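(* Let $f(Z)=\sum_{i=1}^d \alpha_i Z^i\in\mathbb{R}[Z]$ be any polynomial of degree $d\ge 3$, and let $a,q$ be integers with $q\ge 1$, $\gcd(a,q)=1$ and $$\left|\alpha_d-\frac aq\right|<\frac1{q^2}.$$ Let $\ell$ be a positive integer. Then the Weyl sum doubly twisted by the Thue--Morse sequence, $$W_f(r,\ell)=\sum_{0\le n<2^r}t_nt_{n+1}\,\mathbf{e}(\ell f(n)),$$ satisfies $$|W_f(r,\ell)|\le 2^{(1+o(1))r}\left(\ell^{\eta_1(d)}q^{-\eta_1(d)}+\ell^{\vartheta(d)}2^{-\zeta_1(d)r}+2^{-\zeta_2(d)r}+2^{-\zeta_3(d)r}q^{\eta_2(d)}\right)^{1/2}$$ as $r\to\infty$, where $$\eta_1(d)=\frac1{d^2-2d+2},\qquad \eta_2(d)=\frac1{(d-1)^2},\qquad \vartheta(d)=\frac1{d(d-1)},$$ $$\zeta_1(d)=\frac{d-2}{d(d-1)},\qquad \zeta_2(d)=\frac1{d^2-3d+3},\qquad \zeta_3(d)=\frac1{d-1}.$$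
   Context: $\mathbf{e}(z)=\exp(2\pi i z)$. The Thue--Morse sequence is $t_n=(-1)^{\sigma(n)}$, where $\sigma(n)$ is the sum of the binary digits of $n$. The notation $o(1)$ means: for every $\varepsilon>0$ there is $r_0$, depending only on $\varepsilon$ and $d$ (and not on $f,a,q,\ell$), such that for all $r\ge r_0$ the bound holds with $o(1)$ replaced by $\varepsilon$. *)

theory Defs
  imports
    "HOL-Analysis.Analysis"
    "HOL-Computational_Algebra.Polynomial"
begin

fun binary_digit_sum :: "nat \<Rightarrow> nat" where
  "binary_digit_sum n = (if n = 0 then 0 else n mod 2 + binary_digit_sum (n div 2))"

declare binary_digit_sum.simps [simp del]

definition thue_morse :: "nat \<Rightarrow> int" where
  "thue_morse n = (-1) ^ binary_digit_sum n"

definition unit_exp :: "real \<Rightarrow> complex" where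
  "unit_exp x = exp (2 * complex_of_real pi * \<i> * complex_of_real x)"

definition weyl_sum :: "real poly \<Rightarrow> nat \<Rightarrow> nat \<Rightarrow> complex" where
  "weyl_sum f r l =
     (\<Sum>n<2 ^ r. of_int (thue_morse n * thue_morse (n + 1)) *
        unit_exp (real l * poly f (real n)))"

definition eta1 :: "nat \<Rightarrow> real" where
  "eta1 d = 1 / ((real d)\<^sup>2 - 2 * real d + 2)"

definition eta2 :: "nat \<Rightarrow> real" where
  "eta2 d = 1 / (real d - 1)\<^sup>2"

definition vartheta :: "nat \<Rightarrow> real" where
  "vartheta d = 1 / (real d * (real d - 1))"

definition zeta1 :: "nat \<Rightarrow> real" where
  "zeta1 d = (real d - 2) / (real d * (real d - 1))"

definition zeta2 :: "nat \<Rightarrow> real" where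
  "zeta2 d = 1 / ((real d)\<^sup>2 - 3 * real d + 3)"

definition zeta3 :: "nat \<Rightarrow> real" where
  "zeta3 d = 1 / (real d - 1)"

end

(*
  Since t_n t_(n+1) only depends on the 2-adic valuation of n + 1, the doubly twisted sum is, up to
  one term, an alternating sum over v of ordinary Weyl sums of f along the progressions of
  difference 2^(v+1). Hence it is enough to bound Weyl sums with the saving 1 / (d (d - 1)) in the
  exponent, which comes from the sharp form of Vinogradov's mean value theorem in degree d - 1.

  The mean value theorem is obtained from l^2 decoupling for the moment curve over the p-adic
  integers, for a fixed large prime p, where all averages are finite averages over the characters
  x -> e(P(x) / p^M) with deg P <= k. Induction on the degree: after a broad-narrow reduction one
  bounds bilinear averages of |f_I|^(l(l+1)) |f_J|^(k(k+1)-l(l+1)) for separated residue classes I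
  and J. On the scale on which f_J is invariant, f_I can be decoupled in degree l < k; Hoelder's
  inequality then interchanges the roles of I and J. If the optimal exponent were positive, the
  gains of this iteration would grow without bound.

  The passage from mean values to Weyl sums is the classical one: shift the variable, complete the
  resulting incomplete sums, and apply the large sieve in the coefficient of x^(d-1) only.
*)
theory Submission
  imports Defs
begin

section \<open>Inequalities for finite averages\<close>

text \<open>The p-adic setting makes all scales exact: characters trivial on a residue class leave
  its part of the sum unchanged, so no cut-off functions or tails occur, and representatives of
  classes distinct modulo p differ by a unit, so that interpolation between two classes can be
  inverted modulo any power of p. The obstacle is the constant of the broad-narrow step: the narrow
  part costs \<open>4 ^ tri k\<close> at each of the n scales, which for a given prime is a genuine
  power of p ^ n. Hence \<epsilon> is chosen before p, and p so large that this cost per scale is at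
  most p ^ (\<epsilon> / 2). One such prime is enough for the mean value theorem, since every N is a
  power of p up to a factor bounded in terms of p. The saving 1 / (d (d - 1)) is at least half of
  \<open>eta1 d\<close> and half of \<open>zeta2 d\<close>, and so fits under the square root of the
  theorem; for q outside the range where it is applied, one of the four terms is already at least
  1.\<close>

definition avg :: "'a set \<Rightarrow> ('a \<Rightarrow> real) \<Rightarrow> real" where
  "avg A F = (\<Sum>x\<in>A. F x) / real (card A)"

lemma avg_mono: "(\<And>x. x \<in> A \<Longrightarrow> F x \<le> H x) \<Longrightarrow> avg A F \<le> avg A H"
  unfolding avg_def by (intro divide_right_mono sum_mono) auto

lemma avg_nonneg: "(\<And>x. x \<in> A \<Longrightarrow> 0 \<le> F x) \<Longrightarrow> 0 \<le> avg A F"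
  unfolding avg_def by (intro divide_nonneg_nonneg sum_nonneg) auto

lemma avg_cong: "(\<And>x. x \<in> A \<Longrightarrow> F x = H x) \<Longrightarrow> avg A F = avg A H"
  unfolding avg_def by simp

lemma avg_sum: "avg A (\<lambda>x. \<Sum>i\<in>I. F i x) = (\<Sum>i\<in>I. avg A (F i))"
  unfolding avg_def by (subst sum.swap) (simp add: sum_divide_distrib)

lemma avg_add: "avg A (\<lambda>x. F x + H x) = avg A F + avg A H"
  unfolding avg_def by (simp add: sum.distrib add_divide_distrib)

lemma avg_cmult: "avg A (\<lambda>x. c * F x) = c * avg A F"
  unfolding avg_def by (simp add: sum_distrib_left)

lemma avg_swap: "avg A (\<lambda>x. avg B (F x)) = avg B (\<lambda>y. avg A (\<lambda>x. F x y))"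
  unfolding avg_def by (simp add: sum_divide_distrib[symmetric]) (subst sum.swap, simp)

lemma avg_const: "finite A \<Longrightarrow> A \<noteq> {} \<Longrightarrow> avg A (\<lambda>_. c) = c"
  unfolding avg_def by simp

text \<open>The fractional exponents u / (u + v) and v / (u + v) are hidden in a power identity, so
  that later averages involve natural powers only. After X and Y are divided by their sums, the
  claim is the weighted inequality of arithmetic and geometric means, term by term.\<close>

lemma holder_sum:
  fixes T X Y :: "'a \<Rightarrow> real"
  assumes fin: "finite A" and u: "u > 0" and v: "v > 0"
    and nn: "\<And>i. i \<in> A \<Longrightarrow> 0 \<le> T i \<and> 0 \<le> X i \<and> 0 \<le> Y i"
    and eq: "\<And>i. i \<in> A \<Longrightarrow> T i ^ (u + v) = X i ^ u * Y i ^ v"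
  shows "(\<Sum>i\<in>A. T i) ^ (u + v) \<le> (\<Sum>i\<in>A. X i) ^ u * (\<Sum>i\<in>A. Y i) ^ v"
proof -
  define x y where "x = (\<Sum>i\<in>A. X i)" and "y = (\<Sum>i\<in>A. Y i)"
  have xy: "x \<ge> 0" "y \<ge> 0" using nn unfolding x_def y_def by (auto intro!: sum_nonneg)
  show ?thesis
  proof (cases "x = 0 \<or> y = 0")
    case True
    have "T i = 0" if "i \<in> A" for i
    proof -
      have "X i = 0 \<or> Y i = 0"
        using True nn that fin unfolding x_def y_def by (auto simp: sum_nonneg_eq_0_iff)
      then have "T i ^ (u + v) = 0" using eq[OF that] u v by auto
      then show ?thesis by simp
    qed
    then have "(\<Sum>i\<in>A. T i) = 0" by simp
    then have "(\<Sum>i\<in>A. T i) ^ (u + v) = 0" using u by simp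
    then show ?thesis using xy unfolding x_def y_def by (metis mult_nonneg_nonneg zero_le_power)
  next
    case False
    then have pos: "x > 0" "y > 0" using xy by auto
    define \<alpha> \<beta> where "\<alpha> = real u / real (u + v)" and "\<beta> = real v / real (u + v)"
    have ab: "\<alpha> > 0" "\<beta> > 0" "\<alpha> + \<beta> = 1"
      using u v unfolding \<alpha>_def \<beta>_def by (auto simp: divide_simps)
    define t where "t = x powr \<alpha> * y powr \<beta>"
    have tpos: "t > 0" using pos unfolding t_def by simp
    have pw: "(a powr \<alpha> * b powr \<beta>) ^ (u + v) = a ^ u * b ^ v" if "a > 0" "b > 0" for a b :: real
    proof -
      have "(a powr \<alpha> * b powr \<beta>) ^ (u + v) = a powr (\<alpha> * real (u + v)) * b powr (\<beta> * real (u + v))"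
        using that by (simp add: power_mult_distrib powr_powr flip: powr_realpow)
      also have "\<dots> = a powr real u * b powr real v"
        using u v unfolding \<alpha>_def \<beta>_def by simp
      finally show ?thesis using that by (simp add: powr_realpow)
    qed
    have "T i \<le> t * (\<alpha> * (X i / x) + \<beta> * (Y i / y))" if i: "i \<in> A" for i
    proof (cases "X i = 0 \<or> Y i = 0")
      case True
      then have "T i ^ (u + v) = 0" using eq[OF i] u v by auto
      then have "T i = 0" by simp
      then show ?thesis using nn[OF i] tpos ab pos by (auto intro!: mult_nonneg_nonneg add_nonneg_nonneg)
    next
      case False
      then have p: "X i > 0" "Y i > 0" using nn[OF i] by auto
      have "T i ^ (u + v) = (X i powr \<alpha> * Y i powr \<beta>) ^ (u + v)"
        using eq[OF i] pw[OF p] by simp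
      then have "T i = X i powr \<alpha> * Y i powr \<beta>"
        using u nn[OF i] by (metis add_gr_0 mult_nonneg_nonneg power_eq_imp_eq_base powr_ge_zero)
      also have "\<dots> = t * ((X i / x) powr \<alpha> * (Y i / y) powr \<beta>)"
        unfolding t_def using pos p by (simp add: powr_divide)
      also have "\<dots> \<le> t * (\<alpha> * (X i / x) + \<beta> * (Y i / y))"
        using Youngs_inequality_0[of \<alpha> \<beta> "X i / x" "Y i / y"] ab p pos tpos by (intro mult_left_mono) auto
      finally show ?thesis .
    qed
    then have "(\<Sum>i\<in>A. T i) \<le> (\<Sum>i\<in>A. t * (\<alpha> * (X i / x) + \<beta> * (Y i / y)))" by (rule sum_mono)
    also have "\<dots> = t * (\<alpha> * ((\<Sum>i\<in>A. X i) / x) + \<beta> * ((\<Sum>i\<in>A. Y i) / y))"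
      by (simp add: sum.distrib flip: sum_distrib_left sum_divide_distrib)
    also have "\<dots> = t" using pos ab unfolding x_def[symmetric] y_def[symmetric] by simp
    finally have "(\<Sum>i\<in>A. T i) ^ (u + v) \<le> t ^ (u + v)"
      using nn by (intro power_mono sum_nonneg) auto
    also have "\<dots> = x ^ u * y ^ v" unfolding t_def by (rule pw[OF pos])
    finally show ?thesis unfolding x_def y_def .
  qed
qed

lemma holder_avg:
  fixes T X Y :: "'a \<Rightarrow> real"
  assumes fin: "finite A" and u: "u > 0" and v: "v > 0"
    and nn: "\<And>i. i \<in> A \<Longrightarrow> 0 \<le> T i \<and> 0 \<le> X i \<and> 0 \<le> Y i"
    and eq: "\<And>i. i \<in> A \<Longrightarrow> T i ^ (u + v) = X i ^ u * Y i ^ v"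
    and x: "avg A X \<le> x" and y: "avg A Y \<le> y"
  shows "(avg A T) ^ (u + v) \<le> x ^ u * y ^ v"
proof -
  have "(avg A T) ^ (u + v) \<le> (avg A X) ^ u * (avg A Y) ^ v"
    using holder_sum[OF fin u v nn eq] unfolding avg_def
    by (cases "card A = 0") (simp_all add: power_divide power_add divide_right_mono u v)
  also have "\<dots> \<le> x ^ u * y ^ v"
    using x y nn avg_nonneg[of A X] avg_nonneg[of A Y]
    by (intro mult_mono power_mono) (auto intro: zero_le_power order_trans)
  finally show ?thesis .
qed

text \<open>Jensen for the power s with weights proportional to \<open>a\<close>. The weights stay
  free because Minkowski's inequality arises from choosing \<open>a j\<close> as a bound for the
  norm of the j-th function.\<close>

lemma power_sum_le_weighted:
  fixes x a :: "'i \<Rightarrow> real"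
  assumes fin: "finite J" and a: "\<And>j. j \<in> J \<Longrightarrow> a j > 0" and x: "\<And>j. j \<in> J \<Longrightarrow> x j \<ge> 0" and s: "s > 0"
  shows "(\<Sum>j\<in>J. x j) ^ s \<le> (\<Sum>j\<in>J. a j) ^ s * (\<Sum>j\<in>J. (a j / (\<Sum>j\<in>J. a j)) * (x j / a j) ^ s)"
proof (cases "J = {}")
  case True then show ?thesis using s by (simp add: power_0_left)
next
  case False
  define t where "t = (\<Sum>j\<in>J. a j)"
  have t: "t > 0" unfolding t_def using False fin a by (intro sum_pos) auto
  have conv: "convex_on {0..} (\<lambda>x::real. x ^ s)"
    by (metis convex_power_even convex_power_odd convex_on_subset subset_UNIV convex_real_interval(1))
  have "(\<Sum>j\<in>J. (a j / t) *\<^sub>R (x j / a j)) ^ s \<le> (\<Sum>j\<in>J. (a j / t) * (x j / a j) ^ s)"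
  proof (rule convex_on_sum[OF fin False conv])
    show "(\<Sum>j\<in>J. a j / t) = 1" using t unfolding t_def by (simp flip: sum_divide_distrib)
    show "a i / t \<ge> 0" if "i \<in> J" for i using a[OF that] t by simp
    show "x i / a i \<in> {0..}" if "i \<in> J" for i using a[OF that] x[OF that] by simp
  qed
  moreover have "(\<Sum>j\<in>J. (a j / t) *\<^sub>R (x j / a j)) = (\<Sum>j\<in>J. x j) / t"
    unfolding sum_divide_distrib by (rule sum.cong) (use a in force)+
  ultimately have "((\<Sum>j\<in>J. x j) / t) ^ s \<le> (\<Sum>j\<in>J. (a j / t) * (x j / a j) ^ s)" by simp
  then show ?thesis using t unfolding t_def[symmetric]
    by (simp add: power_divide pos_divide_le_eq mult.commute)
qed

lemma minkowski_avg:
  fixes U :: "'a \<Rightarrow> real" and g :: "'i \<Rightarrow> 'a \<Rightarrow> real"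
  assumes J: "finite J" and s: "s > 0"
    and U: "\<And>c. c \<in> A \<Longrightarrow> U c \<ge> 0" and g: "\<And>j c. j \<in> J \<Longrightarrow> c \<in> A \<Longrightarrow> g j c \<ge> 0"
    and a: "\<And>j. j \<in> J \<Longrightarrow> a j \<ge> 0"
    and le: "\<And>j. j \<in> J \<Longrightarrow> avg A (\<lambda>c. U c * g j c ^ s) \<le> a j ^ s"
  shows "avg A (\<lambda>c. U c * (\<Sum>j\<in>J. g j c) ^ s) \<le> (\<Sum>j\<in>J. a j) ^ s"
proof -
  have main: "avg A (\<lambda>c. U c * (\<Sum>j\<in>J. g j c) ^ s) \<le> (\<Sum>j\<in>J. a j) ^ s"
    if a: "\<And>j. j \<in> J \<Longrightarrow> a j > 0" and le: "\<And>j. j \<in> J \<Longrightarrow> avg A (\<lambda>c. U c * g j c ^ s) \<le> a j ^ s" for a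
  proof (cases "J = {}")
    case True
    then show ?thesis using s by (simp add: avg_def power_0_left)
  next
    case False
    define t where "t = (\<Sum>j\<in>J. a j)"
    have t: "t > 0" unfolding t_def using False J a by (intro sum_pos) auto
    have "avg A (\<lambda>c. U c * (\<Sum>j\<in>J. g j c) ^ s) \<le>
        avg A (\<lambda>c. \<Sum>j\<in>J. (t ^ s * (a j / t) / a j ^ s) * (U c * g j c ^ s))"
    proof (rule avg_mono)
      fix c assume c: "c \<in> A"
      have "U c * (\<Sum>j\<in>J. g j c) ^ s \<le> U c * (t ^ s * (\<Sum>j\<in>J. (a j / t) * (g j c / a j) ^ s))"
        unfolding t_def using U[OF c] g[OF _ c] a
        by (intro mult_left_mono power_sum_le_weighted J s) auto
      also have "\<dots> = (\<Sum>j\<in>J. (t ^ s * (a j / t) / a j ^ s) * (U c * g j c ^ s))"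
        by (simp add: sum_distrib_left power_divide mult_ac)
      finally show "U c * (\<Sum>j\<in>J. g j c) ^ s \<le> (\<Sum>j\<in>J. (t ^ s * (a j / t) / a j ^ s) * (U c * g j c ^ s))" .
    qed
    also have "\<dots> = (\<Sum>j\<in>J. (t ^ s * (a j / t) / a j ^ s) * avg A (\<lambda>c. U c * g j c ^ s))"
      unfolding avg_sum avg_cmult ..
    also have "\<dots> \<le> (\<Sum>j\<in>J. (t ^ s * (a j / t) / a j ^ s) * a j ^ s)"
      using le a t by (intro sum_mono mult_left_mono) (auto intro!: less_imp_le[OF divide_pos_pos] mult_pos_pos)
    also have "\<dots> = (\<Sum>j\<in>J. t ^ s * (a j / t))"
    proof (rule sum.cong)
      fix j assume "j \<in> J"
      then have "a j ^ s \<noteq> 0" using a by fastforce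
      then show "(t ^ s * (a j / t) / a j ^ s) * a j ^ s = t ^ s * (a j / t)" by simp
    qed simp
    also have "\<dots> = t ^ s" using t unfolding t_def by (simp flip: sum_distrib_left sum_divide_distrib)
    finally show ?thesis unfolding t_def .
  qed
  \<comment> \<open>The weighted argument divides by \<open>a j\<close>; vanishing bounds are
    reached by raising every \<open>a j\<close> by \<delta> and letting \<delta> tend to 0 from
    above.\<close>
  have "((\<lambda>\<delta>. (\<Sum>j\<in>J. a j + \<delta>) ^ s) \<longlongrightarrow> (\<Sum>j\<in>J. a j + 0) ^ s) (at_right 0)"
    by (intro tendsto_intros)
  then have lim: "((\<lambda>\<delta>. (\<Sum>j\<in>J. a j + \<delta>) ^ s) \<longlongrightarrow> (\<Sum>j\<in>J. a j) ^ s) (at_right 0)"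
    by simp
  show ?thesis
  proof (rule tendsto_lowerbound[OF lim])
    show "\<forall>\<^sub>F \<delta> in at_right 0. avg A (\<lambda>c. U c * (\<Sum>j\<in>J. g j c) ^ s) \<le> (\<Sum>j\<in>J. a j + \<delta>) ^ s"
    proof (rule eventually_at_right_less[THEN eventually_mono])
      fix \<delta> :: real assume d: "0 < \<delta>"
      show "avg A (\<lambda>c. U c * (\<Sum>j\<in>J. g j c) ^ s) \<le> (\<Sum>j\<in>J. a j + \<delta>) ^ s"
      proof (rule main)
        fix j assume j: "j \<in> J"
        show "a j + \<delta> > 0" using a[OF j] d by simp
        have "avg A (\<lambda>c. U c * g j c ^ s) \<le> a j ^ s" by (rule le[OF j])
        also have "\<dots> \<le> (a j + \<delta>) ^ s" using a[OF j] d by (intro power_mono) auto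
        finally show "avg A (\<lambda>c. U c * g j c ^ s) \<le> (a j + \<delta>) ^ s" .
      qed
    qed
  qed simp
qed

lemma power_sum_le_card_power:
  fixes x :: "'i \<Rightarrow> real"
  assumes "finite J" and "\<And>j. j \<in> J \<Longrightarrow> x j \<ge> 0" and "s > 0"
  shows "(\<Sum>j\<in>J. x j) ^ s \<le> real (card J) ^ s * (\<Sum>j\<in>J. x j ^ s)"
proof (cases "J = {}")
  case True then show ?thesis using assms by (simp add: power_0_left)
next
  case False
  then have c: "real (card J) \<ge> 1" using assms(1) by (simp add: Suc_leI card_gt_0_iff)
  have "(\<Sum>j\<in>J. x j) ^ s \<le> (\<Sum>j\<in>J. 1) ^ s * (\<Sum>j\<in>J. (1 / (\<Sum>j\<in>J. 1)) * (x j / 1) ^ s)"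
    using assms by (intro power_sum_le_weighted) auto
  also have "\<dots> = real (card J) ^ s * ((\<Sum>j\<in>J. x j ^ s) / real (card J))"
    by (simp add: sum_divide_distrib)
  also have "\<dots> \<le> real (card J) ^ s * (\<Sum>j\<in>J. x j ^ s)"
  proof (intro mult_left_mono)
    have "(\<Sum>j\<in>J. x j ^ s) * 1 \<le> (\<Sum>j\<in>J. x j ^ s) * real (card J)"
      using assms c by (intro mult_left_mono sum_nonneg) auto
    then show "(\<Sum>j\<in>J. x j ^ s) / real (card J) \<le> (\<Sum>j\<in>J. x j ^ s)"
      using c by (simp add: pos_divide_le_eq)
  qed auto
  finally show ?thesis .
qed

section \<open>Polynomial characters and decoupling constants\<close>

lemma unit_exp_0 [simp]: "unit_exp 0 = 1" by (simp add: unit_exp_def)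

lemma unit_exp_add: "unit_exp (x + y) = unit_exp x * unit_exp y"
  by (simp add: unit_exp_def ring_distribs exp_add)

lemma norm_unit_exp [simp]: "norm (unit_exp x) = 1"
  by (simp add: unit_exp_def)

lemma unit_exp_of_int [simp]: "unit_exp (of_int n) = 1"
  using exp_2pi_1_int[of n] by (simp add: unit_exp_def mult_ac)

lemma unit_exp_add_of_int [simp]: "unit_exp (x + of_int n) = unit_exp x"
  by (simp add: unit_exp_add)

lemma unit_exp_minus: "unit_exp (- x) = cnj (unit_exp x)"
  by (simp add: unit_exp_def exp_cnj)

lemma unit_exp_sum: "unit_exp (\<Sum>i\<in>I. f i) = (\<Prod>i\<in>I. unit_exp (f i))"
  by (induction I rule: infinite_finite_induct) (simp_all add: unit_exp_add)

lemma unit_exp_eq_1_iff: "unit_exp x = 1 \<longleftrightarrow> x \<in> \<int>"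
proof
  assume "unit_exp x = 1"
  then obtain n :: int where "2 * pi * x = of_int (2 * n) * pi"
    unfolding unit_exp_def exp_eq_1 by (auto simp: mult_ac)
  then have "x = of_int n" by simp
  then show "x \<in> \<int>" by simp
qed (auto elim!: Ints_cases)

lemma unit_exp_mod_eq:
  fixes m n Q :: int
  assumes "Q dvd m - n"
  shows "unit_exp (of_int m / of_int Q) = unit_exp (of_int n / of_int Q)"
proof (cases "Q = 0")
  case False
  obtain t where "m - n = Q * t" using assms by (auto elim: dvdE)
  then have "real_of_int m = of_int n + of_int Q * of_int t"
    by (metis add.commute diff_add_cancel of_int_add of_int_mult)
  then have "real_of_int m / of_int Q = of_int n / of_int Q + of_int t"
    using False by (simp add: add_divide_distrib)
  then show ?thesis by simp
qed simp

text \<open>The characters are collected as functions, so polynomials with the same values modulo Q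
  count once. The resulting set is a finite group under pointwise multiplication, and its invariance
  under translation is the source of both the orthogonality relations and the transfer of decoupling
  between degrees and scales.\<close>

definition chars :: "nat \<Rightarrow> int \<Rightarrow> (int \<Rightarrow> complex) set" where
  "chars k Q = (\<lambda>P x. unit_exp (of_int (poly P x) / of_int Q)) ` {P. degree P \<le> k}"

lemma charsI: "degree P \<le> k \<Longrightarrow> (\<lambda>x. unit_exp (of_int (poly P x) / of_int Q)) \<in> chars k Q"
  unfolding chars_def by blast

lemma charsE:
  assumes "\<phi> \<in> chars k Q"
  obtains P where "degree P \<le> k" and "\<phi> = (\<lambda>x. unit_exp (of_int (poly P x) / of_int Q))"
  using assms unfolding chars_def by blast

lemma norm_char [simp]: "\<phi> \<in> chars k Q \<Longrightarrow> norm (\<phi> x) = 1"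
  by (auto elim!: charsE)

lemma chars_nonempty [simp]: "chars k Q \<noteq> {}"
  unfolding chars_def by (auto intro: exI[of _ 0])

lemma finite_chars [simp]:
  assumes "Q > 0" shows "finite (chars k Q)"
proof -
  let ?ch = "\<lambda>c x. unit_exp (of_int (\<Sum>i\<le>k. c i * x ^ i) / of_int Q)"
  have "chars k Q \<subseteq> ?ch ` (PiE {..k} (\<lambda>_. {0..<Q}))"
  proof
    fix \<phi> assume "\<phi> \<in> chars k Q"
    then obtain P where P: "degree P \<le> k" "\<phi> = (\<lambda>x. unit_exp (of_int (poly P x) / of_int Q))"
      by (rule charsE)
    let ?c = "\<lambda>i\<in>{..k}. coeff P i mod Q"
    have "\<phi> = ?ch ?c"
    proof
      fix x
      have "poly P x = (\<Sum>i\<le>k. coeff P i * x ^ i)"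
        unfolding poly_altdef using P(1) by (intro sum.mono_neutral_left) (auto simp: coeff_eq_0)
      moreover have "Q dvd (\<Sum>i\<le>k. coeff P i * x ^ i) - (\<Sum>i\<le>k. ?c i * x ^ i)"
        unfolding sum_subtractf[symmetric]
        by (intro dvd_sum) (auto simp: minus_mod_eq_mult_div simp flip: left_diff_distrib)
      ultimately show "\<phi> x = ?ch ?c x" using unit_exp_mod_eq P(2) by metis
    qed
    moreover have "?c \<in> PiE {..k} (\<lambda>_. {0..<Q})" using assms by auto
    ultimately show "\<phi> \<in> ?ch ` (PiE {..k} (\<lambda>_. {0..<Q}))" by blast
  qed
  then show ?thesis by (rule finite_subset) (intro finite_imageI finite_PiE, auto)
qed

lemma chars_mult:
  assumes "\<phi> \<in> chars k Q" "\<psi> \<in> chars k Q"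
  shows "(\<lambda>x. \<phi> x * \<psi> x) \<in> chars k Q"
proof -
  obtain P where P: "degree P \<le> k" "\<phi> = (\<lambda>x. unit_exp (of_int (poly P x) / of_int Q))"
    using assms(1) by (rule charsE)
  obtain R where R: "degree R \<le> k" "\<psi> = (\<lambda>x. unit_exp (of_int (poly R x) / of_int Q))"
    using assms(2) by (rule charsE)
  have "(\<lambda>x. \<phi> x * \<psi> x) = (\<lambda>x. unit_exp (of_int (poly (P + R) x) / of_int Q))"
    unfolding P R by (auto simp: unit_exp_add add_divide_distrib)
  also have "\<dots> \<in> chars k Q" using P R by (intro charsI degree_add_le)
  finally show ?thesis .
qed

lemma bij_betw_chars_translate:
  assumes Q: "Q > 0" and \<psi>: "\<psi> \<in> chars k Q"
  shows "bij_betw (\<lambda>\<phi> x. \<phi> x * \<psi> x) (chars k Q) (chars k Q)"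
proof -
  let ?t = "\<lambda>\<phi> x. \<phi> x * \<psi> x"
  have inj: "inj_on ?t (chars k Q)"
  proof (rule inj_onI)
    fix \<phi> \<phi>' assume e: "?t \<phi> = ?t \<phi>'"
    show "\<phi> = \<phi>'"
    proof
      fix x
      have "\<psi> x \<noteq> 0" using norm_char[OF \<psi>, of x] by auto
      with fun_cong[OF e, of x] show "\<phi> x = \<phi>' x" by simp
    qed
  qed
  have "?t ` chars k Q = chars k Q"
    using \<psi> Q inj by (intro card_subset_eq) (auto intro: chars_mult simp: card_image)
  then show ?thesis using inj by (simp add: bij_betw_def)
qed

lemma avg_chars_translate:
  assumes "Q > 0" and "\<psi> \<in> chars k Q"
  shows "avg (chars k Q) (\<lambda>\<phi>. F (\<lambda>x. \<phi> x * \<psi> x)) = avg (chars k Q) F"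
  unfolding avg_def by (subst sum.reindex_bij_betw[OF bij_betw_chars_translate[OF assms]]) simp

text \<open>The part of an exponential sum carried by one residue class modulo p ^ a, the analogue
  of an interval of length p ^ (-a). The weight \<open>w\<close> is arbitrary, so that phases can be
  moved into it.\<close>

definition ES :: "nat \<Rightarrow> (int \<Rightarrow> complex) \<Rightarrow> int set \<Rightarrow> nat \<Rightarrow> int \<Rightarrow> (int \<Rightarrow> complex) \<Rightarrow> complex" where
  "ES p w S a \<xi> \<phi> = (\<Sum>x | x \<in> S \<and> int p ^ a dvd x - \<xi>. w x * \<phi> x)"

text \<open>Half of the critical exponent k (k + 1): the power \<open>2 * tri k\<close> of a norm is
  the power \<open>tri k\<close> of its square.\<close>

definition tri :: "nat \<Rightarrow> nat" where "tri k = k * (k + 1) div 2"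

lemma two_tri: "2 * tri k = k * (k + 1)"
  unfolding tri_def by simp

lemma tri_pos: "k \<ge> 1 \<Longrightarrow> tri k > 0"
  using two_tri[of k] by (cases "tri k") auto

text \<open>\<open>C\<close> is an admissible \<open>p\<close>-adic \<open>l\<^sup>2\<close> decoupling constant at the critical exponent \<open>k (k + 1)\<close> for the moment
  curve of degree \<open>k\<close>. The numbers \<open>A j\<close> are upper bounds for the squared \<open>L\<close> norms of the pieces, which avoids roots.\<close>
definition Dec :: "nat \<Rightarrow> nat \<Rightarrow> nat \<Rightarrow> real \<Rightarrow> bool" where
  "Dec p k n C \<longleftrightarrow> (\<forall>w S A. finite S \<longrightarrow>
     (\<forall>j<p ^ n. A j \<ge> 0 \<and>
        avg (chars k (int p ^ (k * n))) (\<lambda>\<phi>. norm (ES p w S n (int j) \<phi>) ^ (2 * tri k)) \<le> A j ^ tri k) \<longrightarrow>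
     avg (chars k (int p ^ (k * n))) (\<lambda>\<phi>. norm (ES p w S 0 0 \<phi>) ^ (2 * tri k)) \<le> C * (\<Sum>j<p ^ n. A j) ^ tri k)"

lemma DecD:
  assumes "Dec p k n C" "finite S"
    and "\<And>j. j < p ^ n \<Longrightarrow> A j \<ge> 0"
    and "\<And>j. j < p ^ n \<Longrightarrow>
      avg (chars k (int p ^ (k * n))) (\<lambda>\<phi>. norm (ES p w S n (int j) \<phi>) ^ (2 * tri k)) \<le> A j ^ tri k"
  shows "avg (chars k (int p ^ (k * n))) (\<lambda>\<phi>. norm (ES p w S 0 0 \<phi>) ^ (2 * tri k)) \<le> C * (\<Sum>j<p ^ n. A j) ^ tri k"
  using assms unfolding Dec_def by blast

lemma Dec_mono:
  assumes "Dec p k n C" "C \<le> C'"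
  shows "Dec p k n C'"
  unfolding Dec_def
proof (intro allI impI)
  fix w S and A :: "nat \<Rightarrow> real"
  assume S: "finite S" and A: "\<forall>j<p ^ n. A j \<ge> 0 \<and>
        avg (chars k (int p ^ (k * n))) (\<lambda>\<phi>. norm (ES p w S n (int j) \<phi>) ^ (2 * tri k)) \<le> A j ^ tri k"
  have "avg (chars k (int p ^ (k * n))) (\<lambda>\<phi>. norm (ES p w S 0 0 \<phi>) ^ (2 * tri k)) \<le> C * (\<Sum>j<p ^ n. A j) ^ tri k"
    using A by (intro DecD[OF assms(1) S]) auto
  also have "\<dots> \<le> C' * (\<Sum>j<p ^ n. A j) ^ tri k"
    using A assms(2) by (intro mult_right_mono zero_le_power sum_nonneg) auto
  finally show "avg (chars k (int p ^ (k * n))) (\<lambda>\<phi>. norm (ES p w S 0 0 \<phi>) ^ (2 * tri k)) \<le> C' * (\<Sum>j<p ^ n. A j) ^ tri k" .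
qed

text \<open>The substitution x = \<xi> + p ^ a z turns the classes inside that of \<xi> into classes
  modulo p ^ m. The old character \<phi> is absorbed into the weight; this is why decoupling is
  asked for all weights at once.\<close>

lemma ES_rescale:
  assumes p: "p > 0" and fac: "\<And>z. \<phi>' (\<xi> + int p ^ a * z) = \<kappa> * \<psi> z"
  shows "ES p w S (a + m) (\<xi> + int p ^ a * j) (\<lambda>x. \<phi> x * \<phi>' x) =
    \<kappa> * ES p (\<lambda>z. w (\<xi> + int p ^ a * z) * \<phi> (\<xi> + int p ^ a * z)) {z. \<xi> + int p ^ a * z \<in> S} m j \<psi>"
proof -
  let ?g = "\<lambda>z. \<xi> + int p ^ a * z"
  have inj: "inj_on ?g X" for X using p by (auto intro!: inj_onI)
  have dv: "int p ^ (a + m) dvd ?g z - ?g j \<longleftrightarrow> int p ^ m dvd z - j" for z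
  proof -
    have "?g z - ?g j = int p ^ a * (z - j)" by (simp add: algebra_simps)
    then show ?thesis using p by (simp add: power_add)
  qed
  have "{x \<in> S. int p ^ (a + m) dvd x - ?g j} = ?g ` {z \<in> {z. ?g z \<in> S}. int p ^ m dvd z - j}"
  proof (intro equalityI subsetI)
    fix x assume x: "x \<in> {x \<in> S. int p ^ (a + m) dvd x - ?g j}"
    then have "int p ^ a dvd x - ?g j" using dvd_trans[of "int p ^ a" "int p ^ (a + m)"] by (simp add: power_add)
    then have "int p ^ a dvd (x - ?g j) + int p ^ a * j" by (intro dvd_add) auto
    then have "int p ^ a dvd x - \<xi>" by (simp add: algebra_simps)
    then obtain z where "x - \<xi> = int p ^ a * z" by (rule dvdE)
    then have "x = ?g z" by simp
    then show "x \<in> ?g ` {z \<in> {z. ?g z \<in> S}. int p ^ m dvd z - j}" using x dv by auto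
  qed (use dv in auto)
  then have "ES p w S (a + m) (?g j) (\<lambda>x. \<phi> x * \<phi>' x) =
      (\<Sum>x \<in> ?g ` {z \<in> {z. ?g z \<in> S}. int p ^ m dvd z - j}. w x * (\<phi> x * \<phi>' x))"
    unfolding ES_def by simp
  also have "\<dots> = (\<Sum>z | z \<in> {z. ?g z \<in> S} \<and> int p ^ m dvd z - j. w (?g z) * (\<phi> (?g z) * \<phi>' (?g z)))"
    by (subst sum.reindex[OF inj]) (simp add: o_def)
  also have "\<dots> = \<kappa> * ES p (\<lambda>z. w (?g z) * \<phi> (?g z)) {z. ?g z \<in> S} m j \<psi>"
    unfolding ES_def sum_distrib_left fac by (intro sum.cong) (auto simp: mult_ac)
  finally show ?thesis .
qed

lemma finite_affine_vimage: "finite S \<Longrightarrow> c \<noteq> 0 \<Longrightarrow> finite {z. \<xi> + c * z \<in> (S :: int set)}"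
  using finite_vimageI[of S "\<lambda>z. \<xi> + c * z"] by (auto simp: vimage_def inj_on_def)

text \<open>Translating by a character that restricts to \<open>\<psi>\<close> on the residue class of \<open>\<xi>\<close> and leaves \<open>U\<close> unchanged, and
  averaging over \<open>\<psi>\<close>, reduces this to decoupling in degree \<open>l\<close>; Minkowski's inequality moves the outer average inside.\<close>
lemma Dec_transfer:
  fixes p :: nat and U :: "(int \<Rightarrow> complex) \<Rightarrow> real"
  assumes p: "p > 0" and l: "l \<ge> 1" and dec: "Dec p l m C" and C: "C \<ge> 0" and S: "finite S" and Q: "Q > 0"
    and U: "\<And>\<phi>. \<phi> \<in> chars k Q \<Longrightarrow> U \<phi> \<ge> 0"
    and ex: "\<And>\<psi>. \<psi> \<in> chars l (int p ^ (l * m)) \<Longrightarrow>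
       \<exists>\<phi>'\<in>chars k Q. (\<forall>\<phi>\<in>chars k Q. U (\<lambda>x. \<phi> x * \<phi>' x) = U \<phi>) \<and>
         (\<exists>\<kappa>. norm \<kappa> = 1 \<and> (\<forall>z. \<phi>' (\<xi> + int p ^ a * z) = \<kappa> * \<psi> z))"
    and A0: "\<And>j. j < p ^ m \<Longrightarrow> A j \<ge> 0"
    and A: "\<And>j. j < p ^ m \<Longrightarrow>
      avg (chars k Q) (\<lambda>\<phi>. U \<phi> * norm (ES p w S (a + m) (\<xi> + int p ^ a * int j) \<phi>) ^ (2 * tri l)) \<le> A j ^ tri l"
  shows "avg (chars k Q) (\<lambda>\<phi>. U \<phi> * norm (ES p w S a \<xi> \<phi>) ^ (2 * tri l)) \<le> C * (\<Sum>j<p ^ m. A j) ^ tri l"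
proof -
  let ?G = "chars k Q" and ?H = "chars l (int p ^ (l * m))"
  have H: "finite ?H" using p by (intro finite_chars) auto
  obtain T \<kappa> where T: "\<And>\<psi>. \<psi> \<in> ?H \<Longrightarrow> T \<psi> \<in> ?G"
    and TU: "\<And>\<psi> \<phi>. \<psi> \<in> ?H \<Longrightarrow> \<phi> \<in> ?G \<Longrightarrow> U (\<lambda>x. \<phi> x * T \<psi> x) = U \<phi>"
    and \<kappa>: "\<And>\<psi>. \<psi> \<in> ?H \<Longrightarrow> norm (\<kappa> \<psi> :: complex) = 1"
    and Tz: "\<And>\<psi> z. \<psi> \<in> ?H \<Longrightarrow> T \<psi> (\<xi> + int p ^ a * z) = \<kappa> \<psi> * \<psi> z"
  proof -
    have "\<exists>\<theta> \<kappa>. \<theta> \<in> ?G \<and> (\<forall>\<phi>\<in>?G. U (\<lambda>x. \<phi> x * \<theta> x) = U \<phi>) \<and> norm (\<kappa> :: complex) = 1 \<and>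
        (\<forall>z. \<theta> (\<xi> + int p ^ a * z) = \<kappa> * \<psi> z)" if "\<psi> \<in> ?H" for \<psi>
      using ex[OF that] by blast
    then obtain T \<kappa> where "\<forall>\<psi>\<in>?H. T \<psi> \<in> ?G \<and> (\<forall>\<phi>\<in>?G. U (\<lambda>x. \<phi> x * T \<psi> x) = U \<phi>) \<and> norm (\<kappa> \<psi> :: complex) = 1 \<and>
        (\<forall>z. T \<psi> (\<xi> + int p ^ a * z) = \<kappa> \<psi> * \<psi> z)"
      by metis
    then show ?thesis by (intro that[of T \<kappa>]) blast+
  qed
  let ?S' = "{z. \<xi> + int p ^ a * z \<in> S}"
  have S': "finite ?S'" using S p by (intro finite_affine_vimage) auto
  let ?w = "\<lambda>\<phi> z. w (\<xi> + int p ^ a * z) * \<phi> (\<xi> + int p ^ a * z)"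
  have nrm: "norm (ES p w S (a + m') (\<xi> + int p ^ a * j) (\<lambda>x. \<phi> x * T \<psi> x)) = norm (ES p (?w \<phi>) ?S' m' j \<psi>)"
    if "\<psi> \<in> ?H" for \<phi> \<psi> m' j
    using ES_rescale[where \<phi>' = "T \<psi>" and \<kappa> = "\<kappa> \<psi>" and \<psi> = \<psi>, OF p Tz[OF that]] \<kappa>[OF that]
    by (simp add: norm_mult)
  have tr: "avg ?G (\<lambda>\<phi>. U \<phi> * norm (ES p w S (a + m') (\<xi> + int p ^ a * j) \<phi>) ^ (2 * tri l)) =
     avg ?G (\<lambda>\<phi>. U \<phi> * avg ?H (\<lambda>\<psi>. norm (ES p (?w \<phi>) ?S' m' j \<psi>) ^ (2 * tri l)))" for m' j
  proof -
    let ?F = "\<lambda>\<phi>. norm (ES p w S (a + m') (\<xi> + int p ^ a * j) \<phi>) ^ (2 * tri l)"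
    have "avg ?G (\<lambda>\<phi>. U \<phi> * ?F \<phi>) = avg ?H (\<lambda>\<psi>. avg ?G (\<lambda>\<phi>. U \<phi> * ?F \<phi>))"
      using H by (simp add: avg_const)
    also have "\<dots> = avg ?H (\<lambda>\<psi>. avg ?G (\<lambda>\<phi>. U (\<lambda>x. \<phi> x * T \<psi> x) * ?F (\<lambda>x. \<phi> x * T \<psi> x)))"
      by (intro avg_cong avg_chars_translate[OF Q T, symmetric])
    also have "\<dots> = avg ?H (\<lambda>\<psi>. avg ?G (\<lambda>\<phi>. U \<phi> * norm (ES p (?w \<phi>) ?S' m' j \<psi>) ^ (2 * tri l)))"
      by (intro avg_cong) (simp add: TU nrm)
    also have "\<dots> = avg ?G (\<lambda>\<phi>. U \<phi> * avg ?H (\<lambda>\<psi>. norm (ES p (?w \<phi>) ?S' m' j \<psi>) ^ (2 * tri l)))"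
      by (subst avg_swap) (simp add: avg_cmult)
    finally show ?thesis .
  qed
  define g where "g j \<phi> = root (tri l) (avg ?H (\<lambda>\<psi>. norm (ES p (?w \<phi>) ?S' m (int j) \<psi>) ^ (2 * tri l)))" for j \<phi>
  have av0: "0 \<le> avg ?H (\<lambda>\<psi>. norm (ES p (?w \<phi>) ?S' m (int j) \<psi>) ^ (2 * tri l))" for \<phi> j
    by (intro avg_nonneg) auto
  have g0: "g j \<phi> \<ge> 0" for j \<phi> unfolding g_def by (intro real_root_ge_zero av0)
  have gp: "g j \<phi> ^ tri l = avg ?H (\<lambda>\<psi>. norm (ES p (?w \<phi>) ?S' m (int j) \<psi>) ^ (2 * tri l))" for j \<phi>
    unfolding g_def using av0 tri_pos[OF l] by simp
  have "avg ?G (\<lambda>\<phi>. U \<phi> * norm (ES p w S a \<xi> \<phi>) ^ (2 * tri l)) =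
     avg ?G (\<lambda>\<phi>. U \<phi> * avg ?H (\<lambda>\<psi>. norm (ES p (?w \<phi>) ?S' 0 0 \<psi>) ^ (2 * tri l)))"
    using tr[of 0 0] by simp
  also have "\<dots> \<le> avg ?G (\<lambda>\<phi>. U \<phi> * (C * (\<Sum>j<p ^ m. g j \<phi>) ^ tri l))"
    using g0 gp by (intro avg_mono mult_left_mono U DecD[OF dec S']) auto
  also have "\<dots> = C * avg ?G (\<lambda>\<phi>. U \<phi> * (\<Sum>j<p ^ m. g j \<phi>) ^ tri l)"
    unfolding avg_cmult[symmetric] by (simp add: mult_ac)
  also have "\<dots> \<le> C * (\<Sum>j<p ^ m. A j) ^ tri l"
  proof (intro mult_left_mono minkowski_avg)
    fix j assume j: "j \<in> {..<p ^ m}"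
    have "avg ?G (\<lambda>\<phi>. U \<phi> * g j \<phi> ^ tri l) =
      avg ?G (\<lambda>\<phi>. U \<phi> * norm (ES p w S (a + m) (\<xi> + int p ^ a * int j) \<phi>) ^ (2 * tri l))"
      unfolding gp tr ..
    also have "\<dots> \<le> A j ^ tri l" using A j by simp
    finally show "avg ?G (\<lambda>\<phi>. U \<phi> * g j \<phi> ^ tri l) \<le> A j ^ tri l" .
  qed (use g0 U A0 C tri_pos[OF l] in auto)
  finally show ?thesis .
qed


section \<open>Characters with a prescribed phase on a residue class\<close>

text \<open>Affine invariance of the moment curve: p ^ (k b) R((x - \<eta>) / p ^ b) has integer
  coefficients because deg R is at most k, and dividing it by p ^ (k n) leaves R(z) / p ^ (k (n -
  b)).\<close>

lemma rescaling_char: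
  fixes p :: nat
  assumes p: "p > 0" and b: "b \<le> n" and \<psi>: "\<psi> \<in> chars k (int p ^ (k * (n - b)))"
  shows "\<exists>\<phi>\<in>chars k (int p ^ (k * n)). \<forall>z. \<phi> (\<eta> + int p ^ b * z) = \<psi> z"
proof -
  obtain R where R: "degree R \<le> k" "\<psi> = (\<lambda>x. unit_exp (of_int (poly R x) / of_int (int p ^ (k * (n - b)))))"
    using \<psi> by (rule charsE)
  define Q where "Q = (\<Sum>m\<le>k. smult (coeff R m * int p ^ (b * (k - m))) ([:-\<eta>, 1:] ^ m))"
  have "degree Q \<le> k"
    unfolding Q_def
    by (intro degree_sum_le) (auto intro!: order.trans[OF degree_smult_le] order.trans[OF degree_power_le])
  moreover have "poly Q (\<eta> + int p ^ b * z) = int p ^ (k * b) * poly R z" for z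
  proof -
    have "poly R z = (\<Sum>m\<le>k. coeff R m * z ^ m)"
      unfolding poly_altdef using R(1) by (intro sum.mono_neutral_left) (auto simp: coeff_eq_0)
    moreover have "coeff R m * int p ^ (b * (k - m)) * (int p ^ b * z) ^ m = int p ^ (k * b) * (coeff R m * z ^ m)"
      if "m \<le> k" for m
    proof -
      have "b * (k - m) + b * m = k * b" using that by (metis distrib_left le_add_diff_inverse2 mult.commute)
      then have "int p ^ (b * (k - m)) * (int p ^ b) ^ m = int p ^ (k * b)"
        by (metis power_add power_mult)
      then show ?thesis by (simp add: power_mult_distrib mult_ac)
    qed
    ultimately show ?thesis unfolding Q_def by (auto simp: poly_sum sum_distrib_left intro!: sum.cong)
  qed
  moreover have "real_of_int (int p ^ (k * b) * t) / of_int (int p ^ (k * n)) = of_int t / of_int (int p ^ (k * (n - b)))" for t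
  proof -
    have "k * n = k * b + k * (n - b)" using b by (metis distrib_left le_add_diff_inverse)
    then show ?thesis using p by (simp add: power_add)
  qed
  ultimately show ?thesis unfolding R(2)
    by (intro bexI[of _ "\<lambda>x. unit_exp (of_int (poly Q x) / of_int (int p ^ (k * n)))"] charsI) auto
qed

lemma poly_antiderivative:
  fixes g :: "int poly"
  assumes "degree g < k"
  shows "\<exists>Q. degree Q \<le> k \<and> coeff Q 0 = 0 \<and> (\<forall>i. of_nat (Suc i) * coeff Q (Suc i) = fact k * coeff g i)"
proof -
  define Q where "Q = (\<Sum>i<k. monom (coeff g i * (fact k div of_nat (Suc i))) (Suc i))"
  have c: "coeff Q (Suc i) = (if i < k then coeff g i * (fact k div of_nat (Suc i)) else 0)" for i
    unfolding Q_def by (simp add: coeff_sum)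
  have "degree Q \<le> k" unfolding Q_def
    by (intro degree_sum_le) (auto intro: order.trans[OF degree_monom_le])
  moreover have "coeff Q 0 = 0" unfolding Q_def by (simp add: coeff_sum)
  moreover have "of_nat (Suc i) * coeff Q (Suc i) = fact k * coeff g i" for i
  proof (cases "i < k")
    case True
    then have "Suc i dvd fact k" by (intro dvd_fact) auto
    then have "int (Suc i) dvd fact k" by (metis of_nat_dvd_iff of_nat_fact)
    then have "int (Suc i) * (fact k div int (Suc i)) = fact k" by (rule dvd_mult_div_cancel)
    then show ?thesis using True unfolding c by (simp add: mult.left_commute mult.commute)
  next
    case False
    then have "coeff g i = 0" using assms by (intro coeff_eq_0) auto
    then show ?thesis unfolding c using False by simp
  qed
  ultimately show ?thesis by blast
qed

text \<open>The witness is the integral of \<open>k! t ^ (k - l) (t - h) ^ (m - 1)\<close> from \<open>0\<close>; the factor \<open>k!\<close> clears the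
  denominators and is a unit modulo \<open>p > k\<close>.\<close>
lemma two_point_poly:
  fixes p :: nat and h :: int
  assumes p: "prime p" "k < p" and l: "l \<le> k" and m: "1 \<le> m" "m \<le> l" and h: "\<not> int p dvd h"
  shows "\<exists>Q. degree Q \<le> k \<and> (\<forall>i\<le>k - l. coeff Q i = 0) \<and>
    (\<forall>j. 1 \<le> j \<and> j < m \<longrightarrow> coeff (pcompose Q [:h, 1:]) j = 0) \<and> \<not> int p dvd coeff (pcompose Q [:h, 1:]) m"
proof -
  define g where "g = monom 1 (k - l) * [:-h, 1:] ^ (m - 1)"
  have "degree g \<le> (k - l) + (m - 1)"
    unfolding g_def by (rule order.trans[OF degree_mult_le])
      (auto intro!: add_mono order.trans[OF degree_power_le] simp: degree_monom_eq)
  then have "degree g < k" using l m by linarith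
  then obtain Q where Q: "degree Q \<le> k" "coeff Q 0 = 0"
    and Qc: "\<And>i. of_nat (Suc i) * coeff Q (Suc i) = fact k * coeff g i"
    using poly_antiderivative by blast
  have low: "coeff Q i = 0" if "i \<le> k - l" for i
  proof (cases i)
    case (Suc j)
    then have "coeff g j = 0" using that unfolding g_def by (simp add: coeff_monom_mult)
    then show ?thesis using Qc[of j] Suc by simp
  qed (use Q in simp)
  define R where "R = pcompose Q [:h, 1:]"
  have "pderiv Q = smult (fact k) g"
    by (rule poly_eqI) (use Qc in \<open>simp add: coeff_pderiv\<close>)
  then have "pderiv R = smult (fact k) (pcompose g [:h, 1:])"
    unfolding R_def by (simp add: pderiv_pcompose pderiv_pCons pcompose_smult)
  also have "pcompose g [:h, 1:] = monom 1 (m - 1) * [:h, 1:] ^ (k - l)"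
    by (subst poly_eq_poly_eq_iff[symmetric]) (simp add: g_def fun_eq_iff poly_pcompose poly_monom mult.commute add.commute)
  finally have Rc: "of_nat (Suc i) * coeff R (Suc i) = fact k * coeff (monom 1 (m - 1) * [:h, 1:] ^ (k - l)) i" for i
    by (metis coeff_pderiv coeff_smult)
  have "coeff R j = 0" if "1 \<le> j" "j < m" for j
  proof -
    obtain i where i: "j = Suc i" using \<open>1 \<le> j\<close> by (cases j) auto
    moreover have "i < m - 1" using i \<open>j < m\<close> by simp
    ultimately show ?thesis using Rc[of i] by (simp add: coeff_monom_mult)
  qed
  moreover have "\<not> int p dvd coeff R m"
  proof
    assume "int p dvd coeff R m"
    then have "int p dvd fact k * h ^ (k - l)"
      using Rc[of "m - 1"] m by (simp add: coeff_monom_mult coeff_0_power) (metis dvd_mult)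
    moreover have pi: "prime (int p)" using p by simp
    ultimately have "int p dvd fact k \<or> int p dvd h ^ (k - l)" by (simp add: prime_dvd_mult_iff)
    moreover have "\<not> int p dvd fact k"
      using prime_dvd_fact_iff[OF p(1), of k] p(2) by (metis leD of_nat_dvd_iff of_nat_fact)
    ultimately show False using h pi prime_dvd_power by blast
  qed
  ultimately show ?thesis using Q low unfolding R_def by blast
qed

text \<open>The two bounds on B say that terms of order above k - l vanish modulo p ^ B on the class
  of \<eta>, and terms of order above l on the class of \<xi>. The polynomial of
  \<open>two_point_poly\<close> therefore vanishes on the former class; on the latter it is a
  constant plus a unit times w ^ m plus terms of orders between m + 1 and l, which are removed by
  descending induction on m.\<close>

lemma monomial_realization:
  fixes p :: nat and \<xi> \<eta> :: int
  assumes p: "prime p" "k < p" and l: "l \<le> k" and h: "\<not> int p dvd \<xi> - \<eta>"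
    and B1: "B \<le> (k - l + 1) * b" and B2: "B \<le> (l + 1) * a" and m: "1 \<le> m" "m \<le> l"
  shows "\<exists>Q c. degree Q \<le> k \<and> (\<forall>x. int p ^ b dvd x - \<eta> \<longrightarrow> int p ^ B dvd poly Q x) \<and>
    (\<forall>w. int p ^ a dvd w \<longrightarrow> int p ^ B dvd poly Q (\<xi> + w) - c - w ^ m)"
  using m
proof (induction "l - m" arbitrary: m rule: less_induct)
  case less
  let ?P = "\<lambda>j Q c. degree Q \<le> k \<and> (\<forall>x. int p ^ b dvd x - \<eta> \<longrightarrow> int p ^ B dvd poly Q x) \<and>
    (\<forall>w. int p ^ a dvd w \<longrightarrow> int p ^ B dvd poly Q (\<xi> + w) - c - w ^ j)"
  have "\<exists>Q c. ?P j Q c" if "m < j" "j \<le> l" for j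
    using less.hyps[of j] that less.prems by auto
  then obtain QQ cc where QQ: "\<And>j. m < j \<Longrightarrow> j \<le> l \<Longrightarrow> ?P j (QQ j) (cc j)" by metis
  obtain Q0 where Q0: "degree Q0 \<le> k" "\<And>i. i \<le> k - l \<Longrightarrow> coeff Q0 i = 0"
    and R0: "\<And>j. 1 \<le> j \<Longrightarrow> j < m \<Longrightarrow> coeff (pcompose Q0 [:\<xi> - \<eta>, 1:]) j = 0"
    and Rm: "\<not> int p dvd coeff (pcompose Q0 [:\<xi> - \<eta>, 1:]) m"
    using two_point_poly[OF p l less.prems h] by blast
  define R where "R = pcompose Q0 [:\<xi> - \<eta>, 1:]"
  have degR: "degree R \<le> k" unfolding R_def using Q0(1) by (simp add: degree_pcompose)
  have "coprime (int p) (coeff R m)" using Rm p unfolding R_def by (simp add: prime_imp_coprime)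
  then have "gcd (coeff R m) (int p ^ B) = 1" by (simp add: coprime_commute)
  \<comment> \<open>The number u inverts the coefficient of w ^ m modulo p ^ B; the separation of
    the two classes modulo p enters through \<open>Rm\<close>.\<close>
  then obtain u v where uv: "u * coeff R m + v * int p ^ B = 1" using bezout_int by metis
  define Q where "Q = smult u (pcompose Q0 [:-\<eta>, 1:]) - (\<Sum>j\<in>{m<..l}. smult (u * coeff R j) (QQ j))"
  define c where "c = u * coeff R 0 - (\<Sum>j\<in>{m<..l}. u * coeff R j * cc j)"
  have "degree Q \<le> k"
    unfolding Q_def using QQ Q0(1)
    by (intro degree_diff_le degree_sum_le) (auto intro!: order.trans[OF degree_smult_le] simp: degree_pcompose)
  moreover have "int p ^ B dvd poly Q x" if x: "int p ^ b dvd x - \<eta>" for x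
  proof -
    have "poly Q0 (x - \<eta>) = (\<Sum>i\<le>degree Q0. coeff Q0 i * (x - \<eta>) ^ i)" by (rule poly_altdef)
    moreover have "int p ^ B dvd coeff Q0 i * (x - \<eta>) ^ i" for i
    proof (cases "i \<le> k - l")
      case False
      then have "(k - l + 1) * b \<le> b * i" by (subst mult.commute, intro mult_le_mono2) simp
      then have "int p ^ B dvd int p ^ (b * i)" using B1 by (intro le_imp_power_dvd) linarith
      also have "\<dots> dvd (x - \<eta>) ^ i" using x by (simp add: power_mult dvd_power_same)
      finally show ?thesis by simp
    qed (use Q0 in simp)
    ultimately have "int p ^ B dvd poly Q0 (x - \<eta>)" by (auto intro!: dvd_sum)
    moreover have "int p ^ B dvd (\<Sum>j\<in>{m<..l}. u * coeff R j * poly (QQ j) x)"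
      using QQ x by (intro dvd_sum dvd_mult) auto
    ultimately show ?thesis unfolding Q_def by (auto simp: poly_sum poly_pcompose)
  qed
  moreover have "int p ^ B dvd poly Q (\<xi> + w) - c - w ^ m" if w: "int p ^ a dvd w" for w
  proof -
    have "poly R w = (\<Sum>j\<le>k. coeff R j * w ^ j)"
      unfolding poly_altdef using degR by (intro sum.mono_neutral_left) (auto simp: coeff_eq_0)
    also have "{..k} = {0} \<union> {1..<m} \<union> {m} \<union> {m<..l} \<union> {l<..k}" using less.prems l by auto
    also have "(\<Sum>j\<in>\<dots>. coeff R j * w ^ j) = coeff R 0 + coeff R m * w ^ m + (\<Sum>j\<in>{m<..l}. coeff R j * w ^ j)
        + (\<Sum>j\<in>{l<..k}. coeff R j * w ^ j)"
      using less.prems R0 by (subst sum.union_disjoint, auto)+ (simp add: R_def)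
    finally have Rw: "poly R w = coeff R 0 + coeff R m * w ^ m + (\<Sum>j\<in>{m<..l}. coeff R j * w ^ j)
        + (\<Sum>j\<in>{l<..k}. coeff R j * w ^ j)" .
    have "poly (pcompose Q0 [:-\<eta>, 1:]) (\<xi> + w) = poly R w"
      unfolding R_def by (simp add: poly_pcompose algebra_simps)
    then have e: "poly Q (\<xi> + w) - c - w ^ m = (u * coeff R m - 1) * w ^ m
       - (\<Sum>j\<in>{m<..l}. u * coeff R j * (poly (QQ j) (\<xi> + w) - cc j - w ^ j)) + u * (\<Sum>j\<in>{l<..k}. coeff R j * w ^ j)"
      unfolding Q_def c_def Rw poly_diff poly_smult poly_sum
      by (simp add: algebra_simps sum.distrib sum_subtractf sum_distrib_left)
    have d1: "int p ^ B dvd (u * coeff R m - 1) * w ^ m"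
    proof -
      have "u * coeff R m - 1 = int p ^ B * (- v)" using uv by (simp add: algebra_simps)
      then show ?thesis by simp
    qed
    have d2: "int p ^ B dvd (\<Sum>j\<in>{m<..l}. u * coeff R j * (poly (QQ j) (\<xi> + w) - cc j - w ^ j))"
      using QQ w by (intro dvd_sum dvd_mult) auto
    have d3: "int p ^ B dvd u * (\<Sum>j\<in>{l<..k}. coeff R j * w ^ j)"
    proof (intro dvd_mult dvd_sum)
      fix j assume "j \<in> {l<..k}"
      then have "(l + 1) * a \<le> a * j" by (subst mult.commute, intro mult_le_mono2) simp
      then have "int p ^ B dvd int p ^ (a * j)" using B2 by (intro le_imp_power_dvd) linarith
      also have "\<dots> dvd w ^ j" using w by (simp add: power_mult dvd_power_same)
      finally show "int p ^ B dvd w ^ j" .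
    qed
    show ?thesis unfolding e by (intro dvd_add dvd_diff d1 d2 d3)
  qed
  ultimately show ?case by blast
qed

text \<open>In the variable x = \<xi> + p ^ a z, a phase R(z) / p ^ (l m) with deg R at most l has
  denominator p ^ (l (a + m)), and this is the precision at which the monomials have to be realised.
  Weighting the j-th of them with p ^ (a (l - j)) gives all the common factor p ^ (l a).\<close>

lemma congruence_char:
  fixes p :: nat and \<xi> \<eta> :: int
  assumes p: "prime p" "k < p" and l: "l \<le> k" and h: "\<not> int p dvd \<xi> - \<eta>"
    and B1: "l * (a + m) \<le> (k - l + 1) * b" and B2: "l * (a + m) \<le> (l + 1) * a" and am: "a + m \<le> n"
    and \<psi>: "\<psi> \<in> chars l (int p ^ (l * m))"
  shows "\<exists>\<phi>\<in>chars k (int p ^ (k * n)). (\<forall>x. int p ^ b dvd x - \<eta> \<longrightarrow> \<phi> x = 1) \<and>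
    (\<exists>\<kappa>. norm \<kappa> = 1 \<and> (\<forall>z. \<phi> (\<xi> + int p ^ a * z) = \<kappa> * \<psi> z))"
proof -
  let ?B = "l * (a + m)"
  have p0: "p > 0" using p by (simp add: prime_gt_0_nat)
  obtain R where R: "degree R \<le> l" "\<psi> = (\<lambda>x. unit_exp (of_int (poly R x) / of_int (int p ^ (l * m))))"
    using \<psi> by (rule charsE)
  let ?P = "\<lambda>j Q c. degree Q \<le> k \<and> (\<forall>x. int p ^ b dvd x - \<eta> \<longrightarrow> int p ^ ?B dvd poly Q x) \<and>
    (\<forall>w. int p ^ a dvd w \<longrightarrow> int p ^ ?B dvd poly Q (\<xi> + w) - c - w ^ j)"
  have "\<exists>Q c. ?P j Q c" if "1 \<le> j" "j \<le> l" for j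
    using monomial_realization[OF p l h B1 B2 that] .
  then obtain QQ cc where QQ: "\<And>j. 1 \<le> j \<Longrightarrow> j \<le> l \<Longrightarrow> ?P j (QQ j) (cc j)" by metis
  define Q where "Q = (\<Sum>j\<in>{1..l}. smult (coeff R j * int p ^ (a * (l - j))) (QQ j))"
  define c where "c = (\<Sum>j\<in>{1..l}. coeff R j * int p ^ (a * (l - j)) * cc j)"
  \<comment> \<open>Raises the denominator to p ^ (k n), so that the character belongs to the group
    over which the averages are taken.\<close>
  define Q' where "Q' = smult (int p ^ (k * n - ?B)) Q"
  have le: "?B \<le> k * n" using l am by (intro mult_le_mono) auto
  then have kn: "int p ^ (k * n) = int p ^ (k * n - ?B) * int p ^ ?B"
    by (simp add: power_add[symmetric])
  have degQ: "degree Q \<le> k"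
    unfolding Q_def using QQ by (intro degree_sum_le) (auto intro!: order.trans[OF degree_smult_le])
  have degQ': "degree Q' \<le> k" unfolding Q'_def using degQ by (auto intro: order.trans[OF degree_smult_le])
  have Q'x: "unit_exp (of_int (poly Q' x) / of_int (int p ^ (k * n))) = unit_exp (of_int (poly Q x) / of_int (int p ^ ?B))" for x
    unfolding Q'_def kn using p0 by simp
  have dvQ: "int p ^ ?B dvd poly Q x" if "int p ^ b dvd x - \<eta>" for x
    unfolding Q_def poly_sum poly_smult using QQ that by (intro dvd_sum dvd_mult) auto
  have val: "int p ^ ?B dvd poly Q (\<xi> + int p ^ a * z) - (c + int p ^ (l * a) * (poly R z - coeff R 0))" for z
  proof -
    have "poly R z = (\<Sum>j\<le>l. coeff R j * z ^ j)"
      unfolding poly_altdef using R(1) by (intro sum.mono_neutral_left) (auto simp: coeff_eq_0)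
    also have "{..l} = insert 0 {1..l}" by auto
    finally have Rz: "poly R z - coeff R 0 = (\<Sum>j\<in>{1..l}. coeff R j * z ^ j)" by simp
    have "int p ^ (l * a) * (coeff R j * z ^ j) = coeff R j * int p ^ (a * (l - j)) * (int p ^ a * z) ^ j"
      if "j \<in> {1..l}" for j
    proof -
      have "a * (l - j) + a * j = l * a"
        using that by (metis atLeastAtMost_iff distrib_left le_add_diff_inverse2 mult.commute)
      then have "int p ^ (a * (l - j)) * (int p ^ a) ^ j = int p ^ (l * a)" by (metis power_add power_mult)
      then show ?thesis by (simp add: power_mult_distrib mult_ac)
    qed
    then have Rs: "int p ^ (l * a) * (poly R z - coeff R 0) =
        (\<Sum>j\<in>{1..l}. coeff R j * int p ^ (a * (l - j)) * (int p ^ a * z) ^ j)"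
      unfolding Rz sum_distrib_left by (rule sum.cong[OF refl])
    have e: "poly Q (\<xi> + int p ^ a * z) - (c + int p ^ (l * a) * (poly R z - coeff R 0)) =
      (\<Sum>j\<in>{1..l}. coeff R j * int p ^ (a * (l - j)) * (poly (QQ j) (\<xi> + int p ^ a * z) - cc j - (int p ^ a * z) ^ j))"
      unfolding Rs unfolding Q_def c_def poly_sum poly_smult sum_subtractf right_diff_distrib by simp
    show ?thesis unfolding e using QQ by (intro dvd_sum dvd_mult) auto
  qed
  define \<kappa> where "\<kappa> = unit_exp (of_int (c - int p ^ (l * a) * coeff R 0) / of_int (int p ^ ?B))"
  let ?\<phi> = "\<lambda>x. unit_exp (of_int (poly Q' x) / of_int (int p ^ (k * n)))"
  have "?\<phi> (\<xi> + int p ^ a * z) = \<kappa> * \<psi> z" for z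
  proof -
    have "?\<phi> (\<xi> + int p ^ a * z) = unit_exp (of_int (c + int p ^ (l * a) * (poly R z - coeff R 0)) / of_int (int p ^ ?B))"
      unfolding Q'x by (rule unit_exp_mod_eq[OF val])
    also have "real_of_int (c + int p ^ (l * a) * (poly R z - coeff R 0)) / of_int (int p ^ ?B)
       = of_int (c - int p ^ (l * a) * coeff R 0) / of_int (int p ^ ?B) + of_int (int p ^ (l * a) * poly R z) / of_int (int p ^ ?B)"
      by (simp add: algebra_simps flip: add_divide_distrib)
    also have "real_of_int (int p ^ (l * a) * poly R z) / of_int (int p ^ ?B) = of_int (poly R z) / of_int (int p ^ (l * m))"
      using p0 by (simp add: power_add distrib_left)
    finally show ?thesis unfolding \<kappa>_def R(2) by (simp add: unit_exp_add)
  qed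
  moreover have "?\<phi> x = 1" if "int p ^ b dvd x - \<eta>" for x
    unfolding Q'x using unit_exp_mod_eq[of "int p ^ ?B" "poly Q x" 0] dvQ[OF that] by simp
  moreover have "norm \<kappa> = 1" unfolding \<kappa>_def by simp
  ultimately show ?thesis using charsI[OF degQ'] by (intro bexI[of _ ?\<phi>]) blast+
qed


section \<open>Bilinear estimates\<close>

lemma ES_split:
  assumes p: "p > 0" and S: "finite S"
  shows "ES p w S a \<xi> \<phi> = (\<Sum>j<p ^ m. ES p w S (a + m) (\<xi> + int p ^ a * int j) \<phi>)"
proof -
  let ?X = "{x \<in> S. int p ^ a dvd x - \<xi>}"
  define g where "g x = nat (((x - \<xi>) div int p ^ a) mod int p ^ m)" for x
  have pm: "int p ^ m > 0" using p by simp
  have "(\<Sum>j\<in>{..<p ^ m}. \<Sum>x | x \<in> ?X \<and> g x = j. w x * \<phi> x) = (\<Sum>x\<in>?X. w x * \<phi> x)"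
  proof (rule sum.group)
    show "g ` ?X \<subseteq> {..<p ^ m}"
    proof
      fix y assume "y \<in> g ` ?X"
      then obtain x where "y = g x" by auto
      moreover have "g x < p ^ m" unfolding g_def
        using pos_mod_bound[OF pm] pos_mod_sign[OF pm] by (simp add: nat_less_iff)
      ultimately show "y \<in> {..<p ^ m}" by simp
    qed
  qed (use S in auto)
  moreover have "{x. x \<in> ?X \<and> g x = j} = {x \<in> S. int p ^ (a + m) dvd x - (\<xi> + int p ^ a * int j)}" if j: "j < p ^ m" for j
  proof -
    have "(int p ^ a dvd x - \<xi> \<and> g x = j) \<longleftrightarrow> int p ^ (a + m) dvd x - (\<xi> + int p ^ a * int j)" for x
    proof (cases "int p ^ a dvd x - \<xi>")
      case True
      then obtain t where t: "x - \<xi> = int p ^ a * t" by (rule dvdE)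
      have "g x = j \<longleftrightarrow> t mod int p ^ m = int j"
        unfolding g_def t using p pos_mod_sign[OF pm] by (auto simp: nat_eq_iff)
      also have "\<dots> \<longleftrightarrow> t mod int p ^ m = int j mod int p ^ m" using j by (simp flip: of_nat_power)
      also have "\<dots> \<longleftrightarrow> int p ^ m dvd t - int j" by (rule mod_eq_dvd_iff)
      also have "\<dots> \<longleftrightarrow> int p ^ (a + m) dvd x - (\<xi> + int p ^ a * int j)"
      proof -
        have "x - (\<xi> + int p ^ a * int j) = int p ^ a * (t - int j)" using t by (simp add: algebra_simps)
        then show ?thesis using p by (simp add: power_add)
      qed
      finally show ?thesis using True by simp
    next
      case False
      have "\<not> int p ^ (a + m) dvd x - (\<xi> + int p ^ a * int j)"
      proof
        assume "int p ^ (a + m) dvd x - (\<xi> + int p ^ a * int j)"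
        then have "int p ^ a dvd x - (\<xi> + int p ^ a * int j)"
          using dvd_trans[of "int p ^ a" "int p ^ (a + m)"] by (simp add: power_add)
        then have "int p ^ a dvd (x - (\<xi> + int p ^ a * int j)) + int p ^ a * int j" by (intro dvd_add) auto
        then show False using False by simp
      qed
      then show ?thesis using False by simp
    qed
    then show ?thesis by auto
  qed
  ultimately show ?thesis unfolding ES_def by simp
qed

lemma ES_mult_trivial:
  assumes "\<And>x. int p ^ b dvd x - \<eta> \<Longrightarrow> \<theta> x = 1"
  shows "ES p w S b \<eta> (\<lambda>x. \<phi> x * \<theta> x) = ES p w S b \<eta> \<phi>"
  unfolding ES_def by (intro sum.cong) (use assms in auto)

lemma tri_add: "tri (l + j) = tri l + tri j + l * j"
proof -
  have "2 * tri (l + j) = 2 * (tri l + tri j + l * j)"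
    unfolding distrib_left two_tri by (simp add: algebra_simps)
  then show ?thesis by simp
qed

lemma tri_mono: "l \<le> k \<Longrightarrow> tri l \<le> tri k"
  unfolding tri_def by (intro div_le_mono mult_le_mono) auto

lemma tri_less: assumes "l < k" shows "tri l < tri k"
  using tri_add[of l "k - l"] tri_pos[of "k - l"] assms by simp

lemma sum_power_le_power_sum:
  fixes x :: "'i \<Rightarrow> real"
  assumes "finite J" and x: "\<And>j. j \<in> J \<Longrightarrow> x j \<ge> 0" and s: "s > 0"
  shows "(\<Sum>j\<in>J. x j ^ s) \<le> (\<Sum>j\<in>J. x j) ^ s"
proof -
  obtain t where t: "s = Suc t" using s by (cases s) auto
  have "(\<Sum>j\<in>J. x j ^ s) \<le> (\<Sum>j\<in>J. x j * (\<Sum>j\<in>J. x j) ^ t)"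
    unfolding t power_Suc using assms
    by (intro sum_mono mult_left_mono power_mono member_le_sum) auto
  also have "\<dots> = (\<Sum>j\<in>J. x j) ^ s" unfolding t by (simp add: sum_distrib_right)
  finally show ?thesis .
qed

text \<open>Either one term dominates all others by a factor \<open>p\<close>, or two different terms are comparable
  to the largest one.\<close>
lemma broad_narrow:
  fixes x :: "nat \<Rightarrow> real"
  assumes p: "p > 0" and x: "\<And>i. i < p \<Longrightarrow> x i \<ge> 0" and F: "0 \<le> F" "F \<le> (\<Sum>i<p. x i)"
  shows "F ^ (2 * (u + v)) \<le> 4 ^ (u + v) * (\<Sum>i<p. x i ^ (2 * (u + v))) +
     real p ^ (4 * (u + v)) * (\<Sum>i<p. \<Sum>j\<in>{..<p} - {i}. x i ^ (2 * u) * x j ^ (2 * v))"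
proof -
  let ?N = "4 ^ (u + v) * (\<Sum>i<p. x i ^ (2 * (u + v)))"
  let ?B = "real p ^ (4 * (u + v)) * (\<Sum>i<p. \<Sum>j\<in>{..<p} - {i}. x i ^ (2 * u) * x j ^ (2 * v))"
  have N0: "?N \<ge> 0" using x by (intro mult_nonneg_nonneg sum_nonneg) auto
  have B0: "?B \<ge> 0" using x by (intro mult_nonneg_nonneg sum_nonneg) auto
  have "finite (x ` {..<p})" "x ` {..<p} \<noteq> {}" using p by auto
  then have "Max (x ` {..<p}) \<in> x ` {..<p}" by (rule Max_in)
  then obtain i where i: "i < p" "x i = Max (x ` {..<p})" by (metis imageE lessThan_iff)
  have mx: "x j \<le> x i" if "j < p" for j using that unfolding i(2) by (intro Max_ge) auto
  have pr: "real p \<ge> 1" using p by simp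
  show ?thesis
  proof (cases "\<forall>j\<in>{..<p} - {i}. x j \<le> x i / real p")
    case True
    \<comment> \<open>The p - 1 other terms are at most \<open>x i / p\<close> each, so the sum is
      at most twice the largest term, with no dependence on p. This matters because the narrow loss
      is paid again at every scale, whereas the broad part contributes an additive term
      there.\<close>
    have "(\<Sum>j<p. x j) = x i + (\<Sum>j\<in>{..<p} - {i}. x j)" using i by (simp add: sum.remove)
    also have "(\<Sum>j\<in>{..<p} - {i}. x j) \<le> real (card ({..<p} - {i})) * (x i / real p)"
      using True by (intro sum_bounded_above) auto
    also have "\<dots> \<le> real p * (x i / real p)"
      using x[OF i(1)] pr i by (intro mult_right_mono) auto
    finally have "F \<le> 2 * x i" using F(2) pr by simp
    then have "F ^ (2 * (u + v)) \<le> (2 * x i) ^ (2 * (u + v))" using F(1) by (rule power_mono)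
    also have "\<dots> = 4 ^ (u + v) * x i ^ (2 * (u + v))"
      unfolding power_mult_distrib power_mult[of 2] by simp
    also have "\<dots> \<le> ?N" using i x by (intro mult_left_mono member_le_sum) auto
    finally show ?thesis using B0 by linarith
  next
    case False
    then obtain j where j: "j < p" "j \<noteq> i" "x i / real p < x j" by force
    have "(\<Sum>j<p. x j) \<le> real (card {..<p}) * x i" using mx by (intro sum_bounded_above) auto
    then have F1: "F \<le> real p * x i" using F(2) by simp
    also have "\<dots> \<le> real p * (real p * x j)" using j(3) pr by (intro mult_left_mono) (auto simp: divide_less_eq mult.commute)
    finally have Fj: "F \<le> real p ^ 2 * x j" by (simp add: power2_eq_square mult_ac)
    have "real p * x i \<le> real p ^ 2 * x i"
      using pr x[OF i(1)] by (intro mult_right_mono) (auto simp: power2_eq_square)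
    then have Fi: "F \<le> real p ^ 2 * x i" using F1 by simp
    have "F ^ (2 * (u + v)) = F ^ (2 * u) * F ^ (2 * v)" by (simp add: power_add distrib_left)
    also have "\<dots> \<le> (real p ^ 2 * x i) ^ (2 * u) * (real p ^ 2 * x j) ^ (2 * v)"
      using Fi Fj F(1) x i(1) j(1) by (intro mult_mono power_mono) auto
    also have "\<dots> = real p ^ (4 * (u + v)) * (x i ^ (2 * u) * x j ^ (2 * v))"
      by (simp add: power_mult_distrib distrib_left power_add flip: power_mult)
    also have "x i ^ (2 * u) * x j ^ (2 * v) \<le> (\<Sum>j\<in>{..<p} - {i}. x i ^ (2 * u) * x j ^ (2 * v))"
      using j x i(1) by (intro member_le_sum) auto
    also have "\<dots> \<le> (\<Sum>i<p. \<Sum>j\<in>{..<p} - {i}. x i ^ (2 * u) * x j ^ (2 * v))"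
      using i x by (intro member_le_sum sum_nonneg) auto
    finally show ?thesis using N0 by (simp add: mult_left_mono)
  qed
qed

section \<open>Averages over two classes separated modulo p\<close>

text \<open>The index of \<open>A\<close> runs over all integers, each standing for its class modulo
  p ^ n, so that classes can be named by shifted representatives without reduction.\<close>

locale bilinear_setting =
  fixes p k n :: nat and w :: "int \<Rightarrow> complex" and S :: "int set" and A :: "int \<Rightarrow> real"
  assumes prime_p: "prime p" and k_less: "k < p" and k_ge: "k \<ge> 2" and finS: "finite S"
    and A_nonneg: "\<And>r. A r \<ge> 0"
    and A_bound: "\<And>r. avg (chars k (int p ^ (k * n))) (\<lambda>\<phi>. norm (ES p w S n r \<phi>) ^ (2 * tri k)) \<le> A r ^ tri k"
begin

abbreviation "G \<equiv> chars k (int p ^ (k * n))"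
abbreviation "f \<equiv> ES p w S"

text \<open>The right-hand side of decoupling for a single class: the bounds for squared norms
  available at the finest scale inside it. It is additive under subdivision.\<close>

definition N :: "nat \<Rightarrow> int \<Rightarrow> real" where
  "N a \<xi> = (\<Sum>j<p ^ (n - a). A (\<xi> + int p ^ a * int j))"

definition Bil :: "nat \<Rightarrow> nat \<Rightarrow> nat \<Rightarrow> real \<Rightarrow> bool" where
  "Bil l a b C \<longleftrightarrow> (\<forall>\<xi> \<eta>. \<not> int p dvd \<xi> - \<eta> \<longrightarrow>
     avg G (\<lambda>\<phi>. norm (f a \<xi> \<phi>) ^ (2 * tri l) * norm (f b \<eta> \<phi>) ^ (2 * (tri k - tri l)))
       \<le> C * N a \<xi> ^ tri l * N b \<eta> ^ (tri k - tri l))"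

lemma p_pos: "p > 0" using prime_p by (simp add: prime_gt_0_nat)

lemma Q_pos: "int p ^ m > 0" using p_pos by simp

lemma finG: "finite G" using Q_pos by (rule finite_chars)

lemma N_nonneg: "N a \<xi> \<ge> 0" unfolding N_def by (intro sum_nonneg A_nonneg)

lemma N_split:
  assumes "a + m \<le> n"
  shows "N a \<xi> = (\<Sum>i<p ^ m. N (a + m) (\<xi> + int p ^ a * int i))"
proof -
  have "N a \<xi> = (\<Sum>j<p ^ (n - (a + m)) * p ^ m. A (\<xi> + int p ^ a * int j))"
    unfolding N_def using assms by (simp flip: power_add)
  also have "\<dots> = (\<Sum>i<p ^ (n - (a + m)). \<Sum>j<p ^ m. A (\<xi> + int p ^ a * int (j + i * p ^ m)))"
    by (rule sum_mult_product)
  also have "\<dots> = (\<Sum>j<p ^ m. \<Sum>i<p ^ (n - (a + m)). A (\<xi> + int p ^ a * int (j + i * p ^ m)))"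
    by (rule sum.swap)
  also have "\<dots> = (\<Sum>i<p ^ m. N (a + m) (\<xi> + int p ^ a * int i))"
    unfolding N_def by (simp add: algebra_simps power_add)
  finally show ?thesis .
qed

text \<open>By rescaling, a class modulo p ^ b is a full problem with n - b scales left.\<close>

lemma class_bound:
  assumes dec: "Dec p k (n - b) D" and D: "D \<ge> 0" and b: "b \<le> n"
  shows "avg G (\<lambda>\<phi>. norm (f b \<eta> \<phi>) ^ (2 * tri k)) \<le> D * N b \<eta> ^ tri k"
proof -
  have "avg G (\<lambda>\<phi>. 1 * norm (f b \<eta> \<phi>) ^ (2 * tri k)) \<le> D * (\<Sum>j<p ^ (n - b). A (\<eta> + int p ^ b * int j)) ^ tri k"
  proof (rule Dec_transfer[OF p_pos _ dec D finS Q_pos])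
    fix \<psi> assume "\<psi> \<in> chars k (int p ^ (k * (n - b)))"
    then obtain \<phi> where "\<phi> \<in> G" "\<And>z. \<phi> (\<eta> + int p ^ b * z) = \<psi> z"
      using rescaling_char[OF p_pos b] by blast
    then show "\<exists>\<phi>'\<in>G. (\<forall>\<phi>\<in>G. (1::real) = 1) \<and> (\<exists>\<kappa>. norm \<kappa> = 1 \<and> (\<forall>z. \<phi>' (\<eta> + int p ^ b * z) = \<kappa> * \<psi> z))"
      by (intro bexI[of _ \<phi>]) (auto intro!: exI[of _ 1])
  next
    fix j
    show "avg G (\<lambda>\<phi>. 1 * norm (f (b + (n - b)) (\<eta> + int p ^ b * int j) \<phi>) ^ (2 * tri k)) \<le> A (\<eta> + int p ^ b * int j) ^ tri k"
      using A_bound b by simp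
  qed (use k_ge A_nonneg in auto)
  then show ?thesis unfolding N_def by simp
qed

lemma BilD:
  "Bil l a b C \<Longrightarrow> \<not> int p dvd \<xi> - \<eta> \<Longrightarrow>
     avg G (\<lambda>\<phi>. norm (f a \<xi> \<phi>) ^ (2 * tri l) * norm (f b \<eta> \<phi>) ^ (2 * (tri k - tri l)))
       \<le> C * N a \<xi> ^ tri l * N b \<eta> ^ (tri k - tri l)"
  unfolding Bil_def by blast

lemma Bil_mono:
  assumes "Bil l a b C" "C \<le> C'" shows "Bil l a b C'"
  unfolding Bil_def
proof (intro allI impI)
  fix \<xi> \<eta> assume "\<not> int p dvd \<xi> - \<eta>"
  note BilD[OF assms(1) this]
  also have "C * N a \<xi> ^ tri l * N b \<eta> ^ (tri k - tri l) \<le> C' * N a \<xi> ^ tri l * N b \<eta> ^ (tri k - tri l)"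
    using assms(2) N_nonneg by (intro mult_right_mono) auto
  finally show "avg G (\<lambda>\<phi>. norm (f a \<xi> \<phi>) ^ (2 * tri l) * norm (f b \<eta> \<phi>) ^ (2 * (tri k - tri l)))
       \<le> C' * N a \<xi> ^ tri l * N b \<eta> ^ (tri k - tri l)" .
qed

lemma not_dvd_shift: "a \<ge> 1 \<Longrightarrow> \<not> int p dvd \<xi> - \<eta> \<Longrightarrow> \<not> int p dvd (\<xi> + int p ^ a * t) - \<eta>"
proof
  assume a: "a \<ge> 1" and nd: "\<not> int p dvd \<xi> - \<eta>" and d: "int p dvd (\<xi> + int p ^ a * t) - \<eta>"
  have "int p dvd int p ^ a * t" using a by (simp add: dvd_power)
  then have "int p dvd ((\<xi> + int p ^ a * t) - \<eta>) - int p ^ a * t" using d by (rule dvd_diff[rotated])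
  then show False using nd by (simp add: algebra_simps)
qed

text \<open>Characters that are trivial on the class of \<open>\<eta>\<close> still realise every polynomial phase of degree \<open>l\<close> on the class
  of \<open>\<xi>\<close>, so the first factor can be decoupled in the lower degree \<open>l\<close> in the presence of the second one.\<close>
lemma Bil_refine:
  assumes bil: "Bil l (a + m) b C" and C: "C \<ge> 0" and dec: "Dec p l m D" and D: "D \<ge> 0"
    and l: "1 \<le> l" "l \<le> k" and am: "a + m \<le> n" and a: "a \<ge> 1"
    and B1: "l * (a + m) \<le> (k - l + 1) * b" and B2: "l * (a + m) \<le> (l + 1) * a"
  shows "Bil l a b (D * C)"
  unfolding Bil_def
proof (intro allI impI)
  fix \<xi> \<eta> assume nd: "\<not> int p dvd \<xi> - \<eta>"
  let ?U = "\<lambda>\<phi>. norm (f b \<eta> \<phi>) ^ (2 * (tri k - tri l))"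
  define V where "V = C * N b \<eta> ^ (tri k - tri l)"
  have V: "V \<ge> 0" unfolding V_def using C N_nonneg by simp
  have tp: "tri l > 0" using tri_pos l by simp
  \<comment> \<open>The bound for the second factor is the same for all j; its root of order
    \<open>tri l\<close> carries it along inside the inputs of \<open>Dec\<close>.\<close>
  define AA where "AA j = root (tri l) V * N (a + m) (\<xi> + int p ^ a * int j)" for j
  have "avg G (\<lambda>\<phi>. ?U \<phi> * norm (f a \<xi> \<phi>) ^ (2 * tri l)) \<le> D * (\<Sum>j<p ^ m. AA j) ^ tri l"
  proof (rule Dec_transfer[OF p_pos l(1) dec D finS Q_pos])
    fix \<psi> assume "\<psi> \<in> chars l (int p ^ (l * m))"
    from congruence_char[OF prime_p k_less l(2) nd B1 B2 am this]
    obtain \<theta> where \<theta>: "\<theta> \<in> G" "\<And>x. int p ^ b dvd x - \<eta> \<Longrightarrow> \<theta> x = 1"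
      "\<exists>\<kappa>. norm \<kappa> = 1 \<and> (\<forall>z. \<theta> (\<xi> + int p ^ a * z) = \<kappa> * \<psi> z)" by blast
    then show "\<exists>\<phi>'\<in>G. (\<forall>\<phi>\<in>G. ?U (\<lambda>x. \<phi> x * \<phi>' x) = ?U \<phi>) \<and> (\<exists>\<kappa>. norm \<kappa> = 1 \<and> (\<forall>z. \<phi>' (\<xi> + int p ^ a * z) = \<kappa> * \<psi> z))"
      by (intro bexI[of _ \<theta>]) (auto simp: ES_mult_trivial)
  next
    fix j
    show "AA j \<ge> 0" unfolding AA_def using V N_nonneg by (intro mult_nonneg_nonneg real_root_ge_zero)
    have "avg G (\<lambda>\<phi>. norm (f (a + m) (\<xi> + int p ^ a * int j) \<phi>) ^ (2 * tri l) * ?U \<phi>)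
        \<le> C * N (a + m) (\<xi> + int p ^ a * int j) ^ tri l * N b \<eta> ^ (tri k - tri l)"
      by (intro BilD[OF bil] not_dvd_shift a nd)
    also have "\<dots> = AA j ^ tri l"
      unfolding AA_def power_mult_distrib using V tp by (simp add: V_def)
    finally show "avg G (\<lambda>\<phi>. ?U \<phi> * norm (f (a + m) (\<xi> + int p ^ a * int j) \<phi>) ^ (2 * tri l)) \<le> AA j ^ tri l"
      by (simp add: mult.commute)
  qed auto
  also have "(\<Sum>j<p ^ m. AA j) = root (tri l) V * N a \<xi>"
    unfolding AA_def N_split[OF am] by (simp add: sum_distrib_left)
  also have "D * \<dots> ^ tri l = D * C * N a \<xi> ^ tri l * N b \<eta> ^ (tri k - tri l)"
    unfolding power_mult_distrib using V tp by (simp add: V_def)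
  finally show "avg G (\<lambda>\<phi>. norm (f a \<xi> \<phi>) ^ (2 * tri l) * ?U \<phi>) \<le> D * C * N a \<xi> ^ tri l * N b \<eta> ^ (tri k - tri l)"
    by (simp add: mult.commute)
qed

text \<open>The source of all gains: if n scales cost p ^ (\<mu> n), the class of \<eta> alone costs
  p ^ (\<mu> (n - b)), which saves \<mu> b in the exponent.\<close>

lemma Bil_zero:
  assumes "Dec p k (n - b) D" "D \<ge> 0" "b \<le> n"
  shows "Bil 0 a b D"
  unfolding Bil_def using class_bound[OF assms] by (simp add: tri_def)

text \<open>The exponent pair of degree l is a convex combination of the pair of degree k - l with
  the classes exchanged, with weight 1 / (k - l + 1), and the pair of degree l - 1, with weight (k -
  l) / (k - l + 1). In the first entry this is the identity (k - l + 1) tri l = tri k - tri (k - l)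
  + (k - l) tri (l - 1).\<close>

lemma Bil_hoelder:
  assumes l: "1 \<le> l" "l < k" and b1: "Bil (k - l) b a C1" and b2: "Bil (l - 1) a b C2"
    and C: "C1 \<ge> 0" "C2 \<ge> 0" "C \<ge> 0" and CC: "C1 * C2 ^ (k - l) \<le> C ^ (k - l + 1)"
  shows "Bil l a b C"
  unfolding Bil_def
proof (intro allI impI)
  fix \<xi> \<eta> assume nd: "\<not> int p dvd \<xi> - \<eta>"
  then have nd': "\<not> int p dvd \<eta> - \<xi>" by (metis dvd_minus_iff minus_diff_eq)
  define j where "j = k - l"
  have j: "j \<ge> 1" and kj: "k = l + j" using l unfolding j_def by auto
  define t where "t = tri (l - 1)"
  have tl: "tri l = t + l"
    using tri_add[of "l - 1" 1] l(1) unfolding t_def by (simp add: tri_def)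
  have e1: "tri k - tri l = tri j + l * j" unfolding kj tri_add by simp
  have e2: "tri k - tri (k - l) = t + l + l * j" unfolding j_def[symmetric] unfolding kj tri_add tl by simp
  have e3: "tri k - tri (l - 1) = l + tri j + l * j" unfolding t_def[symmetric] unfolding kj tri_add tl by simp
  let ?x = "\<lambda>\<phi>. norm (f a \<xi> \<phi>)" and ?y = "\<lambda>\<phi>. norm (f b \<eta> \<phi>)"
  have alg: "(x ^ (2 * (t + l)) * y ^ (2 * (tri j + l * j))) ^ (1 + j) =
      (y ^ (2 * tri j) * x ^ (2 * (t + l + l * j))) ^ 1 * (x ^ (2 * t) * y ^ (2 * (l + tri j + l * j))) ^ j" for x y :: real
  proof -
    have "x ^ (2 * (t + l) * (1 + j)) = x ^ (2 * (t + l + l * j)) * x ^ (2 * t * j)"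
      by (simp add: algebra_simps flip: power_add)
    moreover have "y ^ (2 * (tri j + l * j) * (1 + j)) = y ^ (2 * tri j) * y ^ (2 * (l + tri j + l * j) * j)"
      by (simp add: algebra_simps flip: power_add)
    ultimately show ?thesis
      unfolding power_mult_distrib power_mult[symmetric] power_one_right by (simp only: mult_ac)
  qed
  have alg': "(x ^ (t + l) * y ^ (tri j + l * j)) ^ (1 + j) =
      (y ^ tri j * x ^ (t + l + l * j)) * (x ^ t * y ^ (l + tri j + l * j)) ^ j" for x y :: real
  proof -
    have "x ^ ((t + l) * (1 + j)) = x ^ (t + l + l * j) * x ^ (t * j)"
      by (simp add: algebra_simps flip: power_add)
    moreover have "y ^ ((tri j + l * j) * (1 + j)) = y ^ tri j * y ^ ((l + tri j + l * j) * j)"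
      by (simp add: algebra_simps flip: power_add)
    ultimately show ?thesis
      unfolding power_mult_distrib power_mult[symmetric] by (simp only: mult_ac)
  qed
  let ?T = "\<lambda>\<phi>. ?x \<phi> ^ (2 * (t + l)) * ?y \<phi> ^ (2 * (tri j + l * j))"
  have "(avg G ?T) ^ (1 + j) \<le> (C1 * N b \<eta> ^ tri j * N a \<xi> ^ (t + l + l * j)) ^ 1 *
      (C2 * N a \<xi> ^ t * N b \<eta> ^ (l + tri j + l * j)) ^ j"
  proof (rule holder_avg[OF finG _ _ _ alg])
    show "avg G (\<lambda>\<phi>. ?y \<phi> ^ (2 * tri j) * ?x \<phi> ^ (2 * (t + l + l * j))) \<le> C1 * N b \<eta> ^ tri j * N a \<xi> ^ (t + l + l * j)"
      using BilD[OF b1 nd'] unfolding e2 unfolding j_def[symmetric] .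
    show "avg G (\<lambda>\<phi>. ?x \<phi> ^ (2 * t) * ?y \<phi> ^ (2 * (l + tri j + l * j))) \<le> C2 * N a \<xi> ^ t * N b \<eta> ^ (l + tri j + l * j)"
      using BilD[OF b2 nd] unfolding e3 unfolding t_def[symmetric] .
  qed (use j in auto)
  also have "\<dots> = (C1 * C2 ^ j) * (N a \<xi> ^ (t + l) * N b \<eta> ^ (tri j + l * j)) ^ (1 + j)"
    unfolding alg' by (simp add: power_mult_distrib mult_ac)
  also have "\<dots> \<le> C ^ (j + 1) * (N a \<xi> ^ (t + l) * N b \<eta> ^ (tri j + l * j)) ^ (1 + j)"
    using CC N_nonneg unfolding j_def[symmetric] by (intro mult_right_mono) auto
  also have "\<dots> = (C * N a \<xi> ^ (t + l) * N b \<eta> ^ (tri j + l * j)) ^ Suc j"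
    by (simp add: power_mult_distrib mult_ac)
  finally have "avg G ?T ^ Suc j \<le> (C * N a \<xi> ^ (t + l) * N b \<eta> ^ (tri j + l * j)) ^ Suc j" by simp
  then have "avg G ?T \<le> C * N a \<xi> ^ (t + l) * N b \<eta> ^ (tri j + l * j)"
    by (rule power_le_imp_le_base) (use C N_nonneg in auto)
  then show "avg G (\<lambda>\<phi>. ?x \<phi> ^ (2 * tri l) * ?y \<phi> ^ (2 * (tri k - tri l))) \<le> C * N a \<xi> ^ tri l * N b \<eta> ^ (tri k - tri l)"
    unfolding e1 unfolding tl .
qed

text \<open>Hoelder's inequality between the linear bounds for the two classes. The iteration starts
  here, with gain zero.\<close>

lemma Bil_trivial:
  assumes l: "1 \<le> l" "l < k" and ab: "a \<le> n" "b \<le> n" and D: "D \<ge> 0"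
    and decs: "Dec p k (n - a) D" "Dec p k (n - b) D"
  shows "Bil l a b D"
  unfolding Bil_def
proof (intro allI impI)
  fix \<xi> \<eta>
  define u v where "u = tri l" and "v = tri k - tri l"
  have u: "u > 0" unfolding u_def using tri_pos l by simp
  have v: "v > 0" unfolding v_def using tri_less[OF l(2)] by simp
  have uv: "tri k = u + v" unfolding u_def v_def using tri_mono[of l k] l by simp
  let ?x = "\<lambda>\<phi>. norm (f a \<xi> \<phi>)" and ?y = "\<lambda>\<phi>. norm (f b \<eta> \<phi>)"
  have "(avg G (\<lambda>\<phi>. ?x \<phi> ^ (2 * u) * ?y \<phi> ^ (2 * v))) ^ (u + v) \<le> (D * N a \<xi> ^ (u + v)) ^ u * (D * N b \<eta> ^ (u + v)) ^ v"
  proof (rule holder_avg[OF finG u v])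
    show "avg G (\<lambda>\<phi>. ?x \<phi> ^ (2 * (u + v))) \<le> D * N a \<xi> ^ (u + v)"
      using class_bound[OF decs(1) D ab(1)] unfolding uv .
    show "avg G (\<lambda>\<phi>. ?y \<phi> ^ (2 * (u + v))) \<le> D * N b \<eta> ^ (u + v)"
      using class_bound[OF decs(2) D ab(2)] unfolding uv .
  qed (simp_all add: power_mult_distrib mult_ac flip: power_mult)
  also have "\<dots> = (D * N a \<xi> ^ u * N b \<eta> ^ v) ^ (u + v)"
    by (simp add: power_mult_distrib power_add mult_ac flip: power_mult)
  finally have "avg G (\<lambda>\<phi>. ?x \<phi> ^ (2 * u) * ?y \<phi> ^ (2 * v)) \<le> D * N a \<xi> ^ u * N b \<eta> ^ v"
    by (rule power_mono_iff[THEN iffD1, rotated -1])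
      (use u D N_nonneg in \<open>auto intro!: avg_nonneg mult_nonneg_nonneg\<close>)
  then show "avg G (\<lambda>\<phi>. ?x \<phi> ^ (2 * tri l) * ?y \<phi> ^ (2 * (tri k - tri l))) \<le> D * N a \<xi> ^ tri l * N b \<eta> ^ (tri k - tri l)"
    unfolding u_def v_def .
qed

text \<open>Returning to scale 1 by the triangle inequality loses a fixed power of p ^ (a + b). This
  is affordable because enough rounds of the iteration gain p to any prescribed multiple of
  b.\<close>

lemma Bil_coarsen:
  assumes bil: "Bil l a b C" and l: "1 \<le> l" "l < k" and C: "C \<ge> 0"
    and ab: "1 \<le> a" "a \<le> n" "1 \<le> b" "b \<le> n"
  shows "Bil l 1 1 (real p ^ ((2 * tri k + 1) * (a + b)) * C)"
  unfolding Bil_def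
proof (intro allI impI)
  fix \<xi> \<eta> assume nd: "\<not> int p dvd \<xi> - \<eta>"
  define u v where "u = tri l" and "v = tri k - tri l"
  have u: "u > 0" unfolding u_def using tri_pos l by simp
  have v: "v > 0" unfolding v_def using tri_less[OF l(2)] by simp
  have uv: "tri k = u + v" unfolding u_def v_def using tri_mono[of l k] l by simp
  define \<xi>' \<eta>' where "\<xi>' i = \<xi> + int p ^ 1 * int i" and "\<eta>' i = \<eta> + int p ^ 1 * int i" for i
  have pr: "real p \<ge> 1" using p_pos by simp
  have split: "norm (f 1 \<zeta> \<phi>) ^ (2 * t) \<le> real p ^ ((c - 1) * (2 * t)) * (\<Sum>i<p ^ (c - 1). norm (f c (\<zeta> + int p ^ 1 * int i) \<phi>) ^ (2 * t))"
    if "c \<ge> 1" "t > 0" for c t \<zeta> \<phi>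
  proof -
    have "f 1 \<zeta> \<phi> = (\<Sum>i<p ^ (c - 1). f (1 + (c - 1)) (\<zeta> + int p ^ 1 * int i) \<phi>)"
      by (rule ES_split[OF p_pos finS])
    then have "norm (f 1 \<zeta> \<phi>) \<le> (\<Sum>i<p ^ (c - 1). norm (f c (\<zeta> + int p ^ 1 * int i) \<phi>))"
      using that by (simp add: sum_norm_le)
    then have "norm (f 1 \<zeta> \<phi>) ^ (2 * t) \<le> (\<Sum>i<p ^ (c - 1). norm (f c (\<zeta> + int p ^ 1 * int i) \<phi>)) ^ (2 * t)"
      by (intro power_mono) auto
    also have "\<dots> \<le> real (card {..<p ^ (c - 1)}) ^ (2 * t) * (\<Sum>i<p ^ (c - 1). norm (f c (\<zeta> + int p ^ 1 * int i) \<phi>) ^ (2 * t))"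
      using that by (intro power_sum_le_card_power) auto
    finally show ?thesis by (simp add: power_mult)
  qed
  let ?P = "real p ^ ((a - 1) * (2 * u)) * real p ^ ((b - 1) * (2 * v))"
  have "avg G (\<lambda>\<phi>. norm (f 1 \<xi> \<phi>) ^ (2 * u) * norm (f 1 \<eta> \<phi>) ^ (2 * v)) \<le>
     avg G (\<lambda>\<phi>. ?P * (\<Sum>i<p ^ (a - 1). \<Sum>j<p ^ (b - 1). norm (f a (\<xi>' i) \<phi>) ^ (2 * u) * norm (f b (\<eta>' j) \<phi>) ^ (2 * v)))"
  proof (rule avg_mono)
    fix \<phi>
    have "norm (f 1 \<xi> \<phi>) ^ (2 * u) * norm (f 1 \<eta> \<phi>) ^ (2 * v) \<le>
      (real p ^ ((a - 1) * (2 * u)) * (\<Sum>i<p ^ (a - 1). norm (f a (\<xi>' i) \<phi>) ^ (2 * u))) *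
      (real p ^ ((b - 1) * (2 * v)) * (\<Sum>j<p ^ (b - 1). norm (f b (\<eta>' j) \<phi>) ^ (2 * v)))"
      unfolding \<xi>'_def \<eta>'_def by (intro mult_mono split ab u v mult_nonneg_nonneg sum_nonneg) auto
    also have "\<dots> = ?P * (\<Sum>i<p ^ (a - 1). \<Sum>j<p ^ (b - 1). norm (f a (\<xi>' i) \<phi>) ^ (2 * u) * norm (f b (\<eta>' j) \<phi>) ^ (2 * v))"
      unfolding sum_product[symmetric] by (simp add: mult_ac)
    finally show "norm (f 1 \<xi> \<phi>) ^ (2 * u) * norm (f 1 \<eta> \<phi>) ^ (2 * v) \<le> \<dots>" .
  qed
  also have "\<dots> = ?P * (\<Sum>i<p ^ (a - 1). \<Sum>j<p ^ (b - 1). avg G (\<lambda>\<phi>. norm (f a (\<xi>' i) \<phi>) ^ (2 * u) * norm (f b (\<eta>' j) \<phi>) ^ (2 * v)))"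
    unfolding avg_cmult avg_sum ..
  also have "\<dots> \<le> ?P * (\<Sum>i<p ^ (a - 1). \<Sum>j<p ^ (b - 1). C * N 1 \<xi> ^ u * N 1 \<eta> ^ v)"
  proof (intro mult_left_mono sum_mono)
    fix i j assume i: "i \<in> {..<p ^ (a - 1)}" and j: "j \<in> {..<p ^ (b - 1)}"
    have "\<not> int p dvd \<xi>' i - \<eta>' j"
    proof -
      have "\<not> int p dvd \<xi>' i - \<eta>" unfolding \<xi>'_def by (rule not_dvd_shift[OF _ nd]) simp
      then have "\<not> int p dvd \<eta> - \<xi>' i" by (metis dvd_minus_iff minus_diff_eq)
      then have "\<not> int p dvd \<eta>' j - \<xi>' i" unfolding \<eta>'_def by (rule not_dvd_shift[rotated]) simp
      then show ?thesis by (metis dvd_minus_iff minus_diff_eq)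
    qed
    from BilD[OF bil this]
    have "avg G (\<lambda>\<phi>. norm (f a (\<xi>' i) \<phi>) ^ (2 * u) * norm (f b (\<eta>' j) \<phi>) ^ (2 * v)) \<le> C * N a (\<xi>' i) ^ u * N b (\<eta>' j) ^ v"
      unfolding u_def v_def .
    also have "\<dots> \<le> C * N 1 \<xi> ^ u * N 1 \<eta> ^ v"
    proof (intro mult_mono power_mono)
      have "N (1 + (a - 1)) (\<xi>' i) \<le> N 1 \<xi>"
        unfolding N_split[of 1 "a - 1", OF le_trans[OF _ ab(2)], OF eq_refl[OF le_add_diff_inverse[OF ab(1)]]] \<xi>'_def
        using i N_nonneg by (intro member_le_sum[of i _ "\<lambda>i. N (1 + (a - 1)) (\<xi> + int p ^ 1 * int i)"]) auto
      then show "N a (\<xi>' i) \<le> N 1 \<xi>" using ab by simp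
      have "N (1 + (b - 1)) (\<eta>' j) \<le> N 1 \<eta>"
        unfolding N_split[of 1 "b - 1", OF le_trans[OF _ ab(4)], OF eq_refl[OF le_add_diff_inverse[OF ab(3)]]] \<eta>'_def
        using j N_nonneg by (intro member_le_sum[of j _ "\<lambda>i. N (1 + (b - 1)) (\<eta> + int p ^ 1 * int i)"]) auto
      then show "N b (\<eta>' j) \<le> N 1 \<eta>" using ab by simp
    qed (use C N_nonneg in auto)
    finally show "avg G (\<lambda>\<phi>. norm (f a (\<xi>' i) \<phi>) ^ (2 * u) * norm (f b (\<eta>' j) \<phi>) ^ (2 * v)) \<le> C * N 1 \<xi> ^ u * N 1 \<eta> ^ v" .
  qed auto
  \<comment> \<open>The last two summands of the exponent count the pairs of subclasses; the first
    two come from taking powers of sums.\<close>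
  also have "\<dots> = real p ^ ((a - 1) * (2 * u) + (b - 1) * (2 * v) + (a - 1) + (b - 1)) * (C * N 1 \<xi> ^ u * N 1 \<eta> ^ v)"
    by (simp add: power_add mult_ac)
  also have "\<dots> \<le> real p ^ ((2 * tri k + 1) * (a + b)) * (C * N 1 \<xi> ^ u * N 1 \<eta> ^ v)"
  proof (intro mult_right_mono power_increasing pr)
    have "(a - 1) * (2 * u) \<le> a * (2 * tri k)" "(b - 1) * (2 * v) \<le> b * (2 * tri k)"
      using uv by (intro mult_le_mono; simp)+
    then have "(a - 1) * (2 * u) + (b - 1) * (2 * v) + (a - 1) + (b - 1) \<le> a * (2 * tri k) + b * (2 * tri k) + a + b"
      by linarith
    also have "\<dots> = (2 * tri k + 1) * (a + b)" by (simp add: algebra_simps)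
    finally show "(a - 1) * (2 * u) + (b - 1) * (2 * v) + (a - 1) + (b - 1) \<le> (2 * tri k + 1) * (a + b)" .
  qed (use C N_nonneg in auto)
  finally show "avg G (\<lambda>\<phi>. norm (f 1 \<xi> \<phi>) ^ (2 * tri l) * norm (f 1 \<eta> \<phi>) ^ (2 * (tri k - tri l)))
    \<le> real p ^ ((2 * tri k + 1) * (a + b)) * C * N 1 \<xi> ^ tri l * N 1 \<eta> ^ (tri k - tri l)"
    unfolding u_def v_def by (simp add: mult_ac)
qed

text \<open>Broad-narrow at the coarsest scale. The narrow part is rescaled and costs the linear
  constant at n - 1; in the broad part the sums over two residue classes raise the exponent 4 tri k
  of \<open>broad_narrow\<close> by 2.\<close>

lemma linear_from_bilinear:
  assumes dec: "Dec p k (n - 1) D" "D \<ge> 0" and n: "n \<ge> 1" and l: "1 \<le> l" "l < k"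
    and bil: "Bil l 1 1 C" and C: "C \<ge> 0"
  shows "avg G (\<lambda>\<phi>. norm (f 0 0 \<phi>) ^ (2 * tri k)) \<le> (4 ^ tri k * D + real p ^ (4 * tri k + 2) * C) * N 0 0 ^ tri k"
proof -
  define u v where "u = tri l" and "v = tri k - tri l"
  have u: "u > 0" unfolding u_def using tri_pos l by simp
  have uv: "tri k = u + v" unfolding u_def v_def using tri_mono[of l k] l by simp
  let ?g = "\<lambda>i. f 1 (int i)"
  have Ns: "N 0 0 = (\<Sum>i<p. N 1 (int i))" using N_split[of 0 1 0] n by simp
  have N1: "N 1 (int i) \<le> N 0 0" if "i < p" for i
    unfolding Ns using that N_nonneg by (intro member_le_sum[of i _ "\<lambda>i. N 1 (int i)"]) auto
  have "avg G (\<lambda>\<phi>. norm (f 0 0 \<phi>) ^ (2 * (u + v))) \<le> avg G (\<lambda>\<phi>. 4 ^ (u + v) * (\<Sum>i<p. norm (?g i \<phi>) ^ (2 * (u + v))) +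
     real p ^ (4 * (u + v)) * (\<Sum>i<p. \<Sum>j\<in>{..<p} - {i}. norm (?g i \<phi>) ^ (2 * u) * norm (?g j \<phi>) ^ (2 * v)))"
  proof (intro avg_mono broad_narrow p_pos)
    fix \<phi>
    have "f 0 0 \<phi> = (\<Sum>i<p. ?g i \<phi>)" using ES_split[OF p_pos finS, of w 0 0 \<phi> 1] by simp
    then show "norm (f 0 0 \<phi>) \<le> (\<Sum>i<p. norm (?g i \<phi>))" by (simp add: sum_norm_le)
  qed auto
  also have "\<dots> = 4 ^ (u + v) * (\<Sum>i<p. avg G (\<lambda>\<phi>. norm (?g i \<phi>) ^ (2 * (u + v)))) +
     real p ^ (4 * (u + v)) * (\<Sum>i<p. \<Sum>j\<in>{..<p} - {i}. avg G (\<lambda>\<phi>. norm (?g i \<phi>) ^ (2 * u) * norm (?g j \<phi>) ^ (2 * v)))"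
    unfolding avg_add avg_cmult avg_sum ..
  also have "\<dots> \<le> 4 ^ (u + v) * (\<Sum>i<p. D * N 1 (int i) ^ (u + v)) +
     real p ^ (4 * (u + v)) * (\<Sum>i<p. \<Sum>j\<in>{..<p} - {i}. C * N 0 0 ^ (u + v))"
  proof (intro add_mono mult_left_mono sum_mono)
    fix i
    show "avg G (\<lambda>\<phi>. norm (?g i \<phi>) ^ (2 * (u + v))) \<le> D * N 1 (int i) ^ (u + v)"
      using class_bound[OF dec n] unfolding uv .
  next
    fix i j assume i: "i \<in> {..<p}" and j: "j \<in> {..<p} - {i}"
    have "\<not> int p dvd int i - int j"
    proof
      assume "int p dvd int i - int j"
      then have "int i mod int p = int j mod int p" by (simp add: mod_eq_dvd_iff)
      then show False using i j by auto
    qed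
    from BilD[OF bil this]
    have "avg G (\<lambda>\<phi>. norm (?g i \<phi>) ^ (2 * u) * norm (?g j \<phi>) ^ (2 * v)) \<le> C * N 1 (int i) ^ u * N 1 (int j) ^ v"
      unfolding u_def v_def .
    also have "\<dots> \<le> C * N 0 0 ^ u * N 0 0 ^ v"
      using i j N_nonneg N1 C by (intro mult_mono power_mono) auto
    finally show "avg G (\<lambda>\<phi>. norm (?g i \<phi>) ^ (2 * u) * norm (?g j \<phi>) ^ (2 * v)) \<le> C * N 0 0 ^ (u + v)"
      by (simp add: power_add mult_ac)
  qed auto
  also have "\<dots> \<le> 4 ^ (u + v) * (D * N 0 0 ^ (u + v)) + real p ^ (4 * (u + v)) * (real p * (real p * (C * N 0 0 ^ (u + v))))"
  proof (intro add_mono mult_left_mono)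
    have "(\<Sum>i<p. N 1 (int i) ^ (u + v)) \<le> N 0 0 ^ (u + v)"
      unfolding Ns using u N_nonneg by (intro sum_power_le_power_sum) auto
    then show "(\<Sum>i<p. D * N 1 (int i) ^ (u + v)) \<le> D * N 0 0 ^ (u + v)"
      using dec(2) by (simp add: mult_left_mono flip: sum_distrib_left)
    have nn: "C * N 0 0 ^ (u + v) \<ge> 0" using C N_nonneg by simp
    have "(\<Sum>j\<in>{..<p} - {i}. C * N 0 0 ^ (u + v)) \<le> real p * (C * N 0 0 ^ (u + v))" if "i \<in> {..<p}" for i
      using that nn by (simp add: mult_right_mono)
    then have "(\<Sum>i<p. \<Sum>j\<in>{..<p} - {i}. C * N 0 0 ^ (u + v)) \<le> (\<Sum>i<p. real p * (C * N 0 0 ^ (u + v)))"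
      by (rule sum_mono)
    then show "(\<Sum>i<p. \<Sum>j\<in>{..<p} - {i}. C * N 0 0 ^ (u + v)) \<le> real p * (real p * (C * N 0 0 ^ (u + v)))" by simp
  qed auto
  finally show ?thesis unfolding uv by (simp add: algebra_simps power_add power2_eq_square)
qed

end


section \<open>The decoupling theorem\<close>

context bilinear_setting
begin

text \<open>A single refinement may add at most a / l to the scale a, so a' is reached by steps of
  that length. Each full step has length m at least m0, so C0 is at most p ^ (\<epsilon> m) and is
  absorbed by doubling \<epsilon>. Only the last, possibly short, step leaves C0 visible, whence a
  single factor C0 however long the chain.\<close>

lemma Bil_refine_chain:
  assumes decl: "\<And>m. Dec p l m (C0 * real p powr (\<epsilon> * real m))" and C0: "C0 \<ge> 1" "C0 \<le> real p powr (\<epsilon> * real m0)"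
    and \<epsilon>: "\<epsilon> \<ge> 0" and m0: "m0 \<ge> 1" and l: "1 \<le> l" "l < k"
    and "l * m0 \<le> a" "a \<le> a'" and a': "a' \<le> n" "l * a' \<le> (k - l + 1) * b"
    and bil: "Bil l a' b C" and C: "C \<ge> 0"
  shows "Bil l a b (C0 * real p powr (2 * \<epsilon> * real (a' - a)) * C)"
  using assms(8,9)
proof (induction "a' - a" arbitrary: a rule: less_induct)
  case less
  have pr: "real p \<ge> 1" using p_pos by simp
  have "0 < l * m0" using l m0 by simp
  then have a1: "a \<ge> 1" using less.prems by linarith
  show ?case
  proof (cases "a' - a \<le> a div l")
    case True
    let ?m = "a' - a"
    have "l * ?m \<le> l * (a div l)" using True by (rule mult_le_mono2)
    also have "\<dots> \<le> a" by (rule times_div_less_eq_dividend)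
    finally have B2: "l * (a + ?m) \<le> (l + 1) * a"
      unfolding distrib_left add_mult_distrib by linarith
    have "Bil l a b (C0 * real p powr (\<epsilon> * real ?m) * C)"
      by (rule Bil_refine[OF _ C decl]) (use bil C0 l less.prems a' a1 B2 in auto)
    then show ?thesis
      by (rule Bil_mono) (use C0 C \<epsilon> pr in \<open>auto intro!: mult_right_mono mult_left_mono powr_mono\<close>)
  next
    case False
    define m where "m = a div l"
    have m: "m0 \<le> m" unfolding m_def using less.prems l
      by (metis less_eq_div_iff_mult_less_eq mult.commute zero_less_one order_less_le_trans)
    have am: "a + m < a'" using False unfolding m_def by simp
    have b1: "Bil l (a + m) b (C0 * real p powr (2 * \<epsilon> * real (a' - (a + m))) * C)"
      by (rule less.hyps) (use am m m0 less.prems in auto)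
    have b2: "l * (a + m) \<le> (l + 1) * a"
      using times_div_less_eq_dividend[of l a] unfolding m_def by (simp add: distrib_left)
    have b3: "l * (a + m) \<le> (k - l + 1) * b"
      using am a'(2) by (meson le_trans less_imp_le mult_le_mono2)
    have "Bil l a b ((C0 * real p powr (\<epsilon> * real m)) * (C0 * real p powr (2 * \<epsilon> * real (a' - (a + m))) * C))"
      by (rule Bil_refine[OF b1 _ decl _ _ _ _ _ b3 b2]) (use C0 C l a' am a1 in auto)
    then show ?thesis
    proof (rule Bil_mono)
      have "C0 \<le> real p powr (\<epsilon> * real m)"
        by (rule order.trans[OF C0(2)]) (use \<epsilon> m pr in \<open>intro powr_mono mult_left_mono, auto\<close>)
      then have "C0 * real p powr (\<epsilon> * real m) \<le> real p powr (\<epsilon> * real m) * real p powr (\<epsilon> * real m)"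
        by (intro mult_right_mono) auto
      also have "\<dots> = real p powr (2 * \<epsilon> * real m)"
        by (simp add: mult.assoc flip: powr_add)
      finally have "(C0 * real p powr (\<epsilon> * real m)) * (C0 * real p powr (2 * \<epsilon> * real (a' - (a + m))) * C)
         \<le> real p powr (2 * \<epsilon> * real m) * (C0 * real p powr (2 * \<epsilon> * real (a' - (a + m))) * C)"
        using C0 C by (intro mult_right_mono) auto
      also have "\<dots> = C0 * (real p powr (2 * \<epsilon> * real m) * real p powr (2 * \<epsilon> * real (a' - (a + m)))) * C" by simp
      also have "real p powr (2 * \<epsilon> * real m) * real p powr (2 * \<epsilon> * real (a' - (a + m))) = real p powr (2 * \<epsilon> * real (a' - a))"
        using am by (simp add: algebra_simps flip: powr_add)
      finally show "(C0 * real p powr (\<epsilon> * real m)) * (C0 * real p powr (2 * \<epsilon> * real (a' - (a + m))) * C)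
         \<le> C0 * real p powr (2 * \<epsilon> * real (a' - a)) * C" .
    qed
  qed
qed

end

text \<open>The gains produced by \<open>t\<close> rounds of the scheme: in \<open>Bil l a b\<close> with \<open>a = (k - l + 1) b / l\<close> the trivial
  exponent \<open>\<mu> n\<close> is lowered by \<open>gain k \<mu> t l * b\<close>.\<close>
primrec gain :: "nat \<Rightarrow> real \<Rightarrow> nat \<Rightarrow> nat \<Rightarrow> real" where
  "gain k \<mu> 0 l = (if l = 0 then \<mu> else 0)"
| "gain k \<mu> (Suc t) l = (if l = 0 then \<mu> else
     gain k \<mu> t (k - l) / real l + real (k - l) / real (k - l + 1) * gain k \<mu> t (l - 1))"

lemma gain_0: "gain k \<mu> t 0 = \<mu>"
  by (cases t) auto

text \<open>The sum over \<open>l\<close> is a linear functional which every round increases by the same amount.\<close>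
lemma sum_gain:
  assumes k: "k \<ge> 2"
  shows "(\<Sum>l\<in>{1..<k}. gain k \<mu> t l) = real t * (\<mu> * (real k - 1) / real k)"
proof (induction t)
  case (Suc t)
  let ?x = "gain k \<mu> t"
  have "(\<Sum>l\<in>{1..<k}. ?x (k - l) / real l) = (\<Sum>m\<in>{1..<k}. ?x m / real (k - m))"
    by (rule sum.reindex_bij_witness[of _ "\<lambda>m. k - m" "\<lambda>m. k - m"]) auto
  moreover have "(\<Sum>l\<in>{1..<k}. real (k - l) / real (k - l + 1) * ?x (l - 1)) =
     (\<Sum>m\<in>{0..<k - 1}. real (k - m - 1) / real (k - m) * ?x m)"
    by (rule sum.reindex_bij_witness[of _ "\<lambda>m. m + 1" "\<lambda>m. m - 1"]) (auto simp: Suc_diff_le)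
  moreover have "(\<Sum>m\<in>{0..<k - 1}. real (k - m - 1) / real (k - m) * ?x m) = (\<Sum>m\<in>{0..<k}. real (k - m - 1) / real (k - m) * ?x m)"
    using k by (intro sum.mono_neutral_left) auto
  moreover have "(\<Sum>m\<in>{0..<k}. real (k - m - 1) / real (k - m) * ?x m) =
     real (k - 1) / real k * \<mu> + (\<Sum>m\<in>{1..<k}. real (k - m - 1) / real (k - m) * ?x m)"
    using k by (simp add: sum.atLeast_Suc_lessThan gain_0)
  \<comment> \<open>The value at m enters the next round through l = k - m with weight 1 / (k - m)
    and through l = m + 1 with weight (k - m - 1) / (k - m). These weights add up to 1, and the
    fresh input is that of m = 0, which is \<mu> (k - 1) / k.\<close>
  moreover have "(\<Sum>m\<in>{1..<k}. ?x m / real (k - m)) + (\<Sum>m\<in>{1..<k}. real (k - m - 1) / real (k - m) * ?x m) = (\<Sum>m\<in>{1..<k}. ?x m)"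
    unfolding sum.distrib[symmetric]
  proof (rule sum.cong)
    fix m assume m: "m \<in> {1..<k}"
    have "?x m / real (k - m) + real (k - m - 1) / real (k - m) * ?x m = (1 + real (k - m - 1)) / real (k - m) * ?x m"
      by (simp add: add_divide_distrib distrib_right)
    also have "1 + real (k - m - 1) = real (k - m)" using m by auto
    finally show "?x m / real (k - m) + real (k - m - 1) / real (k - m) * ?x m = ?x m" using m by simp
  qed simp
  ultimately have S: "(\<Sum>l\<in>{1..<k}. gain k \<mu> (Suc t) l) = real (k - 1) / real k * \<mu> + (\<Sum>m\<in>{1..<k}. ?x m)"
    by (simp add: sum.distrib)
  show ?case unfolding S Suc using k by (simp add: field_simps of_nat_diff)
qed simp

context bilinear_setting
begin

text \<open>One round passes from b to c = (k - l + 1) b / l, which lies between b / k and k b. So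
  each round asks for one more factor \<open>fact k\<close> in b, to keep the divisions exact, one
  more factor k between b and n, and one more factor k between m0 and b, so that chains of
  refinements can start.\<close>

lemma Bil_iterate:
  assumes decl: "\<And>l m. 1 \<le> l \<Longrightarrow> l < k \<Longrightarrow> Dec p l m (C0 * real p powr (\<epsilon> * real m))"
    and C0: "C0 \<ge> 1" "C0 \<le> real p powr (\<epsilon> * real m0)" and \<epsilon>: "\<epsilon> \<ge> 0" and m0: "m0 \<ge> 1"
    and deck: "\<And>m. Dec p k m (K * real p powr (\<mu> * real m))" and K: "K \<ge> 0" and lam: "\<mu> \<ge> 0"
    and "1 \<le> l" "l < k" "fact k ^ t dvd b" "b * k ^ (t + 1) \<le> n" "k ^ t * (k * m0) \<le> b"
  shows "Bil l ((k - l + 1) * b div l) b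
     (K * C0 ^ t * real p powr (\<mu> * real n - gain k \<mu> t l * real b + 2 * real t * \<epsilon> * real n))"
  using assms(9-)
proof (induction t arbitrary: l b)
  case 0
  have pr: "real p \<ge> 1" using p_pos by simp
  have "(k - l + 1) * b div l \<le> (k - l + 1) * b" by (rule div_le_dividend)
  also have "\<dots> \<le> k * b" using 0 by (intro mult_le_mono1) auto
  finally have a: "(k - l + 1) * b div l \<le> n" using 0 by (simp add: mult.commute)
  have "b \<le> b * k" using k_ge by simp
  also have "\<dots> \<le> n" using 0 by simp
  finally have b: "b \<le> n" .
  have dec: "Dec p k (n - c) (K * real p powr (\<mu> * real n))" if "c \<le> n" for c
    by (rule Dec_mono[OF deck]) (use K lam pr in \<open>auto intro!: mult_left_mono powr_mono\<close>)
  show ?case using 0 Bil_trivial[OF 0(1,2) a b _ dec[OF a] dec[OF b]] K by simp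
next
  case (Suc t)
  note l = Suc.prems(1,2)
  have pr: "real p \<ge> 1" using p_pos by simp
  define c where "c = (k - l + 1) * b div l"
  obtain e where e: "b = fact k ^ (Suc t) * e" using Suc.prems(3) by (rule dvdE)
  have "l dvd fact k" using l by (intro dvd_fact) auto
  then obtain g where g: "fact k = l * g" by (rule dvdE)
  have bl: "b = l * (g * fact k ^ t * e)" unfolding e power_Suc using g by simp
  have c_eq: "c = (k - l + 1) * (g * fact k ^ t * e)"
    unfolding c_def using bl l by (metis mult.left_commute nonzero_mult_div_cancel_left not_one_le_zero)
  have lc: "l * c = (k - l + 1) * b" unfolding c_eq bl by (rule mult.left_commute)
  have fc: "fact k ^ t dvd c" unfolding c_eq by simp
  have fb: "fact k ^ t dvd b" using Suc.prems(3) by (rule power_le_dvd) simp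
  have c_le: "c \<le> k * b"
  proof -
    have "c \<le> (k - l + 1) * b" unfolding c_def by (rule div_le_dividend)
    also have "\<dots> \<le> k * b" using l by (intro mult_le_mono1) auto
    finally show ?thesis .
  qed
  have kb: "k * b * k ^ (t + 1) \<le> n" using Suc.prems(4) by (simp add: mult_ac)
  have cn: "c * k ^ (t + 1) \<le> n" using c_le kb by (meson le_trans mult_le_mono1)
  have bn: "b * k ^ (t + 1) \<le> n"
  proof -
    have "1 * b \<le> k * b" using k_ge by (intro mult_le_mono1) auto
    then show ?thesis using kb by (metis le_trans mult_1 mult_le_mono1)
  qed
  have kcn: "k * c \<le> n"
  proof -
    have "k * 1 \<le> k * k ^ t" using k_ge by (intro mult_le_mono2) simp
    then have "k * c \<le> k * k ^ t * c" by (metis mult.right_neutral mult_le_mono1)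
    then have "k * c \<le> c * k ^ (t + 1)" by (simp only: power_add power_one_right mult_ac)
    then show ?thesis using cn by (rule le_trans)
  qed
  have kbn: "k * b \<le> n"
  proof -
    have "k * 1 \<le> k * k ^ t" using k_ge by (intro mult_le_mono2) simp
    then have "k * b \<le> k * k ^ t * b" by (metis mult.right_neutral mult_le_mono1)
    then have "k * b \<le> b * k ^ (t + 1)" by (simp only: power_add power_one_right mult_ac)
    then show ?thesis using bn by (rule le_trans)
  qed
  have b_ge: "k * (k ^ t * (k * m0)) \<le> b" using Suc.prems(5) by (simp add: mult_ac)
  have c_ge: "k ^ t * (k * m0) \<le> c"
  proof -
    have "1 * b \<le> (k - l + 1) * b" by (intro mult_le_mono1) simp
    also have "\<dots> = l * c" by (rule lc[symmetric])
    also have "\<dots> \<le> k * c" using l by (intro mult_le_mono1) auto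
    finally have "k * (k ^ t * (k * m0)) \<le> k * c" using b_ge by linarith
    then show ?thesis by (rule mult_le_cancel1[THEN iffD1, THEN mp]) (use k_ge in simp)
  qed
  have b_ge': "k ^ t * (k * m0) \<le> b"
  proof -
    have "1 * (k ^ t * (k * m0)) \<le> k * (k ^ t * (k * m0))" using k_ge by (intro mult_le_mono1) auto
    then show ?thesis using b_ge by linarith
  qed
  have km: "k * m0 \<le> k ^ t * (k * m0)" using k_ge by simp
  have big: "l' * m0 \<le> b" "l' * m0 \<le> c" if "l' < k" for l'
  proof -
    have "l' * m0 \<le> k * m0" using that by (intro mult_le_mono1) auto
    then show "l' * m0 \<le> b" "l' * m0 \<le> c" using km b_ge' c_ge by linarith+
  qed
  let ?E0 = "2 * real (Suc t) * \<epsilon> * real n"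
  have loss: "C0 * real p powr (2 * \<epsilon> * real (a' - a)) * (K * C0 ^ t * real p powr (x + 2 * real t * \<epsilon> * real n))
      \<le> K * C0 ^ Suc t * real p powr (x + ?E0)" if "a' \<le> n" for a a' x
  proof -
    have "2 * \<epsilon> * real (a' - a) \<le> 2 * \<epsilon> * real n" using that \<epsilon> by (intro mult_left_mono) auto
    then have "real p powr (2 * \<epsilon> * real (a' - a)) * real p powr (x + 2 * real t * \<epsilon> * real n) \<le> real p powr (x + ?E0)"
      unfolding powr_add[symmetric] using pr by (intro powr_mono) (auto simp: algebra_simps)
    then have "K * C0 ^ Suc t * (real p powr (2 * \<epsilon> * real (a' - a)) * real p powr (x + 2 * real t * \<epsilon> * real n))
       \<le> K * C0 ^ Suc t * real p powr (x + ?E0)"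
      using K C0 by (intro mult_left_mono) auto
    then show ?thesis by (simp add: mult_ac)
  qed
  define x1 where "x1 = \<mu> * real n - gain k \<mu> t (k - l) * real c"
  define x2 where "x2 = \<mu> * real n - gain k \<mu> t (l - 1) * real b"
  \<comment> \<open>The classes have changed places: b is now the scale of the class to be refined.
    Refining it up to (l + 1) c / (k - l) brings in the induction hypothesis for degree k - l at
    scale c.\<close>
  have B1: "Bil (k - l) b c (K * C0 ^ Suc t * real p powr (x1 + ?E0))"
  proof -
    define a' where "a' = (l + 1) * c div (k - l)"
    have kl: "1 \<le> k - l" "k - l < k" "k - (k - l) + 1 = l + 1" using l by auto
    have bil: "Bil (k - l) a' c (K * C0 ^ t * real p powr (x1 + 2 * real t * \<epsilon> * real n))"
      using Suc.IH[OF kl(1,2) fc cn c_ge] unfolding kl(3) a'_def x1_def .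
    have "a' \<le> (l + 1) * c" unfolding a'_def by (rule div_le_dividend)
    moreover have "(l + 1) * c \<le> k * c" using l by (intro mult_le_mono1) simp
    ultimately have a'n: "a' \<le> n" using kcn by linarith
    have a'2: "(k - l) * a' \<le> (k - (k - l) + 1) * c"
      unfolding kl(3) a'_def by (rule times_div_less_eq_dividend)
    have ba': "b \<le> a'"
    proof -
      have "l * (b * (k - l)) \<le> (l + 1) * ((k - l + 1) * b)" by (simp add: algebra_simps)
      also have "\<dots> = l * ((l + 1) * c)" unfolding lc[symmetric] by (rule mult.left_commute)
      finally have "b * (k - l) \<le> (l + 1) * c" using l by simp
      then show ?thesis unfolding a'_def using kl by (simp add: less_eq_div_iff_mult_less_eq)
    qed
    have "Bil (k - l) b c (C0 * real p powr (2 * \<epsilon> * real (a' - b)) * (K * C0 ^ t * real p powr (x1 + 2 * real t * \<epsilon> * real n)))"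
      by (rule Bil_refine_chain[OF decl[OF kl(1,2)] C0 \<epsilon> m0 kl(1,2) big(1)[OF kl(2)] ba' a'n a'2 bil]) (use K C0 in auto)
    then show ?thesis by (rule Bil_mono) (rule loss[OF a'n])
  qed
  \<comment> \<open>Here the class of \<eta> keeps its scale b, and c is refined up to (k - l + 2) b
    / (l - 1). For l = 1 there is no class left to refine, and the gain \<mu> b is
    collected.\<close>
  have B2: "Bil (l - 1) c b (K * C0 ^ Suc t * real p powr (x2 + ?E0))"
  proof (cases "l = 1")
    case True
    have "1 * b \<le> k * b" using k_ge by (intro mult_le_mono1) auto
    then have bn: "b \<le> n" using kbn by linarith
    have "1 \<le> C0 ^ Suc t" using C0(1) by (rule one_le_power)
    then have KC: "K \<le> K * C0 ^ Suc t" using K by (metis mult.right_neutral mult_left_mono)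
    have "Bil 0 c b (K * real p powr (\<mu> * real (n - b)))"
      by (rule Bil_zero[OF deck _ bn]) (use K in simp)
    then have "Bil 0 c b (K * C0 ^ Suc t * real p powr (x2 + ?E0))"
    proof (rule Bil_mono)
      show "K * real p powr (\<mu> * real (n - b)) \<le> K * C0 ^ Suc t * real p powr (x2 + ?E0)"
        unfolding x2_def using True KC bn K \<epsilon> pr C0
        by (intro mult_mono powr_mono) (auto simp: gain_0 of_nat_diff algebra_simps)
    qed
    then show ?thesis using True by simp
  next
    case False
    then have l2: "1 \<le> l - 1" "l - 1 < k" "k - (l - 1) + 1 = k - l + 2" using l by auto
    define a' where "a' = (k - l + 2) * b div (l - 1)"
    have bil: "Bil (l - 1) a' b (K * C0 ^ t * real p powr (x2 + 2 * real t * \<epsilon> * real n))"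
      using Suc.IH[OF l2(1,2) fb bn b_ge'] unfolding l2(3) a'_def x2_def .
    have a'n: "a' \<le> n"
    proof -
      have "a' \<le> (k - l + 2) * b" unfolding a'_def by (rule div_le_dividend)
      also have "\<dots> \<le> k * b" using l2 l by (intro mult_le_mono1) auto
      finally show ?thesis using kbn by simp
    qed
    have a'2: "(l - 1) * a' \<le> (k - (l - 1) + 1) * b"
      unfolding l2(3) a'_def by (rule times_div_less_eq_dividend)
    have ca': "c \<le> a'"
    proof -
      have "c * (l - 1) \<le> l * c" by (simp add: mult.commute)
      also have "\<dots> \<le> (k - l + 2) * b" unfolding lc by (intro mult_le_mono1) auto
      finally show ?thesis unfolding a'_def using l2 by (simp add: less_eq_div_iff_mult_less_eq)
    qed
    have "Bil (l - 1) c b (C0 * real p powr (2 * \<epsilon> * real (a' - c)) * (K * C0 ^ t * real p powr (x2 + 2 * real t * \<epsilon> * real n)))"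
      by (rule Bil_refine_chain[OF decl[OF l2(1,2)] C0 \<epsilon> m0 l2(1,2) big(2)[OF l2(2)] ca' a'n a'2 bil]) (use K C0 in auto)
    then show ?thesis by (rule Bil_mono) (rule loss[OF a'n])
  qed
  define x where "x = \<mu> * real n - gain k \<mu> (Suc t) l * real b"
  \<comment> \<open>Since l c = (k - l + 1) b, a gain per unit of c, taken with weight 1 / (k - l +
    1), is worth 1 / l of itself per unit of b. This is the origin of the first coefficient in
    \<open>gain\<close>.\<close>
  have ex: "(x1 + ?E0) + real (k - l) * (x2 + ?E0) = real (k - l + 1) * (x + ?E0)"
  proof -
    have rl: "real l \<noteq> 0" "real (k - l + 1) \<noteq> 0" using l by auto
    have lcr: "real l * real c = real (k - l + 1) * real b" using lc by (metis of_nat_mult)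
    have "real (k - l + 1) * (gain k \<mu> t (k - l) / real l) * real b = gain k \<mu> t (k - l) * (real (k - l + 1) * real b) / real l"
      by simp
    also have "\<dots> = gain k \<mu> t (k - l) * real c" unfolding lcr[symmetric] using rl by simp
    finally have "real (k - l + 1) * (gain k \<mu> t (k - l) / real l) * real b = gain k \<mu> t (k - l) * real c" .
    moreover have "real (k - l + 1) * (real (k - l) / real (k - l + 1) * gain k \<mu> t (l - 1)) = real (k - l) * gain k \<mu> t (l - 1)"
      using rl by simp
    moreover have "gain k \<mu> (Suc t) l = gain k \<mu> t (k - l) / real l + real (k - l) / real (k - l + 1) * gain k \<mu> t (l - 1)"
      using l by simp
    ultimately have "real (k - l + 1) * (gain k \<mu> (Suc t) l * real b) = gain k \<mu> t (k - l) * real c + real (k - l) * gain k \<mu> t (l - 1) * real b"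
      by (simp only: distrib_left distrib_right mult.assoc[symmetric])
    then show ?thesis unfolding x1_def x2_def x_def
      by (simp only: right_diff_distrib distrib_left) (simp add: algebra_simps)
  qed
  have "Bil l c b (K * C0 ^ Suc t * real p powr (x + ?E0))"
  proof (rule Bil_hoelder[OF l B1 B2])
    have pw: "(real p powr y) ^ j = real p powr (real j * y)" for y j
      using pr by (simp add: powr_realpow[symmetric] powr_powr mult.commute)
    have comb: "(Y * real p powr u) * (Y * real p powr v) ^ j = Y ^ (j + 1) * real p powr (u + real j * v)" for Y u v j
      unfolding power_mult_distrib pw powr_add by simp
    have "(K * C0 ^ Suc t * real p powr (x1 + ?E0)) * (K * C0 ^ Suc t * real p powr (x2 + ?E0)) ^ (k - l) =
       (K * C0 ^ Suc t) ^ (k - l + 1) * real p powr ((x1 + ?E0) + real (k - l) * (x2 + ?E0))"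
      by (rule comb)
    also have "\<dots> = (K * C0 ^ Suc t * real p powr (x + ?E0)) ^ (k - l + 1)"
      unfolding ex by (simp only: power_mult_distrib[of "K * C0 ^ Suc t"] pw)
    finally show "(K * C0 ^ Suc t * real p powr (x1 + ?E0)) * (K * C0 ^ Suc t * real p powr (x2 + ?E0)) ^ (k - l) \<le>
       (K * C0 ^ Suc t * real p powr (x + ?E0)) ^ (k - l + 1)" by (rule eq_refl)
  qed (use K C0 in auto)
  then show ?case unfolding c_def x_def .
qed

end

section \<open>From bilinear bounds to decoupling constants; the trivial and the linear case\<close>

lemma Dec_of_bilinear:
  assumes "prime p" "k < p" "k \<ge> 2"
    and main: "\<And>w S A. bilinear_setting p k n w S A \<Longrightarrow>
      avg (chars k (int p ^ (k * n))) (\<lambda>\<phi>. norm (ES p w S 0 0 \<phi>) ^ (2 * tri k)) \<le> C * bilinear_setting.N p n A 0 0 ^ tri k"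
  shows "Dec p k n C"
  unfolding Dec_def
proof (intro allI impI)
  fix w S and A :: "nat \<Rightarrow> real"
  assume S: "finite S" and A: "\<forall>j<p ^ n. A j \<ge> 0 \<and>
        avg (chars k (int p ^ (k * n))) (\<lambda>\<phi>. norm (ES p w S n (int j) \<phi>) ^ (2 * tri k)) \<le> A j ^ tri k"
  \<comment> \<open>\<open>bilinear_setting\<close> speaks of all integers, so the bounds are
    extended periodically.\<close>
  define B where "B r = A (nat (r mod int p ^ n))" for r
  have P: "int p ^ n > 0" using assms(1) by (simp add: prime_gt_0_nat)
  have lt: "nat (r mod int p ^ n) < p ^ n" for r
    using pos_mod_bound[OF P] pos_mod_sign[OF P] by (simp add: nat_less_iff)
  have ES: "ES p w S n r \<phi> = ES p w S n (int (nat (r mod int p ^ n))) \<phi>" for r \<phi>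
  proof -
    have "int p ^ n dvd x - r \<longleftrightarrow> int p ^ n dvd x - r mod int p ^ n" for x
      by (metis mod_eq_dvd_iff mod_mod_trivial)
    then show ?thesis unfolding ES_def using pos_mod_sign[OF P] by simp
  qed
  have loc: "bilinear_setting p k n w S B"
  proof
    fix r
    show "B r \<ge> 0" unfolding B_def using A lt by blast
    show "avg (chars k (int p ^ (k * n))) (\<lambda>\<phi>. norm (ES p w S n r \<phi>) ^ (2 * tri k)) \<le> B r ^ tri k"
      unfolding B_def ES[of r] using A lt by blast
  qed (use assms S in auto)
  have "bilinear_setting.N p n B 0 0 = (\<Sum>j<p ^ n. B (int j))"
    unfolding bilinear_setting.N_def[OF loc] by simp
  also have "\<dots> = (\<Sum>j<p ^ n. A j)"
    unfolding B_def by (intro sum.cong) (simp_all flip: of_nat_power)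
  finally show "avg (chars k (int p ^ (k * n))) (\<lambda>\<phi>. norm (ES p w S 0 0 \<phi>) ^ (2 * tri k)) \<le> C * (\<Sum>j<p ^ n. A j) ^ tri k"
    using main[OF loc] by simp
qed

text \<open>Cauchy-Schwarz loses p ^ n in the square, hence p ^ (n tri k) at the critical power.
  From this exponent the descent in \<open>decoupling\<close> starts.\<close>

lemma Dec_trivial:
  assumes p: "p > 0" and k: "k \<ge> 1"
  shows "Dec p k n (real p powr (real (tri k) * real n))"
  unfolding Dec_def
proof (intro allI impI)
  fix w S and A :: "nat \<Rightarrow> real"
  let ?G = "chars k (int p ^ (k * n))" and ?s = "tri k"
  assume S: "finite S" and A: "\<forall>j<p ^ n. A j \<ge> 0 \<and> avg ?G (\<lambda>\<phi>. norm (ES p w S n (int j) \<phi>) ^ (2 * ?s)) \<le> A j ^ ?s"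
  have "avg ?G (\<lambda>\<phi>. norm (ES p w S 0 0 \<phi>) ^ (2 * ?s)) \<le>
     avg ?G (\<lambda>\<phi>. real p ^ (n * ?s) * (1 * (\<Sum>j<p ^ n. (norm (ES p w S n (int j) \<phi>))\<^sup>2) ^ ?s))"
  proof (rule avg_mono)
    fix \<phi>
    have "ES p w S 0 0 \<phi> = (\<Sum>j<p ^ n. ES p w S n (int j) \<phi>)" using ES_split[OF p S, of w 0 0 \<phi> n] by simp
    then have "norm (ES p w S 0 0 \<phi>) \<le> (\<Sum>j<p ^ n. norm (ES p w S n (int j) \<phi>))" by (simp add: sum_norm_le)
    then have "(norm (ES p w S 0 0 \<phi>))\<^sup>2 \<le> (\<Sum>j<p ^ n. norm (ES p w S n (int j) \<phi>))\<^sup>2" by (intro power_mono) auto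
    also have "\<dots> \<le> (\<Sum>j<p ^ n. (norm (ES p w S n (int j) \<phi>))\<^sup>2) * real p ^ n"
      using sum_squared_le_sum_of_squares[of "\<lambda>j. norm (ES p w S n (int j) \<phi>)" "{..<p ^ n}"] by simp
    finally have "((norm (ES p w S 0 0 \<phi>))\<^sup>2) ^ ?s \<le> ((\<Sum>j<p ^ n. (norm (ES p w S n (int j) \<phi>))\<^sup>2) * real p ^ n) ^ ?s"
      by (intro power_mono) auto
    moreover have "norm (ES p w S 0 0 \<phi>) ^ (2 * ?s) = ((norm (ES p w S 0 0 \<phi>))\<^sup>2) ^ ?s" by (rule power_mult)
    ultimately show "norm (ES p w S 0 0 \<phi>) ^ (2 * ?s) \<le> real p ^ (n * ?s) * (1 * (\<Sum>j<p ^ n. (norm (ES p w S n (int j) \<phi>))\<^sup>2) ^ ?s)"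
      by (simp only: power_mult_distrib power_mult[of "real p"] mult_1 mult.commute)
  qed
  also have "\<dots> = real p ^ (n * ?s) * avg ?G (\<lambda>\<phi>. 1 * (\<Sum>j<p ^ n. (norm (ES p w S n (int j) \<phi>))\<^sup>2) ^ ?s)"
    by (rule avg_cmult)
  also have "\<dots> \<le> real p ^ (n * ?s) * (\<Sum>j<p ^ n. A j) ^ ?s"
    using A tri_pos[OF k] by (intro mult_left_mono minkowski_avg) (auto simp flip: power_mult)
  also have "real p ^ (n * ?s) = real p powr (real (tri k) * real n)"
    using p by (simp add: powr_realpow[symmetric] mult.commute)
  finally show "avg ?G (\<lambda>\<phi>. norm (ES p w S 0 0 \<phi>) ^ (2 * ?s)) \<le> real p powr (real (tri k) * real n) * (\<Sum>j<p ^ n. A j) ^ ?s" .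
qed

lemma sum_chars_eq_zero:
  fixes F :: "(int \<Rightarrow> complex) \<Rightarrow> complex"
  assumes Q: "Q > 0" and \<psi>: "\<psi> \<in> chars k Q" and F: "\<And>\<phi>. F (\<lambda>x. \<phi> x * \<psi> x) = c * F \<phi>" and c: "c \<noteq> 1"
  shows "(\<Sum>\<phi>\<in>chars k Q. F \<phi>) = 0"
proof -
  have "(\<Sum>\<phi>\<in>chars k Q. F \<phi>) = (\<Sum>\<phi>\<in>chars k Q. F (\<lambda>x. \<phi> x * \<psi> x))"
    by (subst sum.reindex_bij_betw[OF bij_betw_chars_translate[OF Q \<psi>]]) simp
  also have "\<dots> = c * (\<Sum>\<phi>\<in>chars k Q. F \<phi>)" unfolding F sum_distrib_left ..
  finally have "(1 - c) * (\<Sum>\<phi>\<in>chars k Q. F \<phi>) = 0" by (simp add: algebra_simps)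
  then show ?thesis using c by simp
qed

text \<open>In degree 1 the critical exponent is 2 and decoupling is exact orthogonality: the
  character e(x / p ^ n) is constant on every class modulo p ^ n, with different values on different
  classes.\<close>

lemma Dec_linear:
  assumes p: "p > 0"
  shows "Dec p 1 n 1"
  unfolding Dec_def
proof (intro allI impI)
  fix w S and A :: "nat \<Rightarrow> real"
  let ?Q = "int p ^ (1 * n)"
  let ?G = "chars 1 ?Q" and ?f = "\<lambda>j. ES p w S n (int j)"
  assume S: "finite S" and A: "\<forall>j<p ^ n. A j \<ge> 0 \<and> avg ?G (\<lambda>\<phi>. norm (?f j \<phi>) ^ (2 * tri 1)) \<le> A j ^ tri 1"
  have Q: "?Q > 0" using p by simp
  have tri1: "tri 1 = 1" by (simp add: tri_def)
  define \<theta> where "\<theta> x = unit_exp (of_int (poly [:0, 1:] x) / of_int ?Q)" for x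
  have \<theta>: "\<theta> \<in> ?G" unfolding \<theta>_def by (rule charsI) simp
  have shift: "?f j (\<lambda>x. \<phi> x * \<theta> x) = \<theta> (int j) * ?f j \<phi>" for j \<phi>
    unfolding ES_def sum_distrib_left
  proof (rule sum.cong)
    fix x assume "x \<in> {x \<in> S. int p ^ n dvd x - int j}"
    then have "\<theta> x = \<theta> (int j)" unfolding \<theta>_def by (intro unit_exp_mod_eq) simp
    then show "w x * (\<phi> x * \<theta> x) = \<theta> (int j) * (w x * \<phi> x)" by simp
  qed simp
  have orth: "(\<Sum>\<phi>\<in>?G. ?f i \<phi> * cnj (?f j \<phi>)) = 0" if ij: "i < p ^ n" "j < p ^ n" "i \<noteq> j" for i j
  proof (rule sum_chars_eq_zero[OF Q \<theta>])
    show "?f i (\<lambda>x. \<phi> x * \<theta> x) * cnj (?f j (\<lambda>x. \<phi> x * \<theta> x)) = (\<theta> (int i) * cnj (\<theta> (int j))) * (?f i \<phi> * cnj (?f j \<phi>))" for \<phi>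
      unfolding shift by simp
    have "\<theta> (int i) * cnj (\<theta> (int j)) = unit_exp (of_int (int i - int j) / of_int ?Q)"
      unfolding \<theta>_def unit_exp_minus[symmetric] unit_exp_add[symmetric] by (simp add: diff_divide_distrib)
    moreover have "real_of_int (int i - int j) / of_int ?Q \<notin> \<int>"
    proof
      assume "real_of_int (int i - int j) / of_int ?Q \<in> \<int>"
      then obtain z where z: "real_of_int (int i - int j) / of_int ?Q = of_int z" by (auto elim: Ints_cases)
      have "real_of_int ?Q \<noteq> 0" using Q by linarith
      then have "real_of_int (int i - int j) = of_int (z * ?Q)" using z by (simp add: divide_eq_eq)
      then have "?Q dvd int i - int j" by (metis dvd_triv_right of_int_eq_iff)
      then have "int i mod ?Q = int j mod ?Q" by (simp add: mod_eq_dvd_iff)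
      then show False using ij by (simp flip: of_nat_power)
    qed
    ultimately show "\<theta> (int i) * cnj (\<theta> (int j)) \<noteq> 1" by (simp add: unit_exp_eq_1_iff)
  qed
  have "complex_of_real (\<Sum>\<phi>\<in>?G. (norm (ES p w S 0 0 \<phi>))\<^sup>2) = (\<Sum>\<phi>\<in>?G. \<Sum>i<p ^ n. \<Sum>j<p ^ n. ?f i \<phi> * cnj (?f j \<phi>))"
  proof -
    have "ES p w S 0 0 \<phi> = (\<Sum>j<p ^ n. ?f j \<phi>)" for \<phi> using ES_split[OF p S, of w 0 0 \<phi> n] by simp
    then show ?thesis by (simp only: of_real_sum complex_norm_square sum_product cnj_sum)
  qed
  also have "\<dots> = (\<Sum>i<p ^ n. \<Sum>j<p ^ n. \<Sum>\<phi>\<in>?G. ?f i \<phi> * cnj (?f j \<phi>))"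
    by (subst sum.swap, intro sum.cong refl, rule sum.swap)
  also have "\<dots> = (\<Sum>i<p ^ n. \<Sum>\<phi>\<in>?G. ?f i \<phi> * cnj (?f i \<phi>))"
  proof (rule sum.cong)
    fix i assume i: "i \<in> {..<p ^ n}"
    have "(\<Sum>j<p ^ n. \<Sum>\<phi>\<in>?G. ?f i \<phi> * cnj (?f j \<phi>)) = (\<Sum>j\<in>{i}. \<Sum>\<phi>\<in>?G. ?f i \<phi> * cnj (?f j \<phi>))"
      using i orth by (intro sum.mono_neutral_right) auto
    then show "(\<Sum>j<p ^ n. \<Sum>\<phi>\<in>?G. ?f i \<phi> * cnj (?f j \<phi>)) = (\<Sum>\<phi>\<in>?G. ?f i \<phi> * cnj (?f i \<phi>))" by simp
  qed simp
  also have "\<dots> = complex_of_real (\<Sum>i<p ^ n. \<Sum>\<phi>\<in>?G. (norm (?f i \<phi>))\<^sup>2)"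
    by (simp only: of_real_sum complex_norm_square)
  finally have "(\<Sum>\<phi>\<in>?G. (norm (ES p w S 0 0 \<phi>))\<^sup>2) = (\<Sum>i<p ^ n. \<Sum>\<phi>\<in>?G. (norm (?f i \<phi>))\<^sup>2)"
    by (rule of_real_eq_iff[THEN iffD1])
  then have "avg ?G (\<lambda>\<phi>. norm (ES p w S 0 0 \<phi>) ^ 2) = (\<Sum>i<p ^ n. avg ?G (\<lambda>\<phi>. norm (?f i \<phi>) ^ 2))"
    unfolding avg_def by (simp add: sum_divide_distrib)
  also have "\<dots> \<le> (\<Sum>i<p ^ n. A i)" using A unfolding tri1 by (intro sum_mono) auto
  finally show "avg ?G (\<lambda>\<phi>. norm (ES p w S 0 0 \<phi>) ^ (2 * tri 1)) \<le> 1 * (\<Sum>j<p ^ n. A j) ^ tri 1"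
    unfolding tri1 by simp
qed


section \<open>Lowering the decoupling exponent\<close>

text \<open>The balance of the constants: bringing the bilinear bound back to scale 1 costs at most
  p ^ (Lc b), since a is at most k b. The number t of rounds is so large that, by averaging over l,
  some l gains at least Lc + 1, which leaves a net gain of p ^ b. As b is at least \<theta> n and
  the losses from lower degrees are at most p ^ (\<theta> n / 2) up to a constant, the exponent
  falls by \<theta> / 2, an amount independent of \<mu>.\<close>

lemma Dec_improve:
  fixes p k t :: nat and e1 \<mu> :: real
  defines "Lc \<equiv> (2 * tri k + 1) * (k + 1)"
  defines "\<theta> \<equiv> 1 / (2 * real k ^ (t + 1))"
  defines "\<epsilon> \<equiv> \<theta> / (4 * (real t + 1))"
  assumes p: "prime p" "k < p" and k: "k \<ge> 2" and e1: "e1 > 0" and big: "4 ^ tri k \<le> real p powr e1"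
    and t: "(real k - 1) * (real Lc + 1) \<le> real t * (2 * e1 * (real k - 1) / real k)"
    and decl: "\<And>l m. 1 \<le> l \<Longrightarrow> l < k \<Longrightarrow> Dec p l m (C0 * real p powr (\<epsilon> * real m))" and C0: "C0 \<ge> 1"
    and \<mu>: "\<mu> \<ge> 2 * e1" and K: "K \<ge> 0" and deck: "\<And>m. Dec p k m (K * real p powr (\<mu> * real m))"
  shows "\<exists>K'\<ge>0. \<forall>m. Dec p k m (K' * real p powr (max (2 * e1) (\<mu> - \<theta> / 2) * real m))"
proof -
  have pr: "real p > 1" using p(1) prime_gt_1_nat[OF p(1)] by simp
  have \<theta>: "\<theta> > 0" unfolding \<theta>_def using k by simp
  have \<epsilon>: "\<epsilon> > 0" unfolding \<epsilon>_def using \<theta> by simp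
  have te: "2 * real t * \<epsilon> \<le> \<theta> / 2" unfolding \<epsilon>_def using \<theta> by (simp add: field_simps)
  have "\<exists>l\<in>{1..<k}. gain k \<mu> t l \<ge> real Lc + 1"
  proof (rule ccontr)
    assume "\<not> ?thesis"
    then have "(\<Sum>l\<in>{1..<k}. gain k \<mu> t l) < (\<Sum>l\<in>{1..<k}. real Lc + 1)"
      using k by (intro sum_strict_mono) (auto simp: not_le)
    also have "\<dots> = (real k - 1) * (real Lc + 1)" using k by (simp add: of_nat_diff)
    also have "\<dots> \<le> real t * (2 * e1 * (real k - 1) / real k)" by (rule t)
    also have "\<dots> \<le> real t * (\<mu> * (real k - 1) / real k)"
      using \<mu> k by (intro mult_left_mono divide_right_mono mult_right_mono) auto
    finally show False unfolding sum_gain[OF k] by simp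
  qed
  then obtain l where l: "1 \<le> l" "l < k" and gl: "gain k \<mu> t l \<ge> real Lc + 1" by auto
  \<comment> \<open>The scale from which p ^ (\<epsilon> m) exceeds C0, as
    \<open>Bil_refine_chain\<close> requires.\<close>
  define m0 where "m0 = nat \<lceil>log (real p) C0 / \<epsilon>\<rceil> + 1"
  have m0: "m0 \<ge> 1" unfolding m0_def by simp
  have "log (real p) C0 / \<epsilon> \<le> real m0" unfolding m0_def by linarith
  then have "log (real p) C0 \<le> \<epsilon> * real m0" using \<epsilon> by (simp add: pos_divide_le_eq mult.commute)
  then have Cm: "C0 \<le> real p powr (\<epsilon> * real m0)" using pr C0 by (simp add: log_le_iff)
  define F kk where "F = (fact k :: nat) ^ t" and "kk = k ^ (t + 1)"
  have F: "F > 0" and kk: "kk > 0" unfolding F_def kk_def using k by auto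
  \<comment> \<open>From this size on, rounding b to a multiple of F costs at most half of n / kk
    and still leaves room for kk m0.\<close>
  define n0 where "n0 = 2 * kk * (F + kk * m0)"
  define K1 where "K1 = real p ^ (4 * tri k + 2) * (K * C0 ^ t)"
  have K1: "K1 \<ge> 0" unfolding K1_def using K C0 by simp
  have step: "Dec p k n (4 ^ tri k * D + K1 * real p powr ((\<mu> - \<theta> / 2) * real n))"
    if n: "n \<ge> n0" and D: "D \<ge> 0" and dec: "Dec p k (n - 1) D" for n D
  proof (rule Dec_of_bilinear[OF p k])
    fix w S A assume "bilinear_setting p k n w S A"
    then interpret bilinear_setting p k n w S A .
    \<comment> \<open>The largest multiple of F whose product with kk is at most n.\<close>
    define b where "b = F * (n div (F * kk))"
    have bk: "b * kk \<le> n" unfolding b_def using times_div_less_eq_dividend[of "F * kk" n] by (simp add: mult_ac)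
    have b_big: "real n / (2 * real kk) + real kk * real m0 \<le> real b"
    proof -
      have "n < F * kk + F * kk * (n div (F * kk))" using F kk by (intro dividend_less_times_div) simp
      then have "n < kk * (F + b)" unfolding b_def by (simp add: algebra_simps)
      then have "real n < real kk * (real F + real b)" by (metis of_nat_add of_nat_less_iff of_nat_mult)
      then have "real n / real kk < real F + real b" using kk by (simp add: pos_divide_less_eq mult.commute)
      moreover have "real (2 * kk * (F + kk * m0)) \<le> real n" using n unfolding n0_def by (subst of_nat_le_iff)
      then have "real F + real kk * real m0 \<le> real n / (2 * real kk)"
        using kk by (simp add: pos_le_divide_eq mult_ac)
      moreover have "real n / real kk = 2 * (real n / (2 * real kk))" using kk by simp
      ultimately show ?thesis by linarith
    qed
    have "real n / (2 * real kk) \<ge> 0" by simp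
    then have "real kk * real m0 \<le> real b" using b_big by linarith
    then have "real (kk * m0) \<le> real b" by simp
    then have "kk * m0 \<le> b" by (rule of_nat_le_iff[THEN iffD1])
    then have bm: "k ^ t * (k * m0) \<le> b" unfolding kk_def by (simp add: mult_ac)
    have bn: "\<theta> * real n \<le> real b"
    proof -
      have "\<theta> * real n = real n / (2 * real kk)" unfolding \<theta>_def kk_def by simp
      also have "\<dots> \<le> real n / (2 * real kk) + real kk * real m0" by simp
      finally show ?thesis using b_big by linarith
    qed
    define a where "a = (k - l + 1) * b div l"
    define X where "X = K * C0 ^ t * real p powr (\<mu> * real n - gain k \<mu> t l * real b + 2 * real t * \<epsilon> * real n)"
    have X0: "X \<ge> 0" unfolding X_def using K C0 by simp
    have bil: "Bil l a b X" unfolding a_def X_def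
      by (rule Bil_iterate[OF decl C0 Cm _ m0 deck K _ l]) (use \<epsilon> \<mu> e1 bk bm in \<open>auto simp: b_def F_def kk_def\<close>)
    have "k * m0 \<le> k ^ t * (k * m0)" using k by simp
    moreover have "l * 1 \<le> k * m0" using l m0 by (intro mult_le_mono) auto
    ultimately have lb: "l \<le> b" using bm by linarith
    have "(k - l + 1) * b \<le> k * b" using l by (intro mult_le_mono1) auto
    moreover have "a \<le> (k - l + 1) * b" unfolding a_def by (rule div_le_dividend)
    ultimately have akb: "a \<le> k * b" by linarith
    have a1: "1 \<le> a"
    proof -
      have "1 * l \<le> (k - l + 1) * b" using lb by (intro mult_le_mono) auto
      then show ?thesis unfolding a_def using l by (simp add: less_eq_div_iff_mult_less_eq)
    qed
    have kbn: "k * b \<le> n"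
    proof -
      have "k * 1 \<le> k * k ^ t" using k by (intro mult_le_mono2) simp
      then have "b * k \<le> b * kk" unfolding kk_def by (intro mult_le_mono2) simp
      then show ?thesis using bk by (simp only: mult.commute[of k])
    qed
    have bkb: "b \<le> k * b" using k by simp
    have n1: "n \<ge> 1" using kbn bkb lb l by linarith
    have "Bil l 1 1 (real p ^ ((2 * tri k + 1) * (a + b)) * X)"
      by (rule Bil_coarsen[OF bil l X0 a1]) (use akb kbn bkb l lb in linarith)+
    then have "avg G (\<lambda>\<phi>. norm (f 0 0 \<phi>) ^ (2 * tri k)) \<le>
       (4 ^ tri k * D + real p ^ (4 * tri k + 2) * (real p ^ ((2 * tri k + 1) * (a + b)) * X)) * N 0 0 ^ tri k"
      by (intro linear_from_bilinear[OF dec D _ l]) (use X0 n1 in auto)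
    also have "\<dots> \<le> (4 ^ tri k * D + K1 * real p powr ((\<mu> - \<theta> / 2) * real n)) * N 0 0 ^ tri k"
    proof (intro mult_right_mono add_left_mono zero_le_power N_nonneg)
      have ab: "(2 * tri k + 1) * (a + b) \<le> Lc * b"
      proof -
        have "(2 * tri k + 1) * (a + b) \<le> (2 * tri k + 1) * ((k + 1) * b)" using akb by (intro mult_le_mono2) simp
        then show ?thesis unfolding Lc_def by (simp only: mult.assoc)
      qed
      have "real p ^ ((2 * tri k + 1) * (a + b)) \<le> real p ^ (Lc * b)"
        using ab pr by (intro power_increasing) auto
      also have "\<dots> = real p powr (real Lc * real b)" using pr by (simp add: powr_realpow[symmetric])
      finally have "real p ^ ((2 * tri k + 1) * (a + b)) * X \<le> real p powr (real Lc * real b) * X"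
        using X0 by (rule mult_right_mono)
      also have "\<dots> = K * C0 ^ t * real p powr (real Lc * real b + (\<mu> * real n - gain k \<mu> t l * real b + 2 * real t * \<epsilon> * real n))"
        unfolding X_def powr_add by simp
      also have "\<dots> \<le> K * C0 ^ t * real p powr ((\<mu> - \<theta> / 2) * real n)"
      proof (intro mult_left_mono powr_mono)
        have "(real Lc + 1) * real b \<le> gain k \<mu> t l * real b" using gl by (intro mult_right_mono) auto
        moreover have "2 * real t * \<epsilon> * real n \<le> \<theta> / 2 * real n" using te by (intro mult_right_mono) auto
        ultimately show "real Lc * real b + (\<mu> * real n - gain k \<mu> t l * real b + 2 * real t * \<epsilon> * real n) \<le> (\<mu> - \<theta> / 2) * real n"
          using bn by (simp add: algebra_simps)
      qed (use pr K C0 in auto)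
      finally have "real p ^ (4 * tri k + 2) * (real p ^ ((2 * tri k + 1) * (a + b)) * X) \<le>
         real p ^ (4 * tri k + 2) * (K * C0 ^ t * real p powr ((\<mu> - \<theta> / 2) * real n))"
        by (intro mult_left_mono) auto
      then show "real p ^ (4 * tri k + 2) * (real p ^ ((2 * tri k + 1) * (a + b)) * X) \<le> K1 * real p powr ((\<mu> - \<theta> / 2) * real n)"
        unfolding K1_def by (simp add: mult_ac)
    qed
    finally show "avg G (\<lambda>\<phi>. norm (f 0 0 \<phi>) ^ (2 * tri k)) \<le> (4 ^ tri k * D + K1 * real p powr ((\<mu> - \<theta> / 2) * real n)) * N 0 0 ^ tri k" .
  qed
  define \<nu> where "\<nu> = max (2 * e1) (\<mu> - \<theta> / 2)"
  \<comment> \<open>The first summand covers all m below n0 by means of the old exponent; the second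
    absorbs the broad term in the induction on m.\<close>
  define K' where "K' = K * real p powr (\<mu> * real n0) + 2 * K1"
  have K': "K' \<ge> 0" "K * real p powr (\<mu> * real n0) \<le> K'" "2 * K1 \<le> K'"
    unfolding K'_def using K K1 by auto
  have \<nu>: "\<nu> \<ge> 2 * e1" "\<mu> - \<theta> / 2 \<le> \<nu>" unfolding \<nu>_def by auto
  have "Dec p k m (K' * real p powr (\<nu> * real m))" for m
  proof (induction m)
    case 0
    have "K * 1 \<le> K * real p powr (\<mu> * real n0)"
      using K pr \<mu> e1 by (intro mult_left_mono ge_one_powr_ge_zero) auto
    then show ?case using K'(2) pr by (intro Dec_mono[OF deck]) simp
  next
    case (Suc m)
    show ?case
    proof (cases "Suc m < n0")
      case True
      have "K * real p powr (\<mu> * real (Suc m)) \<le> K * real p powr (\<mu> * real n0)"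
        using K pr \<mu> e1 True by (intro mult_left_mono powr_mono) auto
      also have "\<dots> \<le> K' * 1" using K' by simp
      also have "\<dots> \<le> K' * real p powr (\<nu> * real (Suc m))"
        using K' pr \<nu> e1 by (intro mult_left_mono ge_one_powr_ge_zero) auto
      finally show ?thesis by (rule Dec_mono[OF deck])
    next
      case False
      let ?Y = "real p powr (\<nu> * real (Suc m))"
      have "Dec p k (Suc m) (4 ^ tri k * (K' * real p powr (\<nu> * real m)) + K1 * real p powr ((\<mu> - \<theta> / 2) * real (Suc m)))"
        using False Suc K' by (intro step) auto
      moreover have "4 ^ tri k * (K' * real p powr (\<nu> * real m)) + K1 * real p powr ((\<mu> - \<theta> / 2) * real (Suc m)) \<le> K' * ?Y"
      proof -
        \<comment> \<open>The floor 2 e1 for the exponent comes from here. Of the factor p ^ (2 e1)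
          available between m and m + 1, one p ^ e1 pays for \<open>4 ^ tri k\<close>; the other is
          at least 4 and leaves room for the broad term.\<close>
        have "real p powr (2 * e1) * real p powr (\<nu> * real m) \<le> ?Y"
          unfolding powr_add[symmetric] using pr \<nu> by (intro powr_mono) (auto simp: algebra_simps)
        moreover have "real p powr (2 * e1) = real p powr e1 * real p powr e1" by (simp flip: powr_add)
        ultimately have Y: "real p powr e1 * (real p powr e1 * real p powr (\<nu> * real m)) \<le> ?Y" by (simp add: mult.assoc)
        have "(4::real) ^ 1 \<le> 4 ^ tri k" using tri_pos[of k] k by (intro power_increasing) auto
        then have p4: "4 \<le> real p powr e1" using big by simp
        have "4 ^ tri k * real p powr (\<nu> * real m) \<le> real p powr e1 * real p powr (\<nu> * real m)"
          using big by (intro mult_right_mono) auto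
        also have "4 * \<dots> \<le> real p powr e1 * (real p powr e1 * real p powr (\<nu> * real m))"
          using p4 by (intro mult_right_mono) auto
        finally have Z: "4 * (4 ^ tri k * real p powr (\<nu> * real m)) \<le> ?Y" using Y by simp
        have "0 \<le> 4 ^ tri k * real p powr (\<nu> * real m)" by simp
        then have "2 * (4 ^ tri k * real p powr (\<nu> * real m)) \<le> ?Y" using Z by linarith
        then have "K' * (2 * (4 ^ tri k * real p powr (\<nu> * real m))) \<le> K' * ?Y" using K' by (intro mult_left_mono) auto
        moreover have "K1 * real p powr ((\<mu> - \<theta> / 2) * real (Suc m)) \<le> K1 * ?Y"
          using K1 pr \<nu> by (intro mult_left_mono powr_mono mult_right_mono) auto
        moreover have "2 * K1 * ?Y \<le> K' * ?Y" using K' by (intro mult_right_mono) auto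
        ultimately show ?thesis by (simp add: mult_ac)
      qed
      ultimately show ?thesis by (rule Dec_mono)
    qed
  qed
  then show ?thesis using K'(1) unfolding \<nu>_def by blast
qed

text \<open>The order of the choices matters: \<epsilon> fixes e1, the number t of rounds, the step
  \<theta> and the precision \<epsilon>' for lower degrees, and only then the threshold for p is
  taken. For each such p the exponent descends from tri k in finitely many steps \<theta> / 2, as
  neither t nor \<theta> depends on the current exponent.\<close>

theorem decoupling:
  assumes "k \<ge> 1" "\<epsilon> > 0"
  shows "\<exists>P. \<forall>p. prime p \<and> P \<le> p \<longrightarrow> (\<exists>C\<ge>1. \<forall>m. Dec p k m (C * real p powr (\<epsilon> * real m)))"
  using assms
proof (induction k arbitrary: \<epsilon> rule: less_induct)
  case (less k)
  note \<epsilon> = less.prems(2)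
  show ?case
  proof (cases "k = 1")
    case True
    show ?thesis
    proof (rule exI[of _ 0], intro allI impI)
      fix p :: nat assume "prime p \<and> 0 \<le> p"
      then have p: "p > 0" by (simp add: prime_gt_0_nat)
      have "Dec p k m (1 * real p powr (\<epsilon> * real m))" for m
        unfolding True using p \<epsilon> by (intro Dec_mono[OF Dec_linear]) (auto intro: ge_one_powr_ge_zero)
      then show "\<exists>C\<ge>1. \<forall>m. Dec p k m (C * real p powr (\<epsilon> * real m))" by (intro exI[of _ 1]) auto
    qed
  next
    case False
    then have k: "k \<ge> 2" using less.prems(1) by simp
    define e1 where "e1 = \<epsilon> / 2"
    have e1: "e1 > 0" unfolding e1_def using \<epsilon> by simp
    define Lc where "Lc = (2 * tri k + 1) * (k + 1)"
    have q: "2 * e1 * (real k - 1) / real k > 0" using e1 k by simp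
    obtain t :: nat where t: "(real k - 1) * (real Lc + 1) \<le> real t * (2 * e1 * (real k - 1) / real k)"
    proof -
      obtain t :: nat where "(real k - 1) * (real Lc + 1) / (2 * e1 * (real k - 1) / real k) \<le> real t"
        using real_arch_simple by blast
      then show ?thesis using that q pos_divide_le_eq by blast
    qed
    define \<theta> where "\<theta> = 1 / (2 * real k ^ (t + 1))"
    define \<epsilon>' where "\<epsilon>' = \<theta> / (4 * (real t + 1))"
    have \<theta>: "\<theta> > 0" unfolding \<theta>_def using k by simp
    have \<epsilon>': "\<epsilon>' > 0" unfolding \<epsilon>'_def using \<theta> by simp
    have "\<exists>P. \<forall>p. prime p \<and> P \<le> p \<longrightarrow> (\<exists>C\<ge>1. \<forall>m. Dec p l m (C * real p powr (\<epsilon>' * real m)))" if "1 \<le> l" "l < k" for l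
      by (rule less.IH[OF that(2,1) \<epsilon>'])
    then obtain PP where PP: "\<And>l p. 1 \<le> l \<Longrightarrow> l < k \<Longrightarrow> prime p \<Longrightarrow> PP l \<le> p \<Longrightarrow> \<exists>C\<ge>1. \<forall>m. Dec p l m (C * real p powr (\<epsilon>' * real m))"
      by metis
    \<comment> \<open>Three requirements on p: decoupling in all degrees below k, the condition k <
      p of \<open>two_point_poly\<close>, and \<open>4 ^ tri k\<close> at most p ^ e1.\<close>
    define P where "P = (\<Sum>l<k. PP l) + (k + 1) + nat \<lceil>(4 ^ tri k) powr (1 / e1)\<rceil>"
    show ?thesis
    proof (intro exI[of _ P] allI impI)
      fix p :: nat assume pP: "prime p \<and> P \<le> p"
      then have p: "prime p" "k < p" unfolding P_def by auto
      have pr: "real p > 1" using p(1) prime_gt_1_nat[OF p(1)] by simp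
      have big: "4 ^ tri k \<le> real p powr e1"
      proof -
        have "(4 ^ tri k) powr (1 / e1) \<le> real p" using pP unfolding P_def by linarith
        then have "((4 ^ tri k) powr (1 / e1)) powr e1 \<le> real p powr e1" using e1 by (intro powr_mono2) auto
        then show ?thesis using e1 by (simp add: powr_powr)
      qed
      have "\<exists>C\<ge>1. \<forall>m. Dec p l m (C * real p powr (\<epsilon>' * real m))" if l: "1 \<le> l" "l < k" for l
      proof (rule PP[OF l p(1)])
        have "PP l \<le> (\<Sum>l<k. PP l)" using l by (intro member_le_sum) auto
        then show "PP l \<le> p" using pP unfolding P_def by linarith
      qed
      then obtain CC where CC: "\<And>l. 1 \<le> l \<Longrightarrow> l < k \<Longrightarrow> CC l \<ge> 1"
        "\<And>l m. 1 \<le> l \<Longrightarrow> l < k \<Longrightarrow> Dec p l m (CC l * real p powr (\<epsilon>' * real m))"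
        by metis
      define C0 where "C0 = (\<Sum>l\<in>{1..<k}. CC l)"
      have CC0: "CC l \<le> C0" if "1 \<le> l" "l < k" for l
        unfolding C0_def using that CC(1) by (intro member_le_sum) (auto intro: order.trans[of 0 1])
      have C0: "C0 \<ge> 1" by (rule order.trans[OF CC(1)[of 1] CC0[of 1]]) (use k in auto)
      have decl: "Dec p l m (C0 * real p powr (\<epsilon>' * real m))" if "1 \<le> l" "l < k" for l m
        using CC0[OF that] by (intro Dec_mono[OF CC(2)[OF that]] mult_right_mono) auto
      have "\<exists>K\<ge>0. \<forall>m. Dec p k m (K * real p powr (max (2 * e1) (real (tri k) - real j * (\<theta> / 2)) * real m))" for j
      proof (induction j)
        case 0
        have "Dec p k m (1 * real p powr (max (2 * e1) (real (tri k) - real 0 * (\<theta> / 2)) * real m))" for m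
          using pr k by (intro Dec_mono[OF Dec_trivial]) (auto intro!: powr_mono mult_right_mono)
        then show ?case by (intro exI[of _ 1]) auto
      next
        case (Suc j)
        let ?\<mu> = "max (2 * e1) (real (tri k) - real j * (\<theta> / 2))"
        obtain K where K: "K \<ge> 0" "\<And>m. Dec p k m (K * real p powr (?\<mu> * real m))" using Suc by blast
        have "\<exists>K'\<ge>0. \<forall>m. Dec p k m (K' * real p powr (max (2 * e1) (?\<mu> - \<theta> / 2) * real m))"
          unfolding \<theta>_def
          by (rule Dec_improve[OF p k e1 big t[unfolded Lc_def] decl[unfolded \<epsilon>'_def \<theta>_def] C0 _ K(1) K(2)[unfolded \<theta>_def]])
            auto
        moreover have "max (2 * e1) (?\<mu> - \<theta> / 2) = max (2 * e1) (real (tri k) - real (Suc j) * (\<theta> / 2))"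
        proof -
          have "real (Suc j) * (\<theta> / 2) = real j * (\<theta> / 2) + \<theta> / 2" by (simp add: algebra_simps)
          then show ?thesis using \<theta> by linarith
        qed
        ultimately show ?case by simp
      qed
      moreover obtain j :: nat where "real (tri k) / (\<theta> / 2) \<le> real j" using real_arch_simple by blast
      then have "real (tri k) - real j * (\<theta> / 2) \<le> 0" using \<theta> by (simp add: pos_divide_le_eq)
      then have "max (2 * e1) (real (tri k) - real j * (\<theta> / 2)) = \<epsilon>" using \<epsilon> unfolding e1_def by simp
      ultimately obtain K where K: "K \<ge> 0" "\<And>m. Dec p k m (K * real p powr (\<epsilon> * real m))" by metis
      have "Dec p k m (max 1 K * real p powr (\<epsilon> * real m))" for m
        by (rule Dec_mono[OF K(2)]) (auto intro: mult_right_mono)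
      then show "\<exists>C\<ge>1. \<forall>m. Dec p k m (C * real p powr (\<epsilon> * real m))" by (intro exI[of _ "max 1 K"]) auto
    qed
  qed
qed


section \<open>Sums of geometric sums\<close>

text \<open>Halving the angle leaves an argument of at most pi / 4, where a Taylor bound for the
  sine and the value cos (pi / 4) suffice, because 2 * 5/6 * 7/10 exceeds 1. The weak factor 1/2 is
  compensated later by pi \<ge> 2.\<close>

lemma sin_ge_half:
  assumes "0 \<le> x" "x \<le> pi / 2"
  shows "x / 2 \<le> sin x"
proof -
  define y where "y = x / 2"
  have y: "0 \<le> y" "y \<le> pi / 4" using assms unfolding y_def by auto
  have y1: "y \<le> 1" using y pi_less_4 by simp
  have s: "y * (5 / 6) \<le> sin y"
  proof -
    have "\<bar>sin y - (\<Sum>m<3. sin_coeff m * y ^ m)\<bar> \<le> inverse (fact 3) * \<bar>y\<bar> ^ 3"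
      by (rule Maclaurin_sin_bound)
    moreover have "(\<Sum>m<3. sin_coeff m * y ^ m) = y"
      by (simp add: sin_coeff_def numeral_3_eq_3)
    moreover have "y ^ 3 \<le> y"
      using y y1 by (metis power_decreasing[of 1 3 y] one_le_numeral power_one_right)
    ultimately have "\<bar>sin y - y\<bar> \<le> y / 6" using y(1) by (simp add: fact_numeral)
    then show ?thesis by linarith
  qed
  have "cos (pi / 4) \<le> cos y" using y pi_gt_zero by (intro cos_monotone_0_pi_le) auto
  moreover have "sqrt 2 / 2 \<ge> (7 / 10 :: real)"
  proof -
    have "(7 / 5 :: real) \<le> sqrt 2" by (rule real_le_rsqrt) (simp add: power2_eq_square)
    then show ?thesis by simp
  qed
  ultimately have c: "7 / 10 \<le> cos y" by (simp add: cos_45)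
  have "2 * (y * (5 / 6)) * (7 / 10) \<le> 2 * sin y * cos y"
    using s c y(1) by (intro mult_mono) auto
  also have "\<dots> = sin x" unfolding y_def using sin_double[of "x / 2"] by simp
  finally show ?thesis using y(1) unfolding y_def by simp
qed

lemma norm_one_minus_unit_exp:
  assumes "0 \<le> x" "x \<le> 1"
  shows "2 * min x (1 - x) \<le> norm (1 - unit_exp x)"
proof -
  have "norm (1 - unit_exp x) = 2 * \<bar>sin (pi * x)\<bar>"
  proof -
    have "unit_exp x = cis (2 * (pi * x))"
      by (simp add: unit_exp_def cis_conv_exp mult_ac)
    then have "(norm (1 - unit_exp x))\<^sup>2 = (1 - cos (2 * (pi * x)))\<^sup>2 + (sin (2 * (pi * x)))\<^sup>2"
      by (simp add: cmod_power2)
    also have "\<dots> = 2 - 2 * cos (2 * (pi * x))"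
      using sin_cos_squared_add[of "2 * (pi * x)"] by (simp add: power2_eq_square algebra_simps)
    also have "\<dots> = (2 * sin (pi * x))\<^sup>2"
      unfolding cos_double_sin by (simp add: power2_eq_square)
    finally have "(norm (1 - unit_exp x))\<^sup>2 = (2 * \<bar>sin (pi * x)\<bar>)\<^sup>2" by (simp add: power2_eq_square)
    then show ?thesis by (rule power2_eq_imp_eq) auto
  qed
  moreover have "min x (1 - x) \<le> \<bar>sin (pi * x)\<bar>"
  proof (cases "x \<le> 1 / 2")
    case True
    have "pi * x / 2 \<le> sin (pi * x)"
      using True assms by (intro sin_ge_half) auto
    moreover have "2 * x \<le> pi * x" using assms pi_ge_two by (intro mult_right_mono) auto
    ultimately show ?thesis by linarith
  next
    case False
    have "pi * (1 - x) / 2 \<le> sin (pi * (1 - x))"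
      using False assms by (intro sin_ge_half) auto
    moreover have "2 * (1 - x) \<le> pi * (1 - x)" using assms pi_ge_two by (intro mult_right_mono) auto
    moreover have "sin (pi * (1 - x)) = sin (pi * x)" by (simp add: right_diff_distrib sin_diff)
    ultimately have "1 - x \<le> sin (pi * x)" by simp
    then show ?thesis by simp
  qed
  ultimately show ?thesis by simp
qed

lemma unit_exp_power: "unit_exp (x * real m) = unit_exp x ^ m"
  by (induction m) (simp_all add: algebra_simps unit_exp_add)

lemma geometric_bound:
  assumes "x = of_int z + y" "0 < y" "y < 1"
  shows "norm (\<Sum>m<N. unit_exp (x * real m)) \<le> 1 / min y (1 - y)"
proof -
  have e: "unit_exp x = unit_exp y" unfolding assms(1) by (simp add: add.commute)
  have mn: "min y (1 - y) > 0" using assms by simp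
  have lb: "2 * min y (1 - y) \<le> norm (1 - unit_exp x)"
    unfolding e using assms by (intro norm_one_minus_unit_exp) auto
  have "(1 - unit_exp x) * (\<Sum>m<N. unit_exp (x * real m)) = 1 - unit_exp x ^ N"
    unfolding unit_exp_power using one_diff_power_eq[of "unit_exp x" N] by simp
  then have "norm (1 - unit_exp x) * norm (\<Sum>m<N. unit_exp (x * real m)) = norm (1 - unit_exp x ^ N)"
    by (metis norm_mult)
  also have "\<dots> \<le> norm (1::complex) + norm (unit_exp x ^ N)" by (rule norm_triangle_ineq4)
  also have "\<dots> = 2" by (simp add: norm_power)
  finally have "norm (1 - unit_exp x) * norm (\<Sum>m<N. unit_exp (x * real m)) \<le> 2" .
  moreover have "2 * min y (1 - y) * norm (\<Sum>m<N. unit_exp (x * real m)) \<le> norm (1 - unit_exp x) * norm (\<Sum>m<N. unit_exp (x * real m))"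
    using lb by (intro mult_right_mono) auto
  ultimately have "min y (1 - y) * norm (\<Sum>m<N. unit_exp (x * real m)) \<le> 1" by linarith
  then show ?thesis using mn by (simp add: pos_le_divide_eq mult.commute)
qed

lemma harm_le_ln:
  assumes "n \<ge> 1"
  shows "(harm n :: real) \<le> 1 + ln (real n)"
proof -
  have "harm (Suc (n - 1)) - ln (real (Suc (n - 1))) \<le> harm (Suc 0) - ln (real (Suc 0))"
    by (rule decseqD[OF decseq_harm_diff_ln]) simp
  then show ?thesis using assms by (simp add: harm_def)
qed

text \<open>Multiplied by q, the frequency \<beta> j + x0 lies between a j + c - 1 and a j + c + 2,
  and a j + c runs through all residues modulo q. The residues 0, 1, q - 2 and q - 1 get the trivial
  bound N, which gives 4 N; the others give one harmonic sum for each side of the unit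
  interval.\<close>

lemma geometric_block:
  fixes a :: int and q :: nat
  assumes q: "q \<ge> 1" and cop: "coprime a (int q)" and \<beta>: "\<bar>\<beta> - of_int a / real q\<bar> \<le> 1 / (real q)\<^sup>2"
  shows "(\<Sum>j<q. norm (\<Sum>m<N. unit_exp ((\<beta> * real j + x0) * real m))) \<le> 4 * real N + 2 * real q * (1 + ln (real q))"
proof -
  define c where "c = \<lfloor>real q * x0\<rfloor>"
  define rr where "rr j = nat ((a * int j + c) mod int q)" for j
  define B where "B r = (if 2 \<le> r \<and> r + 3 \<le> q then real q / (real r - 1) + real q / (real q - real r - 2) else real N)" for r
  have q0: "real q > 0" using q by simp
  have bij: "bij_betw rr {..<q} {..<q}"
  proof -
    have "inj_on rr {..<q}"
    proof (rule inj_onI)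
      fix i j assume i: "i \<in> {..<q}" and j: "j \<in> {..<q}" and e: "rr i = rr j"
      have "(a * int i + c) mod int q = (a * int j + c) mod int q"
        using e q unfolding rr_def by (simp add: nat_eq_iff)
      then have "int q dvd a * (int i - int j)" by (simp add: mod_eq_dvd_iff algebra_simps)
      then have "int q dvd int i - int j" using cop by (simp add: coprime_commute coprime_dvd_mult_right_iff)
      then have "int i mod int q = int j mod int q" by (simp add: mod_eq_dvd_iff)
      then show "i = j" using i j by simp
    qed
    moreover have "rr ` {..<q} \<subseteq> {..<q}" unfolding rr_def using q by (auto simp: nat_less_iff)
    ultimately show ?thesis by (simp add: bij_betw_def endo_inj_surj)
  qed
  have le: "norm (\<Sum>m<N. unit_exp ((\<beta> * real j + x0) * real m)) \<le> B (rr j)" if j: "j < q" for j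
  proof (cases "2 \<le> rr j \<and> rr j + 3 \<le> q")
    case False
    have "norm (\<Sum>m<N. unit_exp ((\<beta> * real j + x0) * real m)) \<le> (\<Sum>m<N. norm (unit_exp ((\<beta> * real j + x0) * real m)))"
      by (rule norm_sum)
    moreover have "B (rr j) = real N" unfolding B_def by (rule if_not_P[OF False])
    ultimately show ?thesis by simp
  next
    case True
    define r where "r = rr j"
    define z where "z = (a * int j + c) div int q"
    define y where "y = \<beta> * real j + x0 - of_int z"
    have "a * int j + c = z * int q + int r"
      unfolding z_def r_def rr_def using q by simp
    then have zr: "real_of_int a * real j + of_int c = of_int z * real q + real r"
      by (metis of_int_add of_int_mult of_int_of_nat_eq)
    have c1: "of_int c \<le> real q * x0" "real q * x0 < of_int c + 1" unfolding c_def by linarith+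
    have b1: "\<bar>real q * \<beta> * real j - of_int a * real j\<bar> \<le> 1"
    proof -
      have "real q * \<beta> * real j - of_int a * real j = (\<beta> - of_int a / real q) * (real q * real j)"
        using q0 by (simp add: field_simps)
      then have "\<bar>real q * \<beta> * real j - of_int a * real j\<bar> = \<bar>\<beta> - of_int a / real q\<bar> * (real q * real j)"
        by (simp add: abs_mult)
      also have "\<dots> \<le> 1 / (real q)\<^sup>2 * (real q * real q)"
        using \<beta> j by (intro mult_mono) auto
      finally show ?thesis using q0 by (simp add: power2_eq_square)
    qed
    have qy: "real q * y = (real q * \<beta> * real j - of_int a * real j) + (real q * x0 - of_int c) + real r"
      using zr unfolding y_def by (simp add: algebra_simps)
    have y1: "real r - 1 \<le> real q * y" and y2: "real q * y \<le> real r + 2" using b1 c1 unfolding qy by linarith+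
    have r: "real r \<ge> 2" "real r + 3 \<le> real q" using True unfolding r_def[symmetric] by linarith+
    have ly: "(real r - 1) / real q \<le> y" using y1 q0 by (simp add: pos_divide_le_eq mult.commute)
    have uy: "(real q - real r - 2) / real q \<le> 1 - y" using y2 unfolding pos_divide_le_eq[OF q0] left_diff_distrib by (simp add: mult.commute)
    have py: "0 < (real r - 1) / real q" "0 < (real q - real r - 2) / real q" using r q0 by auto
    have "norm (\<Sum>m<N. unit_exp ((\<beta> * real j + x0) * real m)) \<le> 1 / min y (1 - y)"
      by (rule geometric_bound[of _ z]) (use ly uy py in \<open>auto simp: y_def\<close>)
    also have "\<dots> \<le> 1 / y + 1 / (1 - y)" using ly uy py by (auto simp: min_def)
    also have "\<dots> \<le> 1 / ((real r - 1) / real q) + 1 / ((real q - real r - 2) / real q)"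
      using ly uy py by (intro add_mono divide_left_mono mult_pos_pos) auto
    also have "\<dots> = B r" using True unfolding B_def r_def by simp
    finally show ?thesis unfolding r_def .
  qed
  have "(\<Sum>j<q. norm (\<Sum>m<N. unit_exp ((\<beta> * real j + x0) * real m))) \<le> (\<Sum>j<q. B (rr j))"
    using le by (intro sum_mono) auto
  also have "\<dots> = (\<Sum>r<q. B r)" by (rule sum.reindex_bij_betw[OF bij])
  also have "\<dots> = (\<Sum>r\<in>{r. r < q \<and> \<not> (2 \<le> r \<and> r + 3 \<le> q)}. B r) + (\<Sum>r\<in>{r. 2 \<le> r \<and> r + 3 \<le> q}. B r)"
    by (subst sum.union_disjoint[symmetric]) (auto intro: finite_subset[of _ "{..<q}"] intro!: sum.cong)
  also have "(\<Sum>r\<in>{r. r < q \<and> \<not> (2 \<le> r \<and> r + 3 \<le> q)}. B r) \<le> 4 * real N"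
  proof -
    have sub: "{r. r < q \<and> \<not> (2 \<le> r \<and> r + 3 \<le> q)} \<subseteq> {0, 1, q - 2, q - 1}" by auto
    have "card {r. r < q \<and> \<not> (2 \<le> r \<and> r + 3 \<le> q)} \<le> card {0, 1, q - 2, q - 1}"
      by (rule card_mono[OF _ sub]) simp
    also have "\<dots> \<le> 4" using card_length[of "[0, 1, q - 2, q - 1]"] by simp
    finally have "real (card {r. r < q \<and> \<not> (2 \<le> r \<and> r + 3 \<le> q)}) * real N \<le> 4 * real N"
      by (intro mult_right_mono) auto
    moreover have "(\<Sum>r\<in>{r. r < q \<and> \<not> (2 \<le> r \<and> r + 3 \<le> q)}. B r) = (\<Sum>r\<in>{r. r < q \<and> \<not> (2 \<le> r \<and> r + 3 \<le> q)}. real N)"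
      by (intro sum.cong) (auto simp: B_def)
    ultimately show ?thesis by simp
  qed
  also have "(\<Sum>r\<in>{r. 2 \<le> r \<and> r + 3 \<le> q}. B r) \<le> 2 * real q * (1 + ln (real q))"
  proof -
    have fin: "finite {r. 2 \<le> r \<and> r + 3 \<le> q}" by (rule finite_subset[of _ "{..<q}"]) auto
    have h: "(\<Sum>r\<in>{r. 2 \<le> r \<and> r + 3 \<le> q}. real q / real (g r)) \<le> real q * harm q"
      if "inj_on g {r. 2 \<le> r \<and> r + 3 \<le> q}" "\<And>r. 2 \<le> r \<Longrightarrow> r + 3 \<le> q \<Longrightarrow> g r \<in> {1..q}" for g :: "nat \<Rightarrow> nat"
    proof -
      have "(\<Sum>r\<in>{r. 2 \<le> r \<and> r + 3 \<le> q}. real q / real (g r)) = (\<Sum>i\<in>g ` {r. 2 \<le> r \<and> r + 3 \<le> q}. real q / real i)"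
        by (subst sum.reindex[OF that(1)]) simp
      also have "\<dots> \<le> (\<Sum>i\<in>{1..q}. real q / real i)" using that(2) by (intro sum_mono2) auto
      also have "\<dots> = real q * harm q" by (simp add: harm_def sum_distrib_left divide_inverse)
      finally show ?thesis .
    qed
    have "(\<Sum>r\<in>{r. 2 \<le> r \<and> r + 3 \<le> q}. B r) =
       (\<Sum>r\<in>{r. 2 \<le> r \<and> r + 3 \<le> q}. real q / real (r - 1)) + (\<Sum>r\<in>{r. 2 \<le> r \<and> r + 3 \<le> q}. real q / real (q - r - 2))"
      unfolding sum.distrib[symmetric] by (intro sum.cong) (auto simp: B_def of_nat_diff)
    also have "\<dots> \<le> real q * harm q + real q * harm q"
      by (intro add_mono h) (auto simp: inj_on_def)
    also have "\<dots> \<le> 2 * real q * (1 + ln (real q))"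
      using harm_le_ln[OF q] q0 by simp
    finally show ?thesis .
  qed
  finally show ?thesis by simp
qed

text \<open>The interval is covered by blocks of length q, whose starting points go into the shift
  \<open>x0\<close>.\<close>

lemma geometric_sum_total:
  fixes a :: int and q U :: nat
  assumes q: "q \<ge> 1" and cop: "coprime a (int q)" and \<beta>: "\<bar>\<beta> - of_int a / real q\<bar> \<le> 1 / (real q)\<^sup>2"
  shows "(\<Sum>u\<in>{- int U..int U}. norm (\<Sum>m<N. unit_exp (\<beta> * of_int u * real m)))
     \<le> (2 * real U / real q + 1) * (4 * real N + 2 * real q * (1 + ln (real q)))"
proof -
  define B where "B = (2 * U) div q + 1"
  let ?D = "\<lambda>u::int. norm (\<Sum>m<N. unit_exp (\<beta> * of_int u * real m))"
  have lt: "2 * U + 1 \<le> B * q" unfolding B_def using q dividend_less_div_times[of q "2 * U"] by simp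
  have "(\<Sum>u\<in>{- int U..int U}. ?D u) = (\<Sum>t<2 * U + 1. ?D (int t - int U))"
    by (rule sum.reindex_bij_witness[of _ "\<lambda>t. int t - int U" "\<lambda>u. nat (u + int U)"]) auto
  also have "\<dots> \<le> (\<Sum>t<B * q. ?D (int t - int U))"
    using lt by (intro sum_mono2) auto
  also have "\<dots> = (\<Sum>i<B. \<Sum>j<q. ?D (int (j + i * q) - int U))" by (rule sum_mult_product)
  also have "\<dots> = (\<Sum>i<B. \<Sum>j<q. norm (\<Sum>m<N. unit_exp ((\<beta> * real j + \<beta> * (real (i * q) - real U)) * real m)))"
    by (intro sum.cong refl arg_cong[where f = norm]) (simp add: algebra_simps)
  also have "\<dots> \<le> (\<Sum>i<B. 4 * real N + 2 * real q * (1 + ln (real q)))"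
    by (intro sum_mono geometric_block[OF assms])
  also have "\<dots> = real B * (4 * real N + 2 * real q * (1 + ln (real q)))" by simp
  also have "\<dots> \<le> (2 * real U / real q + 1) * (4 * real N + 2 * real q * (1 + ln (real q)))"
  proof (rule mult_right_mono)
    have "real ((2 * U) div q) \<le> real (2 * U) / real q" by (rule of_nat_div_le_of_nat)
    then show "real B \<le> 2 * real U / real q + 1" unfolding B_def by simp
    have "ln (real q) \<ge> 0" using q by simp
    then show "0 \<le> 4 * real N + 2 * real q * (1 + ln (real q))" by simp
  qed
  finally show ?thesis .
qed

text \<open>The weights on the right do not depend on the position \<open>m\<close> of the interval, so that one can average over \<open>m\<close>.\<close>
lemma completion:
  fixes b :: "int \<Rightarrow> complex" and N m :: nat
  assumes m: "m < N"
  defines "P \<equiv> 2 * N + 1"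
  shows "norm (\<Sum>x\<in>{- int m..<int N - int m}. b x) \<le>
    (\<Sum>h<P. norm (\<Sum>i<N. unit_exp (real h / real P * real i)) / real P *
       norm (\<Sum>x\<in>{- int N..int N}. b x * unit_exp (real h / real P * of_int x)))"
proof -
  let ?I = "{- int m..<int N - int m}" and ?S = "{- int N..int N}"
  have P0: "real P > 0" unfolding P_def by simp
  have orth: "(\<Sum>h<P. unit_exp (real h / real P * of_int t)) = (if int P dvd t then of_nat P else 0)" for t :: int
  proof -
    let ?z = "unit_exp (of_int t / real P)"
    have e: "unit_exp (real h / real P * of_int t) = ?z ^ h" for h
      unfolding unit_exp_power[symmetric] by (simp add: mult_ac)
    have "?z ^ P = 1" unfolding unit_exp_power[symmetric] using P0 by simp
    moreover have "?z = 1 \<longleftrightarrow> int P dvd t"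
    proof -
      have "of_int t / real P \<in> \<int> \<longleftrightarrow> int P dvd t"
      proof
        assume "of_int t / real P \<in> \<int>"
        then obtain z where "of_int t / real P = of_int z" by (auto elim: Ints_cases)
        then have "real_of_int t = of_int (int P * z)" using P0 by (simp add: divide_eq_eq mult.commute)
        then have "t = int P * z" by (rule of_int_eq_iff[THEN iffD1])
        then show "int P dvd t" by simp
      next
        assume "int P dvd t"
        then obtain z where "t = int P * z" by (rule dvdE)
        then have "of_int t / real P = of_int z" using P0 by simp
        then show "of_int t / real P \<in> \<int>" by simp
      qed
      then show ?thesis by (simp add: unit_exp_eq_1_iff)
    qed
    moreover have "(\<Sum>h<P. ?z ^ h) = 0" if "?z ^ P = 1" "?z \<noteq> 1"
      using one_diff_power_eq[of ?z P] that by simp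
    ultimately show ?thesis unfolding e by (cases "?z = 1") auto
  qed
  \<comment> \<open>Differences x - y are at most 2 N in absolute value, so for P = 2 N + 1
    divisibility by P means equality.\<close>
  have ind: "(\<Sum>y\<in>?I. \<Sum>h<P. unit_exp (real h / real P * of_int (x - y))) = (if x \<in> ?I then of_nat P else 0)"
    if x: "x \<in> ?S" for x
  proof -
    have "int P dvd x - y \<longleftrightarrow> y = x" if y: "y \<in> ?I" for y
    proof
      assume "int P dvd x - y"
      then have "x - y \<noteq> 0 \<Longrightarrow> int P \<le> \<bar>x - y\<bar>" using dvd_imp_le_int[of "x - y" "int P"] by simp
      moreover have "\<bar>x - y\<bar> < int P" using x y m unfolding P_def by auto
      ultimately show "y = x" by linarith
    qed simp
    then have "(\<Sum>y\<in>?I. \<Sum>h<P. unit_exp (real h / real P * of_int (x - y))) = (\<Sum>y\<in>?I. if y = x then of_nat P else 0)"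
      unfolding orth by (intro sum.cong) auto
    also have "\<dots> = (if x \<in> ?I then of_nat P else 0)" by (subst sum.delta) auto
    finally show ?thesis .
  qed
  \<comment> \<open>Moving the interval by m multiplies the kernel by a factor of norm 1.\<close>
  have kern: "norm (\<Sum>y\<in>?I. unit_exp (real h / real P * of_int (- y))) = norm (\<Sum>i<N. unit_exp (real h / real P * real i))" for h
  proof -
    have "(\<Sum>y\<in>?I. unit_exp (real h / real P * of_int (- y))) = (\<Sum>i<N. unit_exp (real h / real P * of_int (- (int i - int m))))"
      by (rule sum.reindex_bij_witness[of _ "\<lambda>i. int i - int m" "\<lambda>y. nat (y + int m)"]) auto
    also have "\<dots> = (\<Sum>i<N. unit_exp (real h / real P * real m) * cnj (unit_exp (real h / real P * real i)))"
      unfolding unit_exp_minus[symmetric] unit_exp_add[symmetric]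
      by (intro sum.cong refl arg_cong[where f = unit_exp]) (simp add: right_diff_distrib diff_divide_distrib)
    also have "\<dots> = unit_exp (real h / real P * real m) * cnj (\<Sum>i<N. unit_exp (real h / real P * real i))"
      by (simp add: sum_distrib_left)
    finally show ?thesis by (simp only: norm_mult norm_unit_exp complex_mod_cnj mult_1)
  qed
  have sub: "?I \<subseteq> ?S" using m by auto
  have "of_nat P * (\<Sum>x\<in>?I. b x) = (\<Sum>x\<in>?S. b x * (if x \<in> ?I then of_nat P else 0))"
  proof -
    have "(\<Sum>x\<in>?S. b x * (if x \<in> ?I then of_nat P else 0)) = (\<Sum>x\<in>?I. b x * (if x \<in> ?I then of_nat P else 0))"
      using sub by (intro sum.mono_neutral_right) auto
    then show ?thesis by (simp add: sum_distrib_left mult.commute)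
  qed
  also have "\<dots> = (\<Sum>x\<in>?S. b x * (\<Sum>y\<in>?I. \<Sum>h<P. unit_exp (real h / real P * of_int (x - y))))"
    by (intro sum.cong refl arg_cong2[where f = times] ind[symmetric])
  also have "\<dots> = (\<Sum>x\<in>?S. \<Sum>y\<in>?I. \<Sum>h<P. unit_exp (real h / real P * of_int (- y)) * (b x * unit_exp (real h / real P * of_int x)))"
  proof -
    have "unit_exp (real h / real P * of_int (x - y)) = unit_exp (real h / real P * of_int (- y)) * unit_exp (real h / real P * of_int x)" for h x y
      unfolding unit_exp_add[symmetric] by (rule arg_cong[where f = unit_exp]) (simp add: right_diff_distrib diff_divide_distrib)
    then show ?thesis by (simp only: sum_distrib_left mult.left_commute)
  qed
  also have "\<dots> = (\<Sum>h<P. \<Sum>x\<in>?S. \<Sum>y\<in>?I. unit_exp (real h / real P * of_int (- y)) * (b x * unit_exp (real h / real P * of_int x)))"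
    by (rule trans[OF sum.cong[OF refl sum.swap] sum.swap])
  also have "\<dots> = (\<Sum>h<P. (\<Sum>y\<in>?I. unit_exp (real h / real P * of_int (- y))) * (\<Sum>x\<in>?S. b x * unit_exp (real h / real P * of_int x)))"
    by (intro sum.cong refl, subst sum.swap) (simp only: sum_product)
  finally have "real P * norm (\<Sum>x\<in>?I. b x) = norm (\<Sum>h<P. (\<Sum>y\<in>?I. unit_exp (real h / real P * of_int (- y))) * (\<Sum>x\<in>?S. b x * unit_exp (real h / real P * of_int x)))"
    by (metis norm_mult norm_of_nat)
  also have "\<dots> \<le> (\<Sum>h<P. norm (\<Sum>i<N. unit_exp (real h / real P * real i)) * norm (\<Sum>x\<in>?S. b x * unit_exp (real h / real P * of_int x)))"
    unfolding kern[symmetric] norm_mult[symmetric] by (rule norm_sum)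
  finally have "norm (\<Sum>x\<in>?I. b x) \<le> (\<Sum>h<P. norm (\<Sum>i<N. unit_exp (real h / real P * real i)) * norm (\<Sum>x\<in>?S. b x * unit_exp (real h / real P * of_int x))) / real P"
    using P0 by (simp add: pos_le_divide_eq mult.commute)
  also have "\<dots> = (\<Sum>h<P. norm (\<Sum>i<N. unit_exp (real h / real P * real i)) / real P *
       norm (\<Sum>x\<in>?S. b x * unit_exp (real h / real P * of_int x)))"
    by (simp add: sum_divide_distrib)
  finally show ?thesis .
qed


section \<open>Mean values and moments of Weyl sums\<close>

definition psum :: "nat \<Rightarrow> nat \<Rightarrow> (nat \<Rightarrow> int) \<Rightarrow> int" where
  "psum s j \<tau> = (\<Sum>i<s. \<tau> i ^ j)"

abbreviation tuples :: "nat \<Rightarrow> int set \<Rightarrow> (nat \<Rightarrow> int) set" where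
  "tuples s S \<equiv> PiE {..<s} (\<lambda>_. S)"

lemma finite_tuples [simp]: "finite S \<Longrightarrow> finite (tuples s S)"
  by (intro finite_PiE) auto

lemma sum_power_eq_tuples:
  fixes g :: "int \<Rightarrow> complex"
  assumes "finite S"
  shows "(\<Sum>x\<in>S. g x) ^ s = (\<Sum>\<tau>\<in>tuples s S. \<Prod>i<s. g (\<tau> i))"
  using prod_sum_PiE[of "{..<s}" "\<lambda>_. S" "\<lambda>_. g"] assms by simp

lemma sum_group_image:
  fixes g :: "'a \<Rightarrow> 'c::comm_monoid_add"
  assumes "finite T"
  shows "(\<Sum>\<tau>\<in>T. g \<tau>) = (\<Sum>y\<in>H ` T. \<Sum>\<tau> | \<tau> \<in> T \<and> H \<tau> = y. g \<tau>)"
  by (rule sum.group[symmetric]) (use assms in auto)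

text \<open>What orthogonality leaves of a double sum over tuples: one square for each fibre of
  \<open>H\<close>.\<close>

lemma sum_pairs_same_key:
  fixes W :: "'a \<Rightarrow> complex"
  assumes T: "finite T"
  shows "(\<Sum>\<tau>\<in>T. \<Sum>\<tau>'\<in>T. if H \<tau> = H \<tau>' then W \<tau> * cnj (W \<tau>') else 0) =
    of_real (\<Sum>y\<in>H ` T. (norm (\<Sum>\<tau> | \<tau> \<in> T \<and> H \<tau> = y. W \<tau>))\<^sup>2)"
proof -
  have "(\<Sum>\<tau>\<in>T. \<Sum>\<tau>'\<in>T. if H \<tau> = H \<tau>' then W \<tau> * cnj (W \<tau>') else 0) =
     (\<Sum>y\<in>H ` T. \<Sum>\<tau> | \<tau> \<in> T \<and> H \<tau> = y. \<Sum>\<tau>'\<in>T. if H \<tau> = H \<tau>' then W \<tau> * cnj (W \<tau>') else 0)"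
    by (rule sum_group_image[OF T])
  also have "\<dots> = (\<Sum>y\<in>H ` T. \<Sum>\<tau> | \<tau> \<in> T \<and> H \<tau> = y. \<Sum>\<tau>' | \<tau>' \<in> T \<and> H \<tau>' = y. W \<tau> * cnj (W \<tau>'))"
  proof (rule sum.cong[OF refl], rule sum.cong[OF refl])
    fix y \<tau> assume "\<tau> \<in> {\<tau> \<in> T. H \<tau> = y}"
    then have "(\<Sum>\<tau>'\<in>T. if H \<tau> = H \<tau>' then W \<tau> * cnj (W \<tau>') else 0) = (\<Sum>\<tau>'\<in>T. if H \<tau>' = y then W \<tau> * cnj (W \<tau>') else 0)"
      by (intro sum.cong) auto
    also have "\<dots> = (\<Sum>\<tau>' | \<tau>' \<in> T \<and> H \<tau>' = y. W \<tau> * cnj (W \<tau>'))"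
      by (rule sum.inter_filter[OF T, symmetric])
    finally show "(\<Sum>\<tau>'\<in>T. if H \<tau> = H \<tau>' then W \<tau> * cnj (W \<tau>') else 0) = (\<Sum>\<tau>' | \<tau>' \<in> T \<and> H \<tau>' = y. W \<tau> * cnj (W \<tau>'))" .
  qed
  also have "\<dots> = of_real (\<Sum>y\<in>H ` T. (norm (\<Sum>\<tau> | \<tau> \<in> T \<and> H \<tau> = y. W \<tau>))\<^sup>2)"
    by (simp only: of_real_sum complex_norm_square sum_product cnj_sum)
  finally show ?thesis .
qed

text \<open>Power sums are bounded by s X ^ k, so for Q above twice that value congruences between
  them modulo Q are equations, and the average over characters becomes a weighted count of solutions
  of Vinogradov's system. The labelling \<open>H\<close> has to separate tuples just as the power
  sums do; its shape can be adapted to the application.\<close>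

lemma parseval_tuples:
  fixes w :: "int \<Rightarrow> complex" and X :: nat
  assumes S: "finite S" "\<And>x. x \<in> S \<Longrightarrow> \<bar>x\<bar> \<le> int X" and X: "X \<ge> 1" and Q: "Q > 2 * int s * int X ^ k"
    and H: "\<And>\<tau> \<tau>'. \<tau> \<in> tuples s S \<Longrightarrow> \<tau>' \<in> tuples s S \<Longrightarrow> H \<tau> = H \<tau>' \<longleftrightarrow> (\<forall>j\<in>{1..k}. psum s j \<tau> = psum s j \<tau>')"
  shows "avg (chars k Q) (\<lambda>\<phi>. norm (\<Sum>x\<in>S. w x * \<phi> x) ^ (2 * s)) =
    (\<Sum>y\<in>H ` tuples s S. (norm (\<Sum>\<tau> | \<tau> \<in> tuples s S \<and> H \<tau> = y. \<Prod>i<s. w (\<tau> i)))\<^sup>2)"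
proof -
  let ?T = "tuples s S" and ?G = "chars k Q"
  have "2 * int s * int X ^ k \<ge> 0" by simp
  then have Q0: "Q > 0" using Q by linarith
  define W where "W \<tau> = (\<Prod>i<s. w (\<tau> i))" for \<tau> :: "nat \<Rightarrow> int"
  define \<Phi> where "\<Phi> \<tau> \<phi> = (\<Prod>i<s. \<phi> (\<tau> i))" for \<tau> :: "nat \<Rightarrow> int" and \<phi> :: "int \<Rightarrow> complex"
  have pw: "(\<Sum>x\<in>S. w x * \<phi> x) ^ s = (\<Sum>\<tau>\<in>?T. W \<tau> * \<Phi> \<tau> \<phi>)" for \<phi>
    unfolding sum_power_eq_tuples[OF S(1)] W_def \<Phi>_def by (simp add: prod.distrib)
  have \<Phi>_char: "\<Phi> \<tau> (\<lambda>x. unit_exp (of_int (poly P x) / of_int Q)) = unit_exp ((\<Sum>j\<le>k. of_int (coeff P j) * of_int (psum s j \<tau>)) / of_int Q)"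
    if P: "degree P \<le> k" for P \<tau>
  proof -
    have "poly P x = (\<Sum>j\<le>k. coeff P j * x ^ j)" for x
      unfolding poly_altdef using P by (intro sum.mono_neutral_left) (auto simp: coeff_eq_0)
    then have "(\<Sum>i<s. poly P (\<tau> i)) = (\<Sum>j\<le>k. coeff P j * psum s j \<tau>)"
      unfolding psum_def sum_distrib_left by (simp add: sum.swap[of _ "{..k}"])
    then have "(\<Sum>i<s. real_of_int (poly P (\<tau> i))) = (\<Sum>j\<le>k. of_int (coeff P j) * of_int (psum s j \<tau>))"
      by (metis (mono_tags, lifting) of_int_mult of_int_sum sum.cong)
    then show ?thesis unfolding \<Phi>_def unit_exp_sum[symmetric] sum_divide_distrib[symmetric] by simp
  qed
  have orth: "(\<Sum>\<phi>\<in>?G. \<Phi> \<tau> \<phi> * cnj (\<Phi> \<tau>' \<phi>)) = (if H \<tau> = H \<tau>' then of_nat (card ?G) else 0)"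
    if \<tau>: "\<tau> \<in> ?T" "\<tau>' \<in> ?T" for \<tau> \<tau>'
  proof (cases "H \<tau> = H \<tau>'")
    case True
    then have e: "psum s j \<tau> = psum s j \<tau>'" if "j \<le> k" for j
      using H[OF \<tau>] that by (cases "j = 0") (auto simp: psum_def)
    have "\<Phi> \<tau> \<phi> * cnj (\<Phi> \<tau>' \<phi>) = 1" if \<phi>: "\<phi> \<in> ?G" for \<phi>
    proof -
      obtain P where P: "degree P \<le> k" "\<phi> = (\<lambda>x. unit_exp (of_int (poly P x) / of_int Q))"
        using \<phi> by (rule charsE)
      have "\<Phi> \<tau> \<phi> = \<Phi> \<tau>' \<phi>" unfolding P(2) \<Phi>_char[OF P(1)] using e by simp
      moreover have "norm (\<Phi> \<tau>' \<phi>) = 1" unfolding \<Phi>_def using \<phi> by (simp add: prod_norm[symmetric])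
      ultimately show ?thesis using complex_norm_square[of "\<Phi> \<tau>' \<phi>"] by simp
    qed
    then show ?thesis using True by simp
  next
    case False
    then obtain j where j: "j \<in> {1..k}" "psum s j \<tau> \<noteq> psum s j \<tau>'" using H[OF \<tau>] by blast
    define \<theta> where "\<theta> = (\<lambda>x. unit_exp (of_int (poly (monom 1 j) x) / of_int Q))"
    have dj: "degree (monom (1::int) j) \<le> k" using j by (simp add: degree_monom_eq)
    have \<theta>: "\<theta> \<in> ?G" unfolding \<theta>_def by (rule charsI[OF dj])
    have \<Phi>\<theta>: "\<Phi> \<sigma> \<theta> = unit_exp (of_int (psum s j \<sigma>) / of_int Q)" for \<sigma>
    proof -
      have "(\<Sum>i\<le>k. real_of_int (coeff (monom 1 j) i) * of_int (psum s i \<sigma>)) = (\<Sum>i\<le>k. if i = j then of_int (psum s j \<sigma>) else 0)"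
        by (intro sum.cong) auto
      also have "\<dots> = of_int (psum s j \<sigma>)" using j by simp
      finally show ?thesis unfolding \<theta>_def \<Phi>_char[OF dj] by simp
    qed
    have bnd: "\<bar>psum s j \<sigma>\<bar> \<le> int s * int X ^ k" if "\<sigma> \<in> ?T" for \<sigma>
    proof -
      have "\<bar>psum s j \<sigma>\<bar> \<le> (\<Sum>i<s. \<bar>\<sigma> i ^ j\<bar>)" unfolding psum_def by (rule sum_abs)
      also have "\<dots> \<le> (\<Sum>i<s. int X ^ k)"
      proof (rule sum_mono)
        fix i assume "i \<in> {..<s}"
        then have "\<bar>\<sigma> i\<bar> \<le> int X" using that S(2) by auto
        then have "\<bar>\<sigma> i\<bar> ^ j \<le> int X ^ j" by (intro power_mono) auto
        also have "\<dots> \<le> int X ^ k" using X j by (intro power_increasing) auto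
        finally show "\<bar>\<sigma> i ^ j\<bar> \<le> int X ^ k" by (simp add: power_abs)
      qed
      finally show ?thesis by simp
    qed
    have "(\<Sum>\<phi>\<in>?G. \<Phi> \<tau> \<phi> * cnj (\<Phi> \<tau>' \<phi>)) = 0"
    proof (rule sum_chars_eq_zero[OF Q0 \<theta>])
      show "\<Phi> \<tau> (\<lambda>x. \<phi> x * \<theta> x) * cnj (\<Phi> \<tau>' (\<lambda>x. \<phi> x * \<theta> x)) = (\<Phi> \<tau> \<theta> * cnj (\<Phi> \<tau>' \<theta>)) * (\<Phi> \<tau> \<phi> * cnj (\<Phi> \<tau>' \<phi>))" for \<phi>
        unfolding \<Phi>_def by (simp add: prod.distrib)
      have "\<Phi> \<tau> \<theta> * cnj (\<Phi> \<tau>' \<theta>) = unit_exp (of_int (psum s j \<tau> - psum s j \<tau>') / of_int Q)"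
        unfolding \<Phi>\<theta> unit_exp_minus[symmetric] unit_exp_add[symmetric] by (simp add: diff_divide_distrib)
      moreover have "real_of_int (psum s j \<tau> - psum s j \<tau>') / of_int Q \<notin> \<int>"
      proof
        assume "real_of_int (psum s j \<tau> - psum s j \<tau>') / of_int Q \<in> \<int>"
        then obtain z where z: "real_of_int (psum s j \<tau> - psum s j \<tau>') / of_int Q = of_int z" by (auto elim: Ints_cases)
        have "real_of_int Q \<noteq> 0" using Q0 by linarith
        then have "real_of_int (psum s j \<tau> - psum s j \<tau>') = of_int (z * Q)" using z by (simp add: divide_eq_eq)
        then have "Q dvd psum s j \<tau> - psum s j \<tau>'" by (metis dvd_triv_right of_int_eq_iff)
        then have "\<bar>Q\<bar> \<le> \<bar>psum s j \<tau> - psum s j \<tau>'\<bar>" using j by (intro dvd_imp_le_int) auto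
        moreover have "\<bar>psum s j \<tau> - psum s j \<tau>'\<bar> \<le> 2 * int s * int X ^ k"
          using bnd[OF \<tau>(1)] bnd[OF \<tau>(2)] by linarith
        ultimately show False using Q Q0 by linarith
      qed
      ultimately show "\<Phi> \<tau> \<theta> * cnj (\<Phi> \<tau>' \<theta>) \<noteq> 1" by (simp add: unit_exp_eq_1_iff)
    qed
    then show ?thesis using False by simp
  qed
  have "complex_of_real (\<Sum>\<phi>\<in>?G. norm (\<Sum>x\<in>S. w x * \<phi> x) ^ (2 * s)) =
     (\<Sum>\<phi>\<in>?G. \<Sum>\<tau>\<in>?T. \<Sum>\<tau>'\<in>?T. (W \<tau> * cnj (W \<tau>')) * (\<Phi> \<tau> \<phi> * cnj (\<Phi> \<tau>' \<phi>)))"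
  proof -
    have "norm (\<Sum>x\<in>S. w x * \<phi> x) ^ (2 * s) = (norm (\<Sum>\<tau>\<in>?T. W \<tau> * \<Phi> \<tau> \<phi>))\<^sup>2" for \<phi>
      unfolding pw[symmetric] norm_power by (simp add: power_mult[symmetric] mult.commute)
    then show ?thesis
      by (simp only: of_real_sum complex_norm_square sum_product cnj_sum complex_cnj_mult mult_ac)
  qed
  also have "\<dots> = (\<Sum>\<tau>\<in>?T. \<Sum>\<tau>'\<in>?T. (W \<tau> * cnj (W \<tau>')) * (\<Sum>\<phi>\<in>?G. \<Phi> \<tau> \<phi> * cnj (\<Phi> \<tau>' \<phi>)))"
    unfolding sum_distrib_left by (rule trans[OF sum.swap sum.cong[OF refl sum.swap]])
  also have "\<dots> = (\<Sum>\<tau>\<in>?T. \<Sum>\<tau>'\<in>?T. of_nat (card ?G) * (if H \<tau> = H \<tau>' then W \<tau> * cnj (W \<tau>') else 0))"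
    using orth by (intro sum.cong refl) auto
  also have "\<dots> = of_nat (card ?G) * of_real (\<Sum>y\<in>H ` ?T. (norm (\<Sum>\<tau> | \<tau> \<in> ?T \<and> H \<tau> = y. W \<tau>))\<^sup>2)"
    unfolding sum_distrib_left[symmetric] using S by (subst sum_pairs_same_key) auto
  also have "\<dots> = complex_of_real (real (card ?G) * (\<Sum>y\<in>H ` ?T. (norm (\<Sum>\<tau> | \<tau> \<in> ?T \<and> H \<tau> = y. W \<tau>))\<^sup>2))"
    by simp
  finally have "(\<Sum>\<phi>\<in>?G. norm (\<Sum>x\<in>S. w x * \<phi> x) ^ (2 * s)) = real (card ?G) * (\<Sum>y\<in>H ` ?T. (norm (\<Sum>\<tau> | \<tau> \<in> ?T \<and> H \<tau> = y. W \<tau>))\<^sup>2)"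
    by (rule of_real_eq_iff[THEN iffD1])
  moreover have "real (card ?G) \<noteq> 0" using Q0 by simp
  ultimately show ?thesis unfolding avg_def W_def by simp
qed

text \<open>The scale n is the least one with p ^ n > 2 s N: each class modulo p ^ n then meets S in
  at most one point, and every piece has norm at most 1. Minimality gives p ^ n \<le> 2 s p N, so p
  ^ (\<epsilon> n) is at most N ^ \<epsilon> times a constant, p being fixed once k and \<epsilon>
  are given.\<close>

lemma mean_value:
  fixes \<epsilon> :: real
  assumes k: "k \<ge> 1" and \<epsilon>: "\<epsilon> > 0"
  shows "\<exists>C\<ge>1. \<forall>(N::nat) S (w :: int \<Rightarrow> complex) (H :: (nat \<Rightarrow> int) \<Rightarrow> 'b). N \<ge> 1 \<longrightarrow> S \<subseteq> {- int N..int N} \<longrightarrow> (\<forall>x\<in>S. norm (w x) \<le> 1) \<longrightarrow>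
     (\<forall>\<tau>\<in>tuples (tri k) S. \<forall>\<tau>'\<in>tuples (tri k) S. H \<tau> = H \<tau>' \<longleftrightarrow> (\<forall>j\<in>{1..k}. psum (tri k) j \<tau> = psum (tri k) j \<tau>')) \<longrightarrow>
     (\<Sum>y\<in>H ` tuples (tri k) S. (norm (\<Sum>\<tau> | \<tau> \<in> tuples (tri k) S \<and> H \<tau> = y. \<Prod>i<tri k. w (\<tau> i)))\<^sup>2)
       \<le> C * real N powr \<epsilon> * real (card S) ^ tri k"
proof -
  let ?s = "tri k"
  have s: "?s \<ge> 1" using tri_pos[OF k] by simp
  obtain P where P: "\<And>p. prime p \<Longrightarrow> P \<le> p \<Longrightarrow> \<exists>C\<ge>1. \<forall>m. Dec p k m (C * real p powr (\<epsilon> * real m))"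
    using decoupling[OF k \<epsilon>] by blast
  obtain p where p: "prime p" "P < p" using bigger_prime by blast
  then obtain C where C: "C \<ge> 1" "\<And>m. Dec p k m (C * real p powr (\<epsilon> * real m))" using P[of p] by auto
  have p1: "p > 1" using p(1) prime_gt_1_nat by simp
  define B where "B = (2 * real ?s * real p) powr \<epsilon>"
  have B: "B \<ge> 1" unfolding B_def
  proof (rule ge_one_powr_ge_zero)
    have "1 * 1 \<le> real ?s * real p" using s p1 by (intro mult_mono) auto
    then show "1 \<le> 2 * real ?s * real p" by simp
  qed (use \<epsilon> in simp)
  show ?thesis
  proof (intro exI[of _ "C * B"] conjI allI impI)
    have "1 * 1 \<le> C * B" using C B by (intro mult_mono) auto
    then show "1 \<le> C * B" by simp
  next
    fix N :: nat and S and w :: "int \<Rightarrow> complex" and H :: "(nat \<Rightarrow> int) \<Rightarrow> 'b"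
    assume N: "N \<ge> 1" and S: "S \<subseteq> {- int N..int N}" and w: "\<forall>x\<in>S. norm (w x) \<le> 1"
      and H: "\<forall>\<tau>\<in>tuples ?s S. \<forall>\<tau>'\<in>tuples ?s S. H \<tau> = H \<tau>' \<longleftrightarrow> (\<forall>j\<in>{1..k}. psum ?s j \<tau> = psum ?s j \<tau>')"
    have finS: "finite S" using S by (rule finite_subset) simp
    have Sb: "\<bar>x\<bar> \<le> int N" if "x \<in> S" for x using subsetD[OF S that] by auto
    define n where "n = (LEAST n. 2 * ?s * N < p ^ n)"
    have ex: "\<exists>n. 2 * ?s * N < p ^ n" using p1 by (intro exI[of _ "2 * ?s * N"] power_gt_expt) simp
    then have n1: "2 * ?s * N < p ^ n" unfolding n_def by (rule LeastI_ex)
    have sN: "1 \<le> ?s * N" using s N by (metis mult_le_mono mult_1)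
    then have "n \<noteq> 0" using n1 by (cases n) auto
    then obtain n' where n': "n = Suc n'" by (cases n) auto
    have "\<not> 2 * ?s * N < p ^ n'" using not_less_Least[of n' "\<lambda>n. 2 * ?s * N < p ^ n"] n' unfolding n_def by simp
    then have "p ^ n \<le> p * (2 * ?s * N)" unfolding n' by simp
    then have "real (p ^ n) \<le> real (p * (2 * ?s * N))" by (rule of_nat_le_iff[THEN iffD2])
    then have pn: "real (p ^ n) \<le> 2 * real ?s * real p * real N" by (simp add: mult_ac)
    let ?Q = "int p ^ (k * n)"
    have Q: "?Q > 2 * int ?s * int N ^ k"
    proof -
      have "2 * ?s * N ^ k \<le> (2 * ?s * N) ^ k"
        unfolding power_mult_distrib[of "2 * ?s"] using k s by (intro mult_le_mono1 self_le_power) auto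
      also have "\<dots> < (p ^ n) ^ k" using n1 k by (intro power_strict_mono) auto
      finally have "2 * ?s * N ^ k < p ^ (k * n)" by (simp add: power_mult[symmetric] mult.commute)
      then have "int (2 * ?s * N ^ k) < int (p ^ (k * n))" by (rule of_nat_less_iff[THEN iffD2])
      then show ?thesis by simp
    qed
    have single: "x = y" if "x \<in> S" "y \<in> S" "int p ^ n dvd x - j" "int p ^ n dvd y - j" for x y j
    proof (rule ccontr)
      assume "x \<noteq> y"
      have "int p ^ n dvd (x - j) - (y - j)" using that(3,4) by (rule dvd_diff)
      then have "int p ^ n dvd x - y" by simp
      then have "\<bar>int p ^ n\<bar> \<le> \<bar>x - y\<bar>" using \<open>x \<noteq> y\<close> by (intro dvd_imp_le_int) auto
      moreover have "x \<in> {- int N..int N}" "y \<in> {- int N..int N}" using S that by auto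
      then have "\<bar>x - y\<bar> \<le> 2 * int N" by auto
      moreover have "2 * N \<le> 2 * ?s * N" using s by simp
      then have "int (2 * N) < int (p ^ n)" using n1 by linarith
      ultimately show False by simp
    qed
    define A where "A j = (if \<exists>x\<in>S. int p ^ n dvd x - int j then 1 else 0 :: real)" for j :: nat
    have A: "avg (chars k ?Q) (\<lambda>\<phi>. norm (ES p w S n (int j) \<phi>) ^ (2 * ?s)) \<le> A j ^ ?s" for j
    proof (cases "\<exists>x\<in>S. int p ^ n dvd x - int j")
      case True
      then obtain x where x: "x \<in> S" "int p ^ n dvd x - int j" by blast
      have "{y \<in> S. int p ^ n dvd y - int j} = {x}" using x single by blast
      then have "ES p w S n (int j) \<phi> = w x * \<phi> x" for \<phi> unfolding ES_def by simp
      then have "avg (chars k ?Q) (\<lambda>\<phi>. norm (ES p w S n (int j) \<phi>) ^ (2 * ?s)) \<le> avg (chars k ?Q) (\<lambda>\<phi>. 1)"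
        using w x by (intro avg_mono) (auto simp: norm_mult intro!: power_le_one)
      also have "\<dots> = 1" using p1 by (intro avg_const finite_chars) auto
      finally show ?thesis unfolding A_def using True by simp
    next
      case False
      then have "{y \<in> S. int p ^ n dvd y - int j} = {}" by blast
      then have "ES p w S n (int j) \<phi> = 0" for \<phi> unfolding ES_def by (simp only: sum.empty)
      then show ?thesis using s False unfolding A_def by (simp add: avg_def power_0_left)
    qed
    have sumA: "(\<Sum>j<p ^ n. A j) \<le> real (card S)"
    proof -
      have "(\<Sum>j<p ^ n. A j) = real (card {j \<in> {..<p ^ n}. \<exists>x\<in>S. int p ^ n dvd x - int j})"
        unfolding A_def by (subst sum.inter_filter[symmetric]) auto
      also have "{j \<in> {..<p ^ n}. \<exists>x\<in>S. int p ^ n dvd x - int j} \<subseteq> (\<lambda>x. nat (x mod int p ^ n)) ` S"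
      proof
        fix j assume "j \<in> {j \<in> {..<p ^ n}. \<exists>x\<in>S. int p ^ n dvd x - int j}"
        then obtain x where j: "j < p ^ n" and x: "x \<in> S" "int p ^ n dvd x - int j" by auto
        have "x mod int p ^ n = int j mod int p ^ n" using x by (simp add: mod_eq_dvd_iff)
        also have "\<dots> = int j" using j by (simp flip: of_nat_power)
        finally show "j \<in> (\<lambda>x. nat (x mod int p ^ n)) ` S" using x by force
      qed
      then have "card {j \<in> {..<p ^ n}. \<exists>x\<in>S. int p ^ n dvd x - int j} \<le> card ((\<lambda>x. nat (x mod int p ^ n)) ` S)"
        using finS by (intro card_mono) auto
      also have "\<dots> \<le> card S" using finS by (rule card_image_le)
      finally show ?thesis by simp
    qed
    have "(\<Sum>y\<in>H ` tuples ?s S. (norm (\<Sum>\<tau> | \<tau> \<in> tuples ?s S \<and> H \<tau> = y. \<Prod>i<?s. w (\<tau> i)))\<^sup>2) =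
       avg (chars k ?Q) (\<lambda>\<phi>. norm (\<Sum>x\<in>S. w x * \<phi> x) ^ (2 * ?s))"
      by (rule parseval_tuples[OF finS Sb N Q, symmetric]) (assumption, rule H[THEN bspec, THEN bspec], assumption+)
    also have "\<dots> = avg (chars k ?Q) (\<lambda>\<phi>. norm (ES p w S 0 0 \<phi>) ^ (2 * ?s))" by (simp add: ES_def)
    also have "\<dots> \<le> (C * real p powr (\<epsilon> * real n)) * (\<Sum>j<p ^ n. A j) ^ ?s"
      by (rule DecD[OF C(2) finS _ A]) (simp add: A_def)
    also have "\<dots> \<le> (C * (B * real N powr \<epsilon>)) * real (card S) ^ ?s"
    proof (intro mult_mono power_mono sumA)
      have "real p powr (\<epsilon> * real n) = real (p ^ n) powr \<epsilon>"
      proof -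
        have "real (p ^ n) powr \<epsilon> = (real p powr real n) powr \<epsilon>" using p1 by (simp add: powr_realpow)
        then show ?thesis by (simp add: powr_powr mult.commute)
      qed
      also have "\<dots> \<le> (2 * real ?s * real p * real N) powr \<epsilon>" using pn \<epsilon> by (intro powr_mono2) auto
      also have "\<dots> = B * real N powr \<epsilon>" unfolding B_def by (simp add: powr_mult)
      finally show "real p powr (\<epsilon> * real n) \<le> B * real N powr \<epsilon>" .
    qed (use C B in \<open>auto simp: A_def intro!: sum_nonneg mult_nonneg_nonneg zero_le_power\<close>)
    finally show "(\<Sum>y\<in>H ` tuples ?s S. (norm (\<Sum>\<tau> | \<tau> \<in> tuples ?s S \<and> H \<tau> = y. \<Prod>i<?s. w (\<tau> i)))\<^sup>2)
       \<le> C * B * real N powr \<epsilon> * real (card S) ^ ?s" by (simp add: mult_ac)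
  qed
qed

section \<open>The large sieve in one coefficient and moments over shifts\<close>

text \<open>The large sieve by Schur's test: after expanding the square, the kernel depends on y -
  y' only, so every row sum is at most the sum over all differences u with \<bar>u\<bar> \<le>
  U.\<close>

lemma bilinear_mean:
  fixes W :: "'a \<Rightarrow> complex" and h :: "'a \<Rightarrow> int" and U N :: nat
  assumes T: "finite T" and h: "\<And>\<tau> \<tau>'. \<tau> \<in> T \<Longrightarrow> \<tau>' \<in> T \<Longrightarrow> \<bar>h \<tau> - h \<tau>'\<bar> \<le> int U"
  shows "(\<Sum>m<N. (norm (\<Sum>\<tau>\<in>T. W \<tau> * unit_exp (\<theta> * of_int (h \<tau>) * real m)))\<^sup>2) \<le>
     (\<Sum>u\<in>{- int U..int U}. norm (\<Sum>m<N. unit_exp (\<theta> * of_int u * real m))) *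
     (\<Sum>y\<in>h ` T. (norm (\<Sum>\<tau> | \<tau> \<in> T \<and> h \<tau> = y. W \<tau>))\<^sup>2)"
proof -
  define R where "R y = (\<Sum>\<tau> | \<tau> \<in> T \<and> h \<tau> = y. W \<tau>)" for y
  define D where "D u = norm (\<Sum>m<N. unit_exp (\<theta> * of_int u * real m))" for u :: int
  let ?Y = "h ` T"
  have Y: "finite ?Y" using T by simp
  have g: "(\<Sum>\<tau>\<in>T. W \<tau> * unit_exp (\<theta> * of_int (h \<tau>) * real m)) = (\<Sum>y\<in>?Y. R y * unit_exp (\<theta> * of_int y * real m))" for m
    unfolding R_def sum_distrib_right by (subst sum_group_image[OF T, of _ h]) (auto intro!: sum.cong)
  have Dsym: "D (y' - y) = D (y - y')" for y y'
  proof -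
    have "(\<Sum>m<N. unit_exp (\<theta> * of_int (y' - y) * real m)) = cnj (\<Sum>m<N. unit_exp (\<theta> * of_int (y - y') * real m))"
      unfolding cnj_sum unit_exp_minus[symmetric]
      by (intro sum.cong refl arg_cong[where f = unit_exp]) (simp add: algebra_simps)
    then show ?thesis unfolding D_def by (simp only: complex_mod_cnj)
  qed
  have Dsum: "(\<Sum>y'\<in>?Y. D (y - y')) \<le> (\<Sum>u\<in>{- int U..int U}. D u)" if y: "y \<in> ?Y" for y
  proof -
    have inj: "inj_on (\<lambda>y'. y - y') ?Y" by (auto simp: inj_on_def)
    have "(\<Sum>y'\<in>?Y. D (y - y')) = (\<Sum>u\<in>(\<lambda>y'. y - y') ` ?Y. D u)" by (subst sum.reindex[OF inj]) simp
    also have "\<dots> \<le> (\<Sum>u\<in>{- int U..int U}. D u)"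
      using y h by (intro sum_mono2) (fastforce simp: D_def abs_le_iff)+
    finally show ?thesis .
  qed
  have "complex_of_real (\<Sum>m<N. (norm (\<Sum>y\<in>?Y. R y * unit_exp (\<theta> * of_int y * real m)))\<^sup>2) =
     (\<Sum>m<N. \<Sum>y\<in>?Y. \<Sum>y'\<in>?Y. (R y * cnj (R y')) * unit_exp (\<theta> * of_int (y - y') * real m))"
  proof -
    have "unit_exp (\<theta> * of_int (y - y') * real m) = unit_exp (\<theta> * of_int y * real m) * cnj (unit_exp (\<theta> * of_int y' * real m))" for y y' m
      unfolding unit_exp_minus[symmetric] unit_exp_add[symmetric] by (rule arg_cong[where f = unit_exp]) (simp add: algebra_simps)
    then show ?thesis
      by (simp only: of_real_sum complex_norm_square sum_product cnj_sum complex_cnj_mult mult_ac)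
  qed
  also have "\<dots> = (\<Sum>y\<in>?Y. \<Sum>y'\<in>?Y. (R y * cnj (R y')) * (\<Sum>m<N. unit_exp (\<theta> * of_int (y - y') * real m)))"
    unfolding sum_distrib_left by (rule trans[OF sum.swap sum.cong[OF refl sum.swap]])
  finally have "complex_of_real (\<Sum>m<N. (norm (\<Sum>y\<in>?Y. R y * unit_exp (\<theta> * of_int y * real m)))\<^sup>2) = \<dots>" .
  then have "norm (complex_of_real (\<Sum>m<N. (norm (\<Sum>y\<in>?Y. R y * unit_exp (\<theta> * of_int y * real m)))\<^sup>2)) \<le>
     (\<Sum>y\<in>?Y. \<Sum>y'\<in>?Y. (norm (R y) * norm (R y')) * D (y - y'))"
    unfolding D_def by (simp only:) (intro order.trans[OF norm_sum] sum_mono, simp add: norm_mult)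
  moreover have "norm (complex_of_real (\<Sum>m<N. (norm (\<Sum>y\<in>?Y. R y * unit_exp (\<theta> * of_int y * real m)))\<^sup>2)) =
     (\<Sum>m<N. (norm (\<Sum>y\<in>?Y. R y * unit_exp (\<theta> * of_int y * real m)))\<^sup>2)"
    unfolding norm_of_real by (intro abs_of_nonneg sum_nonneg) auto
  ultimately have "(\<Sum>m<N. (norm (\<Sum>y\<in>?Y. R y * unit_exp (\<theta> * of_int y * real m)))\<^sup>2) \<le>
     (\<Sum>y\<in>?Y. \<Sum>y'\<in>?Y. (norm (R y) * norm (R y')) * D (y - y'))" by simp
  also have "\<dots> \<le> (\<Sum>y\<in>?Y. \<Sum>y'\<in>?Y. ((norm (R y))\<^sup>2 / 2 + (norm (R y'))\<^sup>2 / 2) * D (y - y'))"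
  proof (intro sum_mono mult_right_mono)
    fix y y'
    show "norm (R y) * norm (R y') \<le> (norm (R y))\<^sup>2 / 2 + (norm (R y'))\<^sup>2 / 2"
      using sum_squares_bound[of "norm (R y)" "norm (R y')"] by simp
  qed (simp add: D_def)
  also have "\<dots> = (\<Sum>y\<in>?Y. \<Sum>y'\<in>?Y. (norm (R y))\<^sup>2 / 2 * D (y - y')) + (\<Sum>y\<in>?Y. \<Sum>y'\<in>?Y. (norm (R y'))\<^sup>2 / 2 * D (y - y'))"
    by (simp add: distrib_right sum.distrib)
  also have "(\<Sum>y\<in>?Y. \<Sum>y'\<in>?Y. (norm (R y'))\<^sup>2 / 2 * D (y - y')) = (\<Sum>y\<in>?Y. \<Sum>y'\<in>?Y. (norm (R y))\<^sup>2 / 2 * D (y - y'))"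
    by (subst sum.swap, intro sum.cong refl, subst Dsym, rule refl)
  also have "(\<Sum>y\<in>?Y. \<Sum>y'\<in>?Y. (norm (R y))\<^sup>2 / 2 * D (y - y')) + (\<Sum>y\<in>?Y. \<Sum>y'\<in>?Y. (norm (R y))\<^sup>2 / 2 * D (y - y')) =
     (\<Sum>y\<in>?Y. (norm (R y))\<^sup>2 * (\<Sum>y'\<in>?Y. D (y - y')))"
    unfolding sum.distrib[symmetric] sum_distrib_left by (intro sum.cong refl) simp
  also have "\<dots> \<le> (\<Sum>y\<in>?Y. (norm (R y))\<^sup>2 * (\<Sum>u\<in>{- int U..int U}. D u))"
    by (intro sum_mono mult_left_mono Dsum) auto
  also have "\<dots> = (\<Sum>u\<in>{- int U..int U}. D u) * (\<Sum>y\<in>?Y. (norm (R y))\<^sup>2)"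
    by (simp add: sum_distrib_left mult.commute)
  finally show ?thesis unfolding g R_def D_def .
qed


text \<open>Under a shift by m the leading coefficient stays, and the next one moves linearly in m
  with slope proportional to the leading coefficient. It is this dependence on m that the rational
  approximation controls.\<close>

lemma poly_shift_expansion:
  fixes F :: "real poly"
  assumes F: "degree F \<le> Suc k"
  defines "c \<equiv> \<lambda>m. coeff (pcompose F [:m, 1:])"
  shows "poly F (x + m) = (\<Sum>j\<le>Suc k. c m j * x ^ j)"
    and "c m (Suc k) = coeff F (Suc k)" and "c m k = coeff F k + real (Suc k) * m * coeff F (Suc k)"
proof -
  have Fx: "poly F y = (\<Sum>i\<le>Suc k. coeff F i * y ^ i)" for y
    unfolding poly_altdef using F by (intro sum.mono_neutral_left) (auto simp: coeff_eq_0)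
  have "pcompose F [:m, 1:] = (\<Sum>i\<le>Suc k. smult (coeff F i) ([:m, 1:] ^ i))"
    by (subst poly_eq_poly_eq_iff[symmetric]) (simp add: fun_eq_iff poly_pcompose Fx poly_sum distrib_right)
  then have c: "c m j = (\<Sum>i\<le>Suc k. coeff F i * coeff ([:m, 1:] ^ i) j)" for j
    unfolding c_def by (simp add: coeff_sum)
  have lin: "coeff ([:m, 1:] ^ i) j = real (i choose j) * m ^ (i - j)" for i j
    using coeff_linear_poly_power[of j i m 1] by (cases "j \<le> i") (auto simp: binomial_eq_0 coeff_eq_0 degree_linear_power)
  show "c m (Suc k) = coeff F (Suc k)"
    unfolding c lin by (simp add: binomial_eq_0)
  show "c m k = coeff F k + real (Suc k) * m * coeff F (Suc k)"
  proof -
    have "(\<Sum>i\<le>Suc k. coeff F i * (real (i choose k) * m ^ (i - k))) = (\<Sum>i\<in>{k, Suc k}. coeff F i * (real (i choose k) * m ^ (i - k)))"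
      by (intro sum.mono_neutral_right) (auto simp: binomial_eq_0)
    then show ?thesis unfolding c lin by simp
  qed
  have "degree (pcompose F [:m, 1:]) \<le> Suc k" using F by (simp add: degree_pcompose)
  then have "poly (pcompose F [:m, 1:]) x = (\<Sum>j\<le>Suc k. c m j * x ^ j)"
    unfolding poly_altdef c_def by (intro sum.mono_neutral_left) (auto simp: coeff_eq_0)
  then show "poly F (x + m) = (\<Sum>j\<le>Suc k. c m j * x ^ j)" by (simp add: poly_pcompose add.commute)
qed

lemma sum_below_eq_tri: "(\<Sum>j\<in>{1..<k}. j) = tri (k - 1)"
proof (induction k)
  case (Suc k)
  show ?case
  proof (cases k)
    case (Suc k')
    then show ?thesis using Suc.IH tri_add[of k' 1] by (simp add: tri_def)
  qed (simp add: tri_def)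
qed (simp add: tri_def)

text \<open>The s-th power is grouped by the power sums of order below k. Their coefficients vary
  with m in an uncontrolled way, so they are split off as factors of norm 1, at the price of the
  number of groups by Cauchy-Schwarz. Inside a group, m occurs linearly, next to the power sum of
  order k, and \<open>bilinear_mean\<close> applies. The sums over the fibres recombine to the
  weighted mean value of degree k.\<close>

lemma weyl_moment:
  fixes F :: "real poly" and a :: "int \<Rightarrow> complex" and S :: "int set" and N k :: nat
  defines "s \<equiv> tri k"
  defines "H \<equiv> \<lambda>\<tau>. (restrict (\<lambda>j. psum s j \<tau>) {1..<k}, psum s k \<tau>)"
  defines "U \<equiv> 2 * s * N ^ k"
  assumes k: "k \<ge> 1" and N: "N \<ge> 1" and S: "S \<subseteq> {- int N..int N}" and a: "\<And>x. x \<in> S \<Longrightarrow> norm (a x) \<le> 1"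
    and F: "degree F \<le> Suc k"
    and mv: "\<And>w. (\<And>x. x \<in> S \<Longrightarrow> norm (w x :: complex) \<le> 1) \<Longrightarrow>
      (\<Sum>y\<in>H ` tuples s S. (norm (\<Sum>\<tau> | \<tau> \<in> tuples s S \<and> H \<tau> = y. \<Prod>i<s. w (\<tau> i)))\<^sup>2) \<le> M"
  shows "(\<Sum>m<N. norm (\<Sum>x\<in>S. a x * unit_exp (poly F (of_int x + real m))) ^ (2 * s)) \<le>
     (3 * real s) ^ (k - 1) * real N ^ tri (k - 1) *
     (\<Sum>u\<in>{- int U..int U}. norm (\<Sum>m<N. unit_exp (real (Suc k) * coeff F (Suc k) * of_int u * real m))) * M"
proof -
  let ?T = "tuples s S"
  have finS: "finite S" using S by (rule finite_subset) simp
  have finT: "finite ?T" using finS by simp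
  have s: "s \<ge> 1" unfolding s_def using tri_pos[OF k] by simp
  define \<beta> where "\<beta> = coeff F (Suc k)"
  define \<gamma> where "\<gamma> = coeff F k"
  define \<theta> where "\<theta> = real (Suc k) * \<beta>"
  define c where "c m = coeff (pcompose F [:m, 1:])" for m
  \<comment> \<open>The terms of degree k and k + 1 that do not depend on m join the weight. This is
    how a polynomial of degree k + 1 is treated with the mean value of degree k.\<close>
  define w where "w x = a x * unit_exp (\<beta> * of_int x ^ Suc k + \<gamma> * of_int x ^ k)" for x :: int
  define W where "W \<tau> = (\<Prod>i<s. w (\<tau> i))" for \<tau> :: "nat \<Rightarrow> int"
  define K1 where "K1 \<tau> = restrict (\<lambda>j. psum s j \<tau>) {1..<k}" for \<tau>
  define h where "h \<tau> = psum s k \<tau>" for \<tau>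
  define \<Lambda> where "\<Lambda> m y = unit_exp (c m 0 * real s + (\<Sum>j\<in>{1..<k}. c m j * of_int (y j)))" for m and y :: "nat \<Rightarrow> int"
  have psum_bnd: "\<bar>psum s j \<tau>\<bar> \<le> int s * int N ^ j" if "\<tau> \<in> ?T" for j \<tau>
  proof -
    have "\<bar>psum s j \<tau>\<bar> \<le> (\<Sum>i<s. \<bar>\<tau> i ^ j\<bar>)" unfolding psum_def by (rule sum_abs)
    also have "\<dots> \<le> (\<Sum>i<s. int N ^ j)"
    proof (rule sum_mono)
      fix i assume "i \<in> {..<s}"
      then have "\<tau> i \<in> {- int N..int N}" using that S by auto
      then have "\<bar>\<tau> i\<bar> \<le> int N" by auto
      then show "\<bar>\<tau> i ^ j\<bar> \<le> int N ^ j" by (simp add: power_abs power_mono)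
    qed
    finally show ?thesis by simp
  qed
  have expand: "(\<Sum>x\<in>S. a x * unit_exp (poly F (of_int x + m))) ^ s =
      (\<Sum>y\<in>K1 ` ?T. \<Lambda> m y * (\<Sum>\<tau> | \<tau> \<in> ?T \<and> K1 \<tau> = y. W \<tau> * unit_exp (\<theta> * of_int (h \<tau>) * m)))" for m
  proof -
    have split: "{..Suc k} = insert 0 {1..<k} \<union> {k, Suc k}" using k by auto
    have term_eq: "a x * unit_exp (poly F (of_int x + m)) =
        w x * unit_exp (\<theta> * m * of_int x ^ k + (c m 0 + (\<Sum>j\<in>{1..<k}. c m j * of_int x ^ j)))" for x
    proof -
      have "poly F (of_int x + m) = (\<Sum>j\<le>Suc k. c m j * of_int x ^ j)"
        unfolding c_def by (rule poly_shift_expansion(1)[OF F])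
      also have "\<dots> = (c m 0 + (\<Sum>j\<in>{1..<k}. c m j * of_int x ^ j)) + (c m k * of_int x ^ k + c m (Suc k) * of_int x ^ Suc k)"
        unfolding split by (subst sum.union_disjoint) (use k in auto)
      also have "c m (Suc k) = \<beta>" unfolding c_def \<beta>_def by (rule poly_shift_expansion(2)[OF F])
      also have "c m k = \<gamma> + \<theta> * m"
        unfolding c_def \<gamma>_def \<theta>_def \<beta>_def by (subst poly_shift_expansion(3)[OF F]) (simp add: mult_ac)
      finally have "poly F (of_int x + m) = (\<beta> * of_int x ^ Suc k + \<gamma> * of_int x ^ k) +
          (\<theta> * m * of_int x ^ k + (c m 0 + (\<Sum>j\<in>{1..<k}. c m j * of_int x ^ j)))"
        by (simp add: algebra_simps)
      then show ?thesis unfolding w_def by (simp add: unit_exp_add)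
    qed
    have "(\<Sum>x\<in>S. a x * unit_exp (poly F (of_int x + m))) ^ s = (\<Sum>\<tau>\<in>?T. \<Prod>i<s. a (\<tau> i) * unit_exp (poly F (of_int (\<tau> i) + m)))"
      by (rule sum_power_eq_tuples[OF finS])
    also have "\<dots> = (\<Sum>\<tau>\<in>?T. \<Lambda> m (K1 \<tau>) * (W \<tau> * unit_exp (\<theta> * of_int (h \<tau>) * m)))"
    proof (rule sum.cong[OF refl])
      fix \<tau>
      have ps: "(\<Sum>i<s. real_of_int (\<tau> i) ^ j) = of_int (psum s j \<tau>)" for j
        unfolding psum_def by simp
      have "(\<Sum>i<s. \<theta> * m * of_int (\<tau> i) ^ k + (c m 0 + (\<Sum>j\<in>{1..<k}. c m j * of_int (\<tau> i) ^ j))) =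
         \<theta> * m * (\<Sum>i<s. of_int (\<tau> i) ^ k) + (real s * c m 0 + (\<Sum>j\<in>{1..<k}. c m j * (\<Sum>i<s. of_int (\<tau> i) ^ j)))"
        unfolding sum.distrib sum_distrib_left by (subst sum.swap) simp
      also have "\<dots> = (c m 0 * real s + (\<Sum>j\<in>{1..<k}. c m j * of_int (K1 \<tau> j))) + \<theta> * of_int (h \<tau>) * m"
        unfolding ps h_def K1_def by (simp add: algebra_simps)
      finally have "(\<Prod>i<s. unit_exp (\<theta> * m * of_int (\<tau> i) ^ k + (c m 0 + (\<Sum>j\<in>{1..<k}. c m j * of_int (\<tau> i) ^ j)))) =
         \<Lambda> m (K1 \<tau>) * unit_exp (\<theta> * of_int (h \<tau>) * m)"
        unfolding unit_exp_sum[symmetric] \<Lambda>_def unit_exp_add[symmetric] by simp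
      then show "(\<Prod>i<s. a (\<tau> i) * unit_exp (poly F (of_int (\<tau> i) + m))) = \<Lambda> m (K1 \<tau>) * (W \<tau> * unit_exp (\<theta> * of_int (h \<tau>) * m))"
        unfolding term_eq prod.distrib W_def by (simp only: mult_ac)
    qed
    also have "\<dots> = (\<Sum>y\<in>K1 ` ?T. \<Sum>\<tau> | \<tau> \<in> ?T \<and> K1 \<tau> = y. \<Lambda> m (K1 \<tau>) * (W \<tau> * unit_exp (\<theta> * of_int (h \<tau>) * m)))"
      by (rule sum_group_image[OF finT])
    also have "\<dots> = (\<Sum>y\<in>K1 ` ?T. \<Lambda> m y * (\<Sum>\<tau> | \<tau> \<in> ?T \<and> K1 \<tau> = y. W \<tau> * unit_exp (\<theta> * of_int (h \<tau>) * m)))"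
      unfolding sum_distrib_left by (intro sum.cong refl) auto
    finally show ?thesis .
  qed
  have cardK: "real (card (K1 ` ?T)) \<le> (3 * real s) ^ (k - 1) * real N ^ tri (k - 1)"
  proof -
    have "K1 ` ?T \<subseteq> PiE {1..<k} (\<lambda>j. {- int (s * N ^ j)..int (s * N ^ j)})"
      unfolding K1_def using psum_bnd by (auto simp: abs_le_iff minus_le_iff)
    then have "card (K1 ` ?T) \<le> card (PiE {1..<k} (\<lambda>j. {- int (s * N ^ j)..int (s * N ^ j)}))"
      by (intro card_mono finite_PiE) auto
    also have "\<dots> = (\<Prod>j\<in>{1..<k}. nat (2 * int (s * N ^ j) + 1))"
      by (subst card_PiE) (auto intro!: prod.cong)
    also have "\<dots> \<le> (\<Prod>j\<in>{1..<k}. 3 * s * N ^ j)"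
    proof (rule prod_mono)
      fix j
      have "1 * 1 \<le> s * N ^ j" using s N by (intro mult_le_mono) auto
      moreover have "nat (2 * int t + 1) = 2 * t + 1" for t by simp
      ultimately show "0 \<le> nat (2 * int (s * N ^ j) + 1) \<and> nat (2 * int (s * N ^ j) + 1) \<le> 3 * s * N ^ j"
        by (simp del: of_nat_mult of_nat_power)
    qed
    also have "\<dots> = (3 * s) ^ (k - 1) * N ^ tri (k - 1)"
      unfolding prod.distrib power_sum[symmetric] sum_below_eq_tri by simp
    finally have "real (card (K1 ` ?T)) \<le> real ((3 * s) ^ (k - 1) * N ^ tri (k - 1))" by (rule of_nat_le_iff[THEN iffD2])
    then show ?thesis by simp
  qed
  define D where "D = (\<Sum>u\<in>{- int U..int U}. norm (\<Sum>m<N. unit_exp (\<theta> * of_int u * real m)))"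
  have D0: "D \<ge> 0" unfolding D_def by (intro sum_nonneg) auto
  let ?Ty = "\<lambda>y. {\<tau> \<in> ?T. K1 \<tau> = y}"
  let ?V = "\<lambda>y. (\<Sum>z\<in>h ` ?Ty y. (norm (\<Sum>\<tau> | \<tau> \<in> ?Ty y \<and> h \<tau> = z. W \<tau>))\<^sup>2)"
  have "(\<Sum>m<N. norm (\<Sum>x\<in>S. a x * unit_exp (poly F (of_int x + real m))) ^ (2 * s)) \<le>
     (\<Sum>m<N. (\<Sum>y\<in>K1 ` ?T. (norm (\<Sum>\<tau>\<in>?Ty y. W \<tau> * unit_exp (\<theta> * of_int (h \<tau>) * real m)))\<^sup>2) * real (card (K1 ` ?T)))"
  proof (rule sum_mono)
    fix m
    have "norm (\<Sum>x\<in>S. a x * unit_exp (poly F (of_int x + real m))) ^ (2 * s) =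
       (norm ((\<Sum>x\<in>S. a x * unit_exp (poly F (of_int x + real m))) ^ s))\<^sup>2"
      unfolding norm_power by (simp add: power_mult[symmetric] mult.commute)
    also have "\<dots> \<le> (\<Sum>y\<in>K1 ` ?T. norm (\<Sum>\<tau>\<in>?Ty y. W \<tau> * unit_exp (\<theta> * of_int (h \<tau>) * real m)))\<^sup>2"
    proof (rule power_mono)
      show "norm ((\<Sum>x\<in>S. a x * unit_exp (poly F (of_int x + real m))) ^ s) \<le>
         (\<Sum>y\<in>K1 ` ?T. norm (\<Sum>\<tau>\<in>?Ty y. W \<tau> * unit_exp (\<theta> * of_int (h \<tau>) * real m)))"
        unfolding expand by (rule sum_norm_le) (simp add: norm_mult \<Lambda>_def)
    qed simp
    also have "\<dots> \<le> (\<Sum>y\<in>K1 ` ?T. (norm (\<Sum>\<tau>\<in>?Ty y. W \<tau> * unit_exp (\<theta> * of_int (h \<tau>) * real m)))\<^sup>2) * real (card (K1 ` ?T))"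
      by (rule sum_squared_le_sum_of_squares)
    finally show "norm (\<Sum>x\<in>S. a x * unit_exp (poly F (of_int x + real m))) ^ (2 * s) \<le> \<dots>" .
  qed
  also have "\<dots> = real (card (K1 ` ?T)) * (\<Sum>y\<in>K1 ` ?T. \<Sum>m<N. (norm (\<Sum>\<tau>\<in>?Ty y. W \<tau> * unit_exp (\<theta> * of_int (h \<tau>) * real m)))\<^sup>2)"
    unfolding sum_distrib_right[symmetric] by (subst sum.swap) (rule mult.commute)
  also have "\<dots> \<le> real (card (K1 ` ?T)) * (\<Sum>y\<in>K1 ` ?T. D * ?V y)"
  proof (intro mult_left_mono sum_mono)
    fix y
    show "(\<Sum>m<N. (norm (\<Sum>\<tau>\<in>?Ty y. W \<tau> * unit_exp (\<theta> * of_int (h \<tau>) * real m)))\<^sup>2) \<le> D * ?V y"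
      unfolding D_def
    proof (rule bilinear_mean)
      fix \<tau> \<tau>' assume "\<tau> \<in> ?Ty y" "\<tau>' \<in> ?Ty y"
      then have "\<bar>h \<tau>\<bar> \<le> int s * int N ^ k" "\<bar>h \<tau>'\<bar> \<le> int s * int N ^ k" unfolding h_def using psum_bnd by auto
      then show "\<bar>h \<tau> - h \<tau>'\<bar> \<le> int U" unfolding U_def by simp
    qed (use finT in simp)
  qed simp
  also have "\<dots> = real (card (K1 ` ?T)) * (D * (\<Sum>y\<in>K1 ` ?T. ?V y))" by (simp add: sum_distrib_left)
  also have "(\<Sum>y\<in>K1 ` ?T. ?V y) = (\<Sum>y\<in>H ` ?T. (norm (\<Sum>\<tau> | \<tau> \<in> ?T \<and> H \<tau> = y. W \<tau>))\<^sup>2)"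
  proof -
    have H: "H \<tau> = (K1 \<tau>, h \<tau>)" for \<tau> unfolding H_def K1_def h_def ..
    have "H ` ?T = Sigma (K1 ` ?T) (\<lambda>y. h ` ?Ty y)" unfolding H by (auto simp: image_iff) (metis (lifting))
    then have "(\<Sum>y\<in>H ` ?T. (norm (\<Sum>\<tau> | \<tau> \<in> ?T \<and> H \<tau> = y. W \<tau>))\<^sup>2) =
       (\<Sum>(y, z)\<in>Sigma (K1 ` ?T) (\<lambda>y. h ` ?Ty y). (norm (\<Sum>\<tau> | \<tau> \<in> ?T \<and> H \<tau> = (y, z). W \<tau>))\<^sup>2)"
      by (intro sum.cong) auto
    also have "\<dots> = (\<Sum>y\<in>K1 ` ?T. \<Sum>z\<in>h ` ?Ty y. (norm (\<Sum>\<tau> | \<tau> \<in> ?T \<and> H \<tau> = (y, z). W \<tau>))\<^sup>2)"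
      using finT by (subst sum.Sigma) auto
    also have "\<dots> = (\<Sum>y\<in>K1 ` ?T. ?V y)"
      unfolding H by (intro sum.cong refl arg_cong[where f = "\<lambda>z. (norm z)\<^sup>2"]) auto
    finally show ?thesis ..
  qed
  also have "\<dots> \<le> M" unfolding W_def by (rule mv) (use a in \<open>simp add: w_def norm_mult\<close>)
  finally have "(\<Sum>m<N. norm (\<Sum>x\<in>S. a x * unit_exp (poly F (of_int x + real m))) ^ (2 * s)) \<le> real (card (K1 ` ?T)) * (D * M)"
    using D0 by (simp add: mult_left_mono)
  also have "\<dots> \<le> ((3 * real s) ^ (k - 1) * real N ^ tri (k - 1)) * (D * M)"
  proof (intro mult_right_mono cardK mult_nonneg_nonneg D0)
    have "0 \<le> (\<Sum>y\<in>H ` ?T. (norm (\<Sum>\<tau> | \<tau> \<in> ?T \<and> H \<tau> = y. \<Prod>i<s. w (\<tau> i)))\<^sup>2)" by (intro sum_nonneg) auto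
    also have "\<dots> \<le> M" by (rule mv) (use a in \<open>simp add: w_def norm_mult\<close>)
    finally show "0 \<le> M" .
  qed
  finally show ?thesis unfolding D_def \<theta>_def \<beta>_def by (simp add: mult_ac)
qed


section \<open>A Weyl bound of Vinogradov strength\<close>

lemma le_powr_inverse:
  fixes y X :: real
  assumes "y \<ge> 0" "n > 0" "y ^ n \<le> X"
  shows "y \<le> X powr (1 / real n)"
proof (cases "y = 0")
  case False
  then have "y = (y ^ n) powr (1 / real n)"
    using assms by (simp add: powr_realpow[symmetric] powr_powr)
  also have "\<dots> \<le> X powr (1 / real n)" using assms by (intro powr_mono2) auto
  finally show ?thesis .
qed simp

text \<open>The slope found in \<open>weyl_moment\<close> is k + 1 times the coefficient
  approximated by a / q. Instead of approximating that multiple, the frequencies d u are embedded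
  into an interval d times as long.\<close>

lemma dilated_geometric_sum:
  fixes a :: int and q U N d :: nat
  assumes d: "d \<ge> 1" and q: "q \<ge> 1" and cop: "coprime a (int q)" and \<beta>: "\<bar>\<beta> - of_int a / real q\<bar> \<le> 1 / (real q)\<^sup>2"
  shows "(\<Sum>u\<in>{- int U..int U}. norm (\<Sum>m<N. unit_exp (real d * \<beta> * of_int u * real m)))
     \<le> (2 * real d * real U / real q + 1) * (4 * real N + 2 * real q * (1 + ln (real q)))"
proof -
  let ?f = "\<lambda>u. norm (\<Sum>m<N. unit_exp (\<beta> * of_int u * real m))"
  have inj: "inj_on (\<lambda>u. int d * u) {- int U..int U}" using d by (auto simp: inj_on_def)
  have "(\<Sum>u\<in>{- int U..int U}. norm (\<Sum>m<N. unit_exp (real d * \<beta> * of_int u * real m))) = (\<Sum>u\<in>{- int U..int U}. ?f (int d * u))"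
    by (simp add: mult_ac)
  also have "\<dots> = (\<Sum>u\<in>(\<lambda>u. int d * u) ` {- int U..int U}. ?f u)" by (subst sum.reindex[OF inj]) simp
  also have "\<dots> \<le> (\<Sum>u\<in>{- int (d * U)..int (d * U)}. ?f u)"
  proof (rule sum_mono2)
    show "(\<lambda>u. int d * u) ` {- int U..int U} \<subseteq> {- int (d * U)..int (d * U)}"
    proof
      fix v assume "v \<in> (\<lambda>u. int d * u) ` {- int U..int U}"
      then obtain u where u: "v = int d * u" "u \<in> {- int U..int U}" by (rule imageE)
      then have "int d * (- int U) \<le> int d * u" "int d * u \<le> int d * int U" by (intro mult_left_mono; simp)+
      then show "v \<in> {- int (d * U)..int (d * U)}" using u(1) by simp
    qed
  qed auto
  also have "\<dots> \<le> (2 * real (d * U) / real q + 1) * (4 * real N + 2 * real q * (1 + ln (real q)))"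
    by (rule geometric_sum_total[OF q cop \<beta>])
  finally show ?thesis by (simp add: mult.assoc)
qed

text \<open>Each of the N shifts m represents the same sum after a completion whose weights have
  total mass of order log N. Averaging over m and Hoelder's inequality lead to the moments: as tri
  (k - 1) + (k + 1) + s = 2 s + 1, where s is tri k, the moments of order 2 s over all shifts add up
  to N ^ (2 s + 1) times the bracket, up to small powers. The root of order 2 s gives the
  saving.\<close>

lemma weyl_bound:
  assumes k: "k \<ge> 1" and \<epsilon>: "\<epsilon> > 0"
  shows "\<exists>A\<ge>1. \<forall>(N::nat) (F::real poly) (a::int) (q::nat). N \<ge> 1 \<longrightarrow> degree F \<le> Suc k \<longrightarrow> q \<ge> 1 \<longrightarrow> coprime a (int q) \<longrightarrow>
     \<bar>coeff F (Suc k) - of_int a / real q\<bar> \<le> 1 / (real q)\<^sup>2 \<longrightarrow>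
     norm (\<Sum>n<N. unit_exp (poly F (real n))) \<le>
       A * real N powr (1 + \<epsilon>) * (1 / real q + 1 / real N + real q / real N ^ Suc k) powr (1 / real (2 * tri k))"
proof -
  define s where "s = tri k"
  have s: "s \<ge> 1" unfolding s_def using tri_pos[OF k] by simp
  \<comment> \<open>The logarithm of q and the mean value lose n ^ \<delta> each, but under a root
    of order 2 s \<ge> 2, so at most n ^ \<delta> together; the completion loses n ^ \<delta>
    again.\<close>
  define \<delta> where "\<delta> = \<epsilon> / 2"
  have \<delta>: "\<delta> > 0" unfolding \<delta>_def using \<epsilon> by simp
  let ?H = "\<lambda>\<tau>. (restrict (\<lambda>j. psum s j \<tau>) {1..<k}, psum s k \<tau>)"
  obtain C where C: "C \<ge> 1" and mv: "\<And>(N::nat) S (w :: int \<Rightarrow> complex) (H :: (nat \<Rightarrow> int) \<Rightarrow> (nat \<Rightarrow> int) \<times> int).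
     N \<ge> 1 \<Longrightarrow> S \<subseteq> {- int N..int N} \<Longrightarrow> (\<forall>x\<in>S. norm (w x) \<le> 1) \<Longrightarrow>
     (\<forall>\<tau>\<in>tuples s S. \<forall>\<tau>'\<in>tuples s S. H \<tau> = H \<tau>' \<longleftrightarrow> (\<forall>j\<in>{1..k}. psum s j \<tau> = psum s j \<tau>')) \<Longrightarrow>
     (\<Sum>y\<in>H ` tuples s S. (norm (\<Sum>\<tau> | \<tau> \<in> tuples s S \<and> H \<tau> = y. \<Prod>i<s. w (\<tau> i)))\<^sup>2)
       \<le> C * real N powr \<delta> * real (card S) ^ s"
    using mean_value[OF k \<delta>, where 'b = "(nat \<Rightarrow> int) \<times> int"] unfolding s_def by blast
  have Hk: "?H \<tau> = ?H \<tau>' \<longleftrightarrow> (\<forall>j\<in>{1..k}. psum s j \<tau> = psum s j \<tau>')" for \<tau> \<tau>'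
  proof
    assume e: "?H \<tau> = ?H \<tau>'"
    show "\<forall>j\<in>{1..k}. psum s j \<tau> = psum s j \<tau>'"
    proof
      fix j assume j: "j \<in> {1..k}"
      have "restrict (\<lambda>j. psum s j \<tau>) {1..<k} j = restrict (\<lambda>j. psum s j \<tau>') {1..<k} j" using e by simp
      then show "psum s j \<tau> = psum s j \<tau>'" using e j by (cases "j = k") auto
    qed
  next
    assume "\<forall>j\<in>{1..k}. psum s j \<tau> = psum s j \<tau>'"
    then show "?H \<tau> = ?H \<tau>'" using k by (auto simp: restrict_def fun_eq_iff)
  qed
  define c1 where "c1 = 1 + real (Suc k) / \<delta>"
  define c2 where "c2 = 32 * real (Suc k) * real s"
  define c3 where "c3 = (3 * real s) ^ (k - 1) * c2 * c1 * C * 3 ^ s"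
  define c4 where "c4 = 8 + 2 / \<delta>"
  have c1: "c1 \<ge> 1" unfolding c1_def using \<delta> by simp
  have c2: "c2 \<ge> 0" unfolding c2_def by simp
  have c3: "c3 \<ge> 0" unfolding c3_def using c1 c2 C by simp
  have c4: "c4 \<ge> 0" unfolding c4_def using \<delta> by simp
  define A where "A = 1 + c4 * c3 powr (1 / real (2 * s))"
  have A1: "A \<ge> 1" unfolding A_def using c4 by simp
  show ?thesis
  proof (intro exI[of _ A] conjI A1 allI impI)
    fix N :: nat and F :: "real poly" and a :: int and q :: nat
    assume N: "N \<ge> 1" and F: "degree F \<le> Suc k" and q: "q \<ge> 1" and cop: "coprime a (int q)"
      and \<beta>: "\<bar>coeff F (Suc k) - of_int a / real q\<bar> \<le> 1 / (real q)\<^sup>2"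
    define E where "E = 1 / real q + 1 / real N + real q / real N ^ Suc k"
    define n where "n = real N"
    have n1: "n \<ge> 1" unfolding n_def using N by simp
    have E0: "E > 0" unfolding E_def using N q by (intro add_pos_pos divide_pos_pos) auto
    let ?Sm = "\<Sum>m<N. unit_exp (poly F (real m))"
    show "norm ?Sm \<le> A * real N powr (1 + \<epsilon>) * (1 / real q + 1 / real N + real q / real N ^ Suc k) powr (1 / real (2 * tri k))"
      unfolding E_def[symmetric] unfolding n_def[symmetric] s_def[symmetric]
    \<comment> \<open>For q beyond N ^ (k + 1) the bracket is at least 1 and the trivial bound is
      enough; otherwise log q is at most a multiple of log N.\<close>
    proof (cases "N ^ Suc k < q")
      case True
      then have "real (N ^ Suc k) < real q" by (rule of_nat_less_iff[THEN iffD2])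
      then have "1 \<le> real q / real N ^ Suc k" using N by (simp add: pos_le_divide_eq)
      then have "1 \<le> E" unfolding E_def using N q by (simp add: add_increasing)
      then have "1 \<le> E powr (1 / real (2 * s))" by (intro ge_one_powr_ge_zero) auto
      moreover have "norm ?Sm \<le> n"
        using norm_sum[of "\<lambda>m. unit_exp (poly F (real m))" "{..<N}"] unfolding n_def by simp
      moreover have "n powr 1 \<le> n powr (1 + \<epsilon>)" using n1 \<epsilon> by (intro powr_mono) auto
      ultimately have "norm ?Sm \<le> n powr (1 + \<epsilon>)" using n1 by simp
      also have "\<dots> \<le> A * n powr (1 + \<epsilon>)" using A1 by (simp add: mult_le_cancel_right1)
      also have "\<dots> = A * n powr (1 + \<epsilon>) * 1" by simp
      also have "\<dots> \<le> A * n powr (1 + \<epsilon>) * E powr (1 / real (2 * s))"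
        using A1 \<open>1 \<le> E powr _\<close> by (intro mult_left_mono) auto
      finally show "norm ?Sm \<le> A * n powr (1 + \<epsilon>) * E powr (1 / real (2 * s))" .
    next
      case False
      have lnN: "ln n \<le> n powr \<delta> / \<delta>" using n1 \<delta> by (rule ln_powr_bound)
      have nd: "1 \<le> n powr \<delta>" using n1 \<delta> by (intro ge_one_powr_ge_zero) auto
      have Lq: "1 + ln (real q) \<le> c1 * n powr \<delta>"
      proof -
        have "real q \<le> real (N ^ Suc k)" using False by (intro of_nat_mono) simp
        then have "ln (real q) \<le> ln (n ^ Suc k)" using q N unfolding n_def by (subst ln_le_cancel_iff) auto
        also have "\<dots> = real (Suc k) * ln n" using n1 by (subst ln_realpow) auto
        also have "\<dots> \<le> real (Suc k) * (n powr \<delta> / \<delta>)" using lnN by (intro mult_left_mono) auto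
        finally show ?thesis unfolding c1_def using nd by (simp add: algebra_simps)
      qed
      define P where "P = 2 * N + 1"
      define \<kappa> where "\<kappa> h = norm (\<Sum>i<N. unit_exp (real h / real P * real i)) / real P" for h
      define g where "g h m = norm (\<Sum>x\<in>{- int N..int N}. unit_exp (real h / real P * of_int x) * unit_exp (poly F (of_int x + real m)))" for h m
      have \<kappa>0: "\<kappa> h \<ge> 0" for h unfolding \<kappa>_def by simp
      have sum\<kappa>: "(\<Sum>h<P. \<kappa> h) \<le> c4 * n powr \<delta>"
      proof -
        have P: "real P > 0" "P \<ge> 1" unfolding P_def by auto
        \<comment> \<open>The frequencies h / P form one complete block with a = 1 and q =
          P.\<close>
        have "(\<Sum>h<P. norm (\<Sum>i<N. unit_exp ((1 / real P * real h + 0) * real i))) \<le> 4 * real N + 2 * real P * (1 + ln (real P))"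
          by (rule geometric_block[of P 1]) (use P in auto)
        then have "(\<Sum>h<P. norm (\<Sum>i<N. unit_exp (real h / real P * real i))) / real P \<le> (4 * real N + 2 * real P * (1 + ln (real P))) / real P"
          using P by (intro divide_right_mono) auto
        also have "\<dots> = 4 * real N / real P + 2 * (1 + ln (real P))" using P by (simp add: add_divide_distrib)
        also have "4 * real N / real P \<le> 2" unfolding P_def by (simp add: pos_divide_le_eq)
        also have "ln (real P) \<le> 2 + ln n"
        proof -
          have "ln (real P) \<le> ln (3 * n)" unfolding P_def n_def using N by (subst ln_le_cancel_iff) auto
          also have "\<dots> = ln 3 + ln n" using n1 by (subst ln_mult) auto
          also have "ln (3::real) \<le> 2" using ln_le_minus_one[of "3::real"] by simp
          finally show ?thesis by simp
        qed
        finally have "(\<Sum>h<P. \<kappa> h) \<le> 8 + 2 * ln n" unfolding \<kappa>_def by (simp add: sum_divide_distrib)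
        also have "\<dots> \<le> 8 * n powr \<delta> + 2 * (n powr \<delta> / \<delta>)" using lnN nd by linarith
        also have "\<dots> = c4 * n powr \<delta>" unfolding c4_def by (simp add: distrib_right)
        finally show ?thesis .
      qed
      have each: "norm ?Sm \<le> (\<Sum>h<P. \<kappa> h * g h m)" if m: "m < N" for m
      proof -
        have "?Sm = (\<Sum>x\<in>{- int m..<int N - int m}. unit_exp (poly F (of_int x + real m)))"
          by (rule sum.reindex_bij_witness[of _ "\<lambda>x. nat (x + int m)" "\<lambda>i. int i - int m"]) auto
        also have "norm \<dots> \<le> (\<Sum>h<P. \<kappa> h * norm (\<Sum>x\<in>{- int N..int N}. unit_exp (poly F (of_int x + real m)) * unit_exp (real h / real P * of_int x)))"
          using completion[OF m, of "\<lambda>x. unit_exp (poly F (of_int x + real m))"] unfolding \<kappa>_def P_def .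
        finally show ?thesis unfolding g_def by (simp add: mult.commute)
      qed
      define \<Theta> where "\<Theta> = c3 * E * n powr (2 * real s + 1 + 2 * \<delta>)"
      have moment: "(\<Sum>m<N. g h m ^ (2 * s)) \<le> \<Theta>" for h
      proof -
        let ?U = "2 * s * N ^ k"
        let ?M = "C * n powr \<delta> * real (card {- int N..int N}) ^ s"
        let ?D = "\<Sum>u\<in>{- int ?U..int ?U}. norm (\<Sum>m<N. unit_exp (real (Suc k) * coeff F (Suc k) * of_int u * real m))"
        have "(\<Sum>m<N. g h m ^ (2 * s)) \<le> (3 * real s) ^ (k - 1) * real N ^ tri (k - 1) * ?D * ?M"
          unfolding g_def s_def
        proof (rule weyl_moment[OF k N _ _ F])
          fix w :: "int \<Rightarrow> complex" assume w: "\<And>x. x \<in> {- int N..int N} \<Longrightarrow> norm (w x) \<le> 1"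
          have "(\<Sum>y\<in>?H ` tuples s {- int N..int N}. (norm (\<Sum>\<tau> | \<tau> \<in> tuples s {- int N..int N} \<and> ?H \<tau> = y. \<Prod>i<s. w (\<tau> i)))\<^sup>2) \<le> ?M"
            unfolding n_def by (rule mv[OF N]) (use w Hk in auto)
          then show "(\<Sum>y\<in>(\<lambda>\<tau>. (restrict (\<lambda>j. psum (tri k) j \<tau>) {1..<k}, psum (tri k) k \<tau>)) ` tuples (tri k) {- int N..int N}.
              (norm (\<Sum>\<tau> | \<tau> \<in> tuples (tri k) {- int N..int N} \<and> (restrict (\<lambda>j. psum (tri k) j \<tau>) {1..<k}, psum (tri k) k \<tau>) = y. \<Prod>i<tri k. w (\<tau> i)))\<^sup>2)
            \<le> C * n powr \<delta> * real (card {- int N..int N}) ^ tri k" unfolding s_def .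
        qed auto
        also have "\<dots> \<le> (3 * real s) ^ (k - 1) * real N ^ tri (k - 1) * (c2 * (n ^ Suc k * E) * (c1 * n powr \<delta>)) * (C * n powr \<delta> * (3 ^ s * n ^ s))"
        proof (intro mult_mono mult_left_mono)
          have "?D \<le> (2 * real (Suc k) * real ?U / real q + 1) * (4 * real N + 2 * real q * (1 + ln (real q)))"
            by (rule dilated_geometric_sum[OF _ q cop \<beta>]) simp
          also have "\<dots> \<le> (4 * real (Suc k) * real s * (n ^ k / real q + 1)) * (4 * (n + real q) * (1 + ln (real q)))"
          proof (intro mult_mono)
            have "1 * 1 \<le> 4 * real (Suc k) * real s" using s by (intro mult_mono) auto
            moreover have "2 * real (Suc k) * real ?U / real q = 4 * real (Suc k) * real s * (n ^ k / real q)"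
              unfolding n_def by simp
            ultimately show "2 * real (Suc k) * real ?U / real q + 1 \<le> 4 * real (Suc k) * real s * (n ^ k / real q + 1)"
              unfolding distrib_left[of "4 * real (Suc k) * real s"] by linarith
            have l0: "ln (real q) \<ge> 0" using q by simp
            have "4 * n * 1 \<le> 4 * n * (1 + ln (real q))" using l0 n1 by (intro mult_left_mono) auto
            moreover have "2 * real q * (1 + ln (real q)) \<le> 4 * real q * (1 + ln (real q))" using l0 by (intro mult_right_mono) auto
            ultimately show "4 * real N + 2 * real q * (1 + ln (real q)) \<le> 4 * (n + real q) * (1 + ln (real q))"
              unfolding n_def by (simp add: algebra_simps)
            show "0 \<le> 4 * real N + 2 * real q * (1 + ln (real q))" using l0 by simp
          qed (use n1 in simp)
          also have "\<dots> = 16 * real (Suc k) * real s * ((n ^ k / real q + 1) * (n + real q)) * (1 + ln (real q))"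
          proof -
            have "(4 * K * Z * X) * (4 * Y * L) = 16 * K * Z * (X * Y) * L" for K Z X Y L :: real by simp
            then show ?thesis .
          qed
          also have "\<dots> \<le> 16 * real (Suc k) * real s * (2 * (n ^ Suc k * E)) * (c1 * n powr \<delta>)"
          proof (rule mult_mono[OF mult_left_mono Lq])
            have "n ^ Suc k * E = n ^ Suc k / real q + n ^ k + real q"
              unfolding E_def n_def using N q by (simp add: distrib_left)
            moreover have "(n ^ k / real q + 1) * (n + real q) = n ^ Suc k / real q + n ^ k + n + real q"
              using q by (simp add: algebra_simps add_divide_distrib)
            moreover have "n \<le> n ^ k" using n1 k by (intro self_le_power) auto
            moreover have "0 \<le> n ^ Suc k / real q" using n1 by simp
            ultimately show "(n ^ k / real q + 1) * (n + real q) \<le> 2 * (n ^ Suc k * E)" by simp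
          qed (use n1 E0 q in auto)
          also have "\<dots> = c2 * (n ^ Suc k * E) * (c1 * n powr \<delta>)" unfolding c2_def by simp
          finally show "?D \<le> c2 * (n ^ Suc k * E) * (c1 * n powr \<delta>)" .
          have "real (card {- int N..int N}) \<le> 3 * n" unfolding n_def using N by simp
          then have "real (card {- int N..int N}) ^ s \<le> (3 * n) ^ s" by (intro power_mono) auto
          then show "real (card {- int N..int N}) ^ s \<le> 3 ^ s * n ^ s" by (simp add: power_mult_distrib)
        qed (use C c1 c2 n1 E0 in \<open>auto intro!: sum_nonneg mult_nonneg_nonneg\<close>)
        also have "\<dots> = c3 * E * (n ^ tri (k - 1) * n ^ Suc k * n ^ s * (n powr \<delta> * n powr \<delta>))"
          unfolding c3_def n_def by (simp only: mult_ac)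
        also have "n ^ tri (k - 1) * n ^ Suc k * n ^ s = n powr (2 * real s + 1)"
        proof -
          have "tri k = tri (k - 1) + k" using tri_add[of "k - 1" 1] k by (simp add: tri_def)
          then have "tri (k - 1) + Suc k + s = 2 * s + 1" unfolding s_def by simp
          then have "n ^ tri (k - 1) * n ^ Suc k * n ^ s = n ^ (2 * s + 1)" by (metis power_add)
          also have "\<dots> = n powr real (2 * s + 1)" using n1 by (subst powr_realpow) auto
          finally show ?thesis by (simp add: add.commute)
        qed
        also have "n powr (2 * real s + 1) * (n powr \<delta> * n powr \<delta>) = n powr (2 * real s + 1 + 2 * \<delta>)"
          by (simp add: powr_add[symmetric])
        finally show ?thesis unfolding \<Theta>_def .
      qed
      define \<Gamma> where "\<Gamma> = c3 powr (1 / real (2 * s)) * E powr (1 / real (2 * s)) * n powr (2 + \<delta>)"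
      have gsum: "(\<Sum>m<N. g h m) \<le> \<Gamma>" for h
      proof -
        have g0: "g h m \<ge> 0" for m unfolding g_def by simp
        have "(\<Sum>m<N. g h m) ^ (1 + (2 * s - 1)) \<le> (\<Sum>m<N. g h m ^ (2 * s)) ^ 1 * (\<Sum>m<N. 1) ^ (2 * s - 1)"
          by (rule holder_sum) (use s g0 in auto)
        also have "\<dots> \<le> \<Theta> * n ^ (2 * s - 1)"
          using moment[of h] n1 unfolding n_def by (simp add: mult_right_mono)
        also have "\<dots> = c3 * E * (n powr (2 * real s + 1 + 2 * \<delta>) * n powr (2 * real s - 1))"
        proof -
          have "n ^ (2 * s - 1) = n powr real (2 * s - 1)" using n1 by (subst powr_realpow) auto
          also have "real (2 * s - 1) = 2 * real s - 1" using s by (simp add: of_nat_diff)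
          finally show ?thesis unfolding \<Theta>_def by simp
        qed
        also have "\<dots> = c3 * E * n powr (4 * real s + 2 * \<delta>)" by (simp add: powr_add[symmetric])
        finally have "(\<Sum>m<N. g h m) ^ (2 * s) \<le> c3 * E * n powr (4 * real s + 2 * \<delta>)" using s by simp
        then have "(\<Sum>m<N. g h m) \<le> (c3 * E * n powr (4 * real s + 2 * \<delta>)) powr (1 / real (2 * s))"
          using s g0 by (intro le_powr_inverse sum_nonneg) auto
        also have "\<dots> = c3 powr (1 / real (2 * s)) * E powr (1 / real (2 * s)) * n powr ((4 * real s + 2 * \<delta>) * (1 / real (2 * s)))"
          using c3 E0 by (simp add: powr_mult powr_powr)
        also have "\<dots> \<le> \<Gamma>" unfolding \<Gamma>_def
        proof (intro mult_left_mono powr_mono n1)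
          have "2 * \<delta> \<le> \<delta> * real (2 * s)" using \<delta> s by simp
          then have "4 * real s + 2 * \<delta> \<le> (2 + \<delta>) * real (2 * s)" by (simp add: algebra_simps)
          then show "(4 * real s + 2 * \<delta>) * (1 / real (2 * s)) \<le> 2 + \<delta>" using s by (simp add: pos_divide_le_eq)
        qed auto
        finally show ?thesis .
      qed
      have \<Gamma>0: "\<Gamma> \<ge> 0" unfolding \<Gamma>_def by simp
      have "n * norm ?Sm = (\<Sum>m<N. norm ?Sm)" unfolding n_def by simp
      also have "\<dots> \<le> (\<Sum>m<N. \<Sum>h<P. \<kappa> h * g h m)" by (intro sum_mono each) simp
      also have "\<dots> = (\<Sum>h<P. \<kappa> h * (\<Sum>m<N. g h m))" by (subst sum.swap) (simp add: sum_distrib_left)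
      also have "\<dots> \<le> (\<Sum>h<P. \<kappa> h * \<Gamma>)" by (intro sum_mono mult_left_mono gsum \<kappa>0)
      also have "\<dots> = (\<Sum>h<P. \<kappa> h) * \<Gamma>" by (simp add: sum_distrib_right)
      also have "\<dots> \<le> c4 * n powr \<delta> * \<Gamma>" using sum\<kappa> \<Gamma>0 by (rule mult_right_mono)
      also have "\<dots> = n * (c4 * c3 powr (1 / real (2 * s)) * n powr (1 + \<epsilon>) * E powr (1 / real (2 * s)))"
      proof -
        have "n powr \<delta> * n powr (2 + \<delta>) = n powr (1 + (1 + \<epsilon>))"
          unfolding powr_add[symmetric] \<delta>_def by (simp add: add.commute)
        also have "\<dots> = n * n powr (1 + \<epsilon>)" using n1 by (subst powr_add) simp
        finally show ?thesis unfolding \<Gamma>_def by (simp add: mult_ac)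
      qed
      finally have "norm ?Sm \<le> c4 * c3 powr (1 / real (2 * s)) * n powr (1 + \<epsilon>) * E powr (1 / real (2 * s))" using n1 by simp
      also have "\<dots> \<le> A * n powr (1 + \<epsilon>) * E powr (1 / real (2 * s))"
        unfolding A_def by (intro mult_right_mono) auto
      finally show "norm ?Sm \<le> A * n powr (1 + \<epsilon>) * E powr (1 / real (2 * s))" .
    qed
  qed
qed


section \<open>The Thue--Morse weights\<close>

lemma thue_morse_even: "thue_morse (2 * m) = thue_morse m"
  unfolding thue_morse_def by (cases "m = 0") (simp_all add: binary_digit_sum.simps[of "2 * m"])

lemma thue_morse_odd: "thue_morse (2 * m + 1) = - thue_morse m"
proof -
  have "binary_digit_sum (2 * m + 1) = 1 + binary_digit_sum m" by (subst binary_digit_sum.simps) simp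
  then show ?thesis unfolding thue_morse_def by simp
qed

lemma thue_morse_square: "thue_morse m * thue_morse m = 1"
  unfolding thue_morse_def by (simp flip: power_mult_distrib)

definition tm_sum :: "real poly \<Rightarrow> nat \<Rightarrow> complex" where
  "tm_sum F r = (\<Sum>n<2 ^ r. of_int (thue_morse n * thue_morse (n + 1)) * unit_exp (poly F (real n)))"

text \<open>The valuation of n + 1 is peeled off one bit at a time: at n = 2 m the product of signs
  is -1, and at n = 2 m + 1 it is minus the product at m, which leads back to the same kind of sum
  for F(2 x + 1).\<close>

lemma tm_sum_Suc:
  "tm_sum F (Suc r) = - (\<Sum>m<2 ^ r. unit_exp (poly (pcompose F [:0, 2:]) (real m))) - tm_sum (pcompose F [:1, 2:]) r"
proof -
  let ?t = "\<lambda>n. of_int (thue_morse n * thue_morse (n + 1)) * unit_exp (poly F (real n))"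
  have "tm_sum F (Suc r) = (\<Sum>n<2 ^ r * 2. ?t n)" unfolding tm_sum_def by (simp add: mult.commute)
  also have "\<dots> = (\<Sum>m<2 ^ r. \<Sum>j<2. ?t (j + m * 2))" by (rule sum_mult_product)
  also have "\<dots> = (\<Sum>m<2 ^ r. ?t (2 * m) + ?t (2 * m + 1))" by (simp add: numeral_2_eq_2 mult.commute)
  also have "\<dots> = (\<Sum>m<2 ^ r. - unit_exp (poly (pcompose F [:0, 2:]) (real m)) -
      of_int (thue_morse m * thue_morse (m + 1)) * unit_exp (poly (pcompose F [:1, 2:]) (real m)))"
  proof (rule sum.cong[OF refl])
    fix m
    have "thue_morse (2 * m) * thue_morse (2 * m + 1) = - 1"
      unfolding thue_morse_odd thue_morse_even using thue_morse_square[of m] by simp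
    moreover have "thue_morse (2 * m + 1) * thue_morse (2 * m + 1 + 1) = - (thue_morse m * thue_morse (m + 1))"
      using thue_morse_even[of "m + 1"] unfolding thue_morse_odd by simp
    ultimately show "?t (2 * m) + ?t (2 * m + 1) = - unit_exp (poly (pcompose F [:0, 2:]) (real m)) -
      of_int (thue_morse m * thue_morse (m + 1)) * unit_exp (poly (pcompose F [:1, 2:]) (real m))"
      by (simp only:) (simp add: poly_pcompose algebra_simps)
  qed
  also have "\<dots> = - (\<Sum>m<2 ^ r. unit_exp (poly (pcompose F [:0, 2:]) (real m))) - tm_sum (pcompose F [:1, 2:]) r"
    unfolding tm_sum_def sum_subtractf sum_negf ..
  finally show ?thesis .
qed

lemma coeff_pcompose_affine:
  fixes F :: "real poly"
  assumes "degree F \<le> d"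
  shows "coeff (pcompose F [:c, 2:]) d = coeff F d * 2 ^ d"
proof (cases "degree F = d")
  case True
  have "degree (pcompose F [:c, 2:]) = d" using True by (simp add: degree_pcompose)
  moreover have "lead_coeff (pcompose F [:c, 2:]) = lead_coeff F * 2 ^ degree F" by (subst lead_coeff_comp) auto
  ultimately show ?thesis using True by simp
next
  case False
  then have "degree F < d" using assms by simp
  moreover have "degree (pcompose F [:c, 2:]) < d" using False assms by (simp add: degree_pcompose)
  ultimately show ?thesis by (simp add: coeff_eq_0)
qed

text \<open>The polynomials on the progressions are recorded by degree and leading coefficient
  alone, because the Weyl bound depends on nothing else of them; each substitution multiplies that
  coefficient by 2 ^ d. The summand 1 is the single term left when r has been used up.\<close>

lemma tm_sum_bound:
  assumes "degree F \<le> d"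
    and "\<And>i F'. i < r \<Longrightarrow> degree F' \<le> d \<Longrightarrow> coeff F' d = coeff F d * (2 ^ d) ^ (i + 1) \<Longrightarrow>
      norm (\<Sum>m<2 ^ (r - 1 - i). unit_exp (poly F' (real m))) \<le> b i"
  shows "norm (tm_sum F r) \<le> 1 + (\<Sum>i<r. b i)"
  using assms
proof (induction r arbitrary: F b)
  case 0
  have "thue_morse 0 = 1" by (simp add: thue_morse_def binary_digit_sum.simps)
  moreover from this have "thue_morse (Suc 0) = - 1" using thue_morse_odd[of 0] by simp
  ultimately show ?case unfolding tm_sum_def by simp
next
  case (Suc r)
  have 1: "norm (\<Sum>m<2 ^ r. unit_exp (poly (pcompose F [:0, 2:]) (real m))) \<le> b 0"
    using Suc.prems(2)[of 0 "pcompose F [:0, 2:]"] Suc.prems(1) by (simp add: degree_pcompose coeff_pcompose_affine)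
  have 2: "norm (tm_sum (pcompose F [:1, 2:]) r) \<le> 1 + (\<Sum>i<r. b (Suc i))"
  proof (rule Suc.IH)
    show "degree (pcompose F [:1, 2:]) \<le> d" using Suc.prems(1) by (simp add: degree_pcompose)
    fix i F' assume i: "i < r" and F': "degree F' \<le> d" "coeff F' d = coeff (pcompose F [:1, 2:]) d * (2 ^ d) ^ (i + 1)"
    have "coeff F' d = coeff F d * (2 ^ d) ^ (Suc i + 1)"
      using F'(2) Suc.prems(1) by (simp add: coeff_pcompose_affine mult_ac)
    then show "norm (\<Sum>m<2 ^ (r - 1 - i). unit_exp (poly F' (real m))) \<le> b (Suc i)"
      using Suc.prems(2)[of "Suc i" F'] i F'(1) by simp
  qed
  have "norm (tm_sum F (Suc r)) \<le> norm (\<Sum>m<2 ^ r. unit_exp (poly (pcompose F [:0, 2:]) (real m))) + norm (tm_sum (pcompose F [:1, 2:]) r)"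
    unfolding tm_sum_Suc by (rule order.trans[OF norm_triangle_ineq4]) simp
  then show ?case using 1 2 unfolding sum.lessThan_Suc_shift by linarith
qed

section \<open>Diophantine approximation along the progressions\<close>

text \<open>Either the fractions \<open>a / q\<close> and \<open>a' / (C q')\<close> coincide or they repel each other.\<close>
lemma denominator_bound:
  fixes a q a' q' :: int and \<alpha> :: real and C Q :: nat
  assumes q: "q \<ge> 1" and cop: "coprime a q" and \<alpha>: "\<bar>\<alpha> - of_int a / of_int q\<bar> < 1 / (of_int q)\<^sup>2"
    and q': "q' \<ge> 1" and C: "C \<ge> 1" and Q: "2 * of_int q \<le> real Q"
    and \<alpha>': "\<bar>real C * \<alpha> - of_int a' / of_int q'\<bar> \<le> 1 / (of_int q' * real Q)"
  shows "1 / of_int q' \<le> 2 * real C / of_int q"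
proof (cases "int C * q' * a = a' * q")
  case True
  then have "q dvd (int C * q') * a" by simp
  then have "q dvd int C * q'" using cop by (simp add: coprime_commute coprime_dvd_mult_left_iff)
  then have "q \<le> int C * q'" using C q' by (intro zdvd_imp_le) auto
  then have "real_of_int q \<le> real C * of_int q'" by (metis of_int_le_iff of_int_mult of_int_of_nat_eq)
  moreover have "0 \<le> real C * of_int q'" using q' by simp
  ultimately show ?thesis using q q' by (simp add: field_simps)
next
  case False
  have pos: "real_of_int q > 0" "real_of_int q' > 0" "real C > 0" using q q' C by auto
  have Q0: "real Q > 0" using Q pos by linarith
  \<comment> \<open>A nonzero integer, to be written as a difference of two approximation errors.
    The condition 2 q \<le> Q keeps the first at most 1/2, so the bound C q' / q for the second is
    at least 1/2.\<close>
  have "1 \<le> \<bar>int C * q' * a - a' * q\<bar>" using False by simp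
  then have "1 \<le> \<bar>real_of_int (int C * q' * a - a' * q)\<bar>" by (metis of_int_1 of_int_abs of_int_le_iff)
  then have "1 \<le> \<bar>real C * of_int q' * of_int a - of_int a' * of_int q\<bar>" by simp
  also have "real C * of_int q' * of_int a - of_int a' * of_int q =
      (real C * \<alpha> - of_int a' / of_int q') * (of_int q * of_int q') - (\<alpha> - of_int a / of_int q) * (real C * of_int q' * of_int q)"
    using pos by (simp add: field_simps)
  also have "\<bar>\<dots>\<bar> \<le> \<bar>(real C * \<alpha> - of_int a' / of_int q') * (of_int q * of_int q')\<bar> + \<bar>(\<alpha> - of_int a / of_int q) * (real C * of_int q' * of_int q)\<bar>"
    by (rule abs_triangle_ineq4)
  also have "\<dots> \<le> 1 / (of_int q' * real Q) * (of_int q * of_int q') + 1 / (of_int q)\<^sup>2 * (real C * of_int q' * of_int q)"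
    unfolding abs_mult using \<alpha> \<alpha>' pos by (intro add_mono mult_mono) auto
  also have "\<dots> = of_int q / real Q + real C * of_int q' / of_int q"
    using pos Q0 by (simp add: power2_eq_square)
  also have "of_int q / real Q \<le> 1 / 2" using Q Q0 by (simp add: pos_divide_le_eq)
  finally have "1 / 2 \<le> real C * of_int q' / of_int q" by linarith
  then have "of_int q \<le> 2 * real C * of_int q'" using pos by (simp add: field_simps)
  then show ?thesis using pos by (simp add: field_simps)
qed

text \<open>At level i the progression has difference 2 ^ (i + 1), so the leading coefficient grows
  by G = 2 ^ (d (i + 1)), and the bracket of the Weyl bound is at most 3 G times l / q + 1 / n. As d
  \<le> D, the root of order D turns G into at most 2 ^ (i + 1), which the shorter length M = n / 2
  ^ (i + 1) makes up for. So all levels obey the same bound, and their number costs a factor linear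
  in r.\<close>

lemma tm_weyl_estimate:
  fixes d :: nat and \<epsilon> :: real
  assumes d: "d \<ge> 3" and \<epsilon>: "\<epsilon> > 0"
  shows "\<exists>A\<ge>1. \<forall>(f::real poly) (a::int) (q::int) (l::nat) (r::nat).
    degree f = d \<longrightarrow> q \<ge> 1 \<longrightarrow> gcd a q = 1 \<longrightarrow> \<bar>coeff f d - of_int a / of_int q\<bar> < 1 / (of_int q)\<^sup>2 \<longrightarrow>
    l \<ge> 1 \<longrightarrow> of_int q \<le> (2 ^ r :: real) ^ (d - 1) \<longrightarrow>
    norm (weyl_sum f r l) \<le> A * (real r + 1) * (2 ^ r) powr (1 + \<epsilon>) * (real l / of_int q + 1 / 2 ^ r) powr (1 / (real d * (real d - 1)))"
proof -
  define k where "k = d - 1"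
  have k: "k \<ge> 1" "Suc k = d" unfolding k_def using d by auto
  define D where "D = real d * (real d - 1)"
  have D: "real (2 * tri k) = D" unfolding two_tri D_def k_def using d by (simp add: of_nat_diff)
  have dD: "real d \<le> D" unfolding D_def using d by simp
  have D1: "D \<ge> 1" using dD d by simp
  obtain A0 where A0: "A0 \<ge> 1" and wb: "\<And>(N::nat) (F::real poly) (a::int) (q::nat). N \<ge> 1 \<Longrightarrow> degree F \<le> d \<Longrightarrow> q \<ge> 1 \<Longrightarrow> coprime a (int q) \<Longrightarrow>
     \<bar>coeff F d - of_int a / real q\<bar> \<le> 1 / (real q)\<^sup>2 \<Longrightarrow>
     norm (\<Sum>n<N. unit_exp (poly F (real n))) \<le>
       A0 * real N powr (1 + \<epsilon>) * (1 / real q + 1 / real N + real q / real N ^ d) powr (1 / D)"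
    using weyl_bound[OF k(1) \<epsilon>] unfolding k(2) D by blast
  show ?thesis
  proof (intro exI[of _ "3 * A0"] conjI allI impI)
    show "1 \<le> 3 * A0" using A0 by simp
    fix f :: "real poly" and a q :: int and l r :: nat
    assume f: "degree f = d" and q: "q \<ge> 1" and cop: "gcd a q = 1"
      and \<alpha>: "\<bar>coeff f d - of_int a / of_int q\<bar> < 1 / (of_int q)\<^sup>2" and l: "l \<ge> 1" and qr: "of_int q \<le> (2 ^ r :: real) ^ (d - 1)"
    define n :: real where "n = 2 ^ r"
    have n1: "n \<ge> 1" unfolding n_def by simp
    define Z where "Z = real l / of_int q + 1 / n"
    have Z0: "Z > 0" unfolding Z_def using n1 q by (intro add_nonneg_pos) auto
    define F where "F = smult (real l) f"
    have degF: "degree F \<le> d" unfolding F_def using f by simp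
    have wF: "weyl_sum f r l = tm_sum F r" unfolding weyl_sum_def tm_sum_def F_def by simp
    define X where "X = n powr (1 + \<epsilon>) * Z powr (1 / D)"
    have tm: "norm (tm_sum F r) \<le> 1 + (\<Sum>i<r. 3 * A0 * X)"
    proof (rule tm_sum_bound[OF degF])
      fix i F' assume i: "i < r" and F': "degree F' \<le> d" "coeff F' d = coeff F d * (2 ^ d) ^ (i + 1)"
      define C where "C = l * 2 ^ (d * (i + 1))"
      define G :: real where "G = 2 ^ (d * (i + 1))"
      define M :: nat where "M = 2 ^ (r - 1 - i)"
      \<comment> \<open>Large enough for \<open>denominator_bound\<close>, as q \<le> n ^ (d - 1),
        and small enough for q' / M ^ d to be at most 2 G / n.\<close>
      define Q :: nat where "Q = 2 * 2 ^ (r * (d - 1))"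
      have G1: "G \<ge> 1" unfolding G_def by simp
      have M1: "M \<ge> 1" unfolding M_def by simp
      have C1: "C \<ge> 1" unfolding C_def using l by simp
      have Q0: "Q > 0" unfolding Q_def by simp
      have CG: "real C = real l * G" unfolding C_def G_def by simp
      have Qn: "real Q = 2 * n ^ (d - 1)" unfolding Q_def n_def by (simp add: power_mult)
      have "r = (r - 1 - i) + (i + 1)" using i by simp
      then have nM: "n = real M * 2 ^ (i + 1)" unfolding n_def M_def by (metis of_nat_numeral of_nat_power power_add)
      have coF': "coeff F' d = real C * coeff f d"
        unfolding F'(2) F_def C_def by (simp add: power_add power_mult)
      obtain a' q' where q': "coprime a' q'" "0 < q'" "q' \<le> int Q" and ap: "\<bar>of_int q' * (real C * coeff f d) - of_int a'\<bar> < 1 / real Q"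
        using Dirichlet_approx_coprime[OF Q0] by blast
      have q'r: "real_of_int q' > 0" using q'(2) by simp
      have q'Q: "real_of_int q' \<le> real Q" using q'(3) by (metis of_int_le_iff of_int_of_nat_eq)
      have ap': "\<bar>real C * coeff f d - of_int a' / of_int q'\<bar> \<le> 1 / (of_int q' * real Q)"
      proof -
        have "real C * coeff f d - of_int a' / of_int q' = (of_int q' * (real C * coeff f d) - of_int a') / of_int q'"
          using q'r by (simp add: field_simps)
        then have "\<bar>real C * coeff f d - of_int a' / of_int q'\<bar> = \<bar>of_int q' * (real C * coeff f d) - of_int a'\<bar> / of_int q'"
          using q'r by (simp add: abs_divide)
        also have "\<dots> \<le> (1 / real Q) / of_int q'" using ap q'r by (intro divide_right_mono) auto
        finally show ?thesis by (simp add: mult.commute)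
      qed
      have inv: "1 / of_int q' \<le> 2 * real C / of_int q"
      proof (rule denominator_bound[OF q _ \<alpha> _ C1 _ ap'])
        show "coprime a q" using cop by (simp add: coprime_iff_gcd_eq_1)
        show "1 \<le> q'" using q' by simp
        show "2 * of_int q \<le> real Q" using qr unfolding Qn n_def by simp
      qed
      have w1: "norm (\<Sum>m<M. unit_exp (poly F' (real m))) \<le>
        A0 * real M powr (1 + \<epsilon>) * (1 / real (nat q') + 1 / real M + real (nat q') / real M ^ d) powr (1 / D)"
      proof (rule wb[OF M1 F'(1)])
        show "1 \<le> nat q'" using q' by simp
        show "coprime a' (int (nat q'))" using q' by simp
        have "1 / (real_of_int q' * real Q) \<le> 1 / (of_int q' * of_int q')"
          using q'r q'Q by (intro divide_left_mono mult_left_mono) (auto simp: Q0)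
        then show "\<bar>coeff F' d - of_int a' / real (nat q')\<bar> \<le> 1 / (real (nat q'))\<^sup>2"
          unfolding coF' using ap' q'(2) by (simp add: power2_eq_square)
      qed
      have nq: "real (nat q') = of_int q'" using q'(2) by simp
      have br: "1 / of_int q' + 1 / real M + of_int q' / real M ^ d \<le> 3 * G * Z"
      proof -
        have Mr: "real M > 0" using M1 by simp
        have "1 / of_int q' \<le> 2 * G * (real l / of_int q)" using inv unfolding CG by (simp add: mult_ac)
        moreover have "1 / real M \<le> G * (1 / n)"
        proof -
          have "1 * (i + 1) \<le> d * (i + 1)" using d by (intro mult_le_mono1) simp
          then have "(2::real) ^ (i + 1) \<le> G" unfolding G_def by (intro power_increasing) auto
          moreover have "1 / real M = 2 ^ (i + 1) / n" unfolding nM by simp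
          ultimately show ?thesis using n1 by (simp add: divide_right_mono)
        qed
        moreover have "of_int q' / real M ^ d \<le> 2 * G * (1 / n)"
        proof -
          have Gd: "G = (2 ^ (i + 1)) ^ d" unfolding G_def by (simp only: power_mult[symmetric] mult.commute)
          have nd: "n ^ d = real M ^ d * G" unfolding nM Gd by (rule power_mult_distrib)
          have "n ^ d = n ^ (d - 1) * n" using d by (metis One_nat_def Suc_pred power_Suc2 less_le_trans zero_less_numeral)
          then have "real Q / real M ^ d = 2 * G * (1 / n)"
            using nd Mr n1 unfolding Qn by (simp add: field_simps)
          moreover have "of_int q' / real M ^ d \<le> real Q / real M ^ d" using q'Q Mr by (intro divide_right_mono) auto
          ultimately show ?thesis by simp
        qed
        moreover have "0 \<le> G * (real l / of_int q)" using G1 q by simp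
        ultimately show ?thesis unfolding Z_def by (simp add: distrib_left)
      qed
      have pw: "(3 * G * Z) powr (1 / D) \<le> 3 * 2 ^ (i + 1) * Z powr (1 / D)"
      proof -
        have "(3::real) powr (1 / D) \<le> 3 powr 1" using D1 by (intro powr_mono) auto
        moreover have "G powr (1 / D) \<le> 2 ^ (i + 1)"
        proof -
          have "G powr (1 / D) = 2 powr (real (d * (i + 1)) * (1 / D))"
            unfolding G_def by (simp add: powr_powr flip: powr_realpow)
          also have "\<dots> \<le> 2 powr real (i + 1)"
          proof (rule powr_mono)
            have "real d / D \<le> 1" using dD D1 by simp
            then have "real d / D * real (i + 1) \<le> 1 * real (i + 1)" by (rule mult_right_mono) simp
            then show "real (d * (i + 1)) * (1 / D) \<le> real (i + 1)" by (simp only: of_nat_mult mult_1 times_divide_eq_left times_divide_eq_right mult_1_right)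
          qed simp
          also have "\<dots> = 2 ^ (i + 1)" by (subst powr_realpow) auto
          finally show ?thesis .
        qed
        ultimately show ?thesis using G1 Z0 by (simp only: powr_mult) (intro mult_mono, auto)
      qed
      have "(1 / of_int q' + 1 / real M + of_int q' / real M ^ d) powr (1 / D) \<le> (3 * G * Z) powr (1 / D)"
        using q'r D1 by (intro powr_mono2 br) (auto intro!: add_nonneg_nonneg)
      also note pw
      finally have "A0 * real M powr (1 + \<epsilon>) * (1 / of_int q' + 1 / real M + of_int q' / real M ^ d) powr (1 / D)
          \<le> A0 * real M powr (1 + \<epsilon>) * (3 * 2 ^ (i + 1) * Z powr (1 / D))"
        using A0 by (intro mult_left_mono) auto
      with w1 have "norm (\<Sum>m<M. unit_exp (poly F' (real m))) \<le> A0 * real M powr (1 + \<epsilon>) * (3 * 2 ^ (i + 1) * Z powr (1 / D))"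
        unfolding nq by (rule order.trans)
      also have "\<dots> \<le> A0 * (real M * n powr \<epsilon>) * (3 * 2 ^ (i + 1) * Z powr (1 / D))"
      proof (intro mult_right_mono mult_left_mono)
        have "real M * 1 \<le> real M * 2 ^ (i + 1)" by (intro mult_left_mono one_le_power) auto
        then have "real M \<le> n" unfolding nM by simp
        then have "real M powr \<epsilon> \<le> n powr \<epsilon>" using \<epsilon> by (intro powr_mono2) auto
        then show "real M powr (1 + \<epsilon>) \<le> real M * n powr \<epsilon>" using M1 by (simp add: powr_add mult_left_mono)
      qed (use A0 in auto)
      also have "\<dots> = 3 * A0 * (n * n powr \<epsilon> * Z powr (1 / D))" unfolding nM by simp
      also have "n * n powr \<epsilon> = n powr (1 + \<epsilon>)" using n1 by (simp add: powr_add)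
      finally show "norm (\<Sum>m<2 ^ (r - 1 - i). unit_exp (poly F' (real m))) \<le> 3 * A0 * X" unfolding M_def X_def by simp
    qed
    have X1: "1 \<le> X"
    proof -
      have "1 / n \<le> (1 / n) powr (1 / D)"
        using powr_mono'[of "1 / D" 1 "1 / n"] n1 D1 by simp
      also have "\<dots> \<le> Z powr (1 / D)" unfolding Z_def using n1 q D1 by (intro powr_mono2) auto
      finally have "n * (1 / n) \<le> n powr (1 + \<epsilon>) * Z powr (1 / D)"
        using n1 \<epsilon> powr_mono[of 1 "1 + \<epsilon>" n] by (intro mult_mono) auto
      then show ?thesis unfolding X_def using n1 by simp
    qed
    have "1 * X \<le> 3 * A0 * X" using A0 X1 by (intro mult_right_mono) auto
    moreover have "(\<Sum>i<r. 3 * A0 * X) = real r * (3 * A0 * X)" by simp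
    ultimately have "norm (tm_sum F r) \<le> 3 * A0 * X + real r * (3 * A0 * X)" using tm X1 by linarith
    also have "\<dots> = 3 * A0 * (real r + 1) * X" by (simp add: algebra_simps)
    finally show "norm (weyl_sum f r l) \<le> 3 * A0 * (real r + 1) * (2 ^ r) powr (1 + \<epsilon>) * (real l / of_int q + 1 / 2 ^ r) powr (1 / (real d * (real d - 1)))"
      unfolding wF X_def Z_def n_def D_def by (simp add: mult.assoc)
  qed
qed

section \<open>Deduction of the theorem\<close>

lemma linear_le_exponential:
  fixes A c :: real
  assumes "A \<ge> 1" "c > 0"
  shows "\<exists>r0::nat. \<forall>r\<ge>r0. A * (real r + 1) \<le> 2 powr (c * real r)"
proof -
  define b where "b = c * ln 2"
  have b: "b > 0" unfolding b_def using assms by simp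
  obtain r0 :: nat where r0: "4 * A / b\<^sup>2 \<le> real r0" using real_arch_simple by blast
  show ?thesis
  proof (intro exI[of _ "r0 + 1"] allI impI)
    fix r assume r: "r0 + 1 \<le> r"
    have "4 * A / b\<^sup>2 \<le> real r" using r0 r by linarith
    then have "4 * A \<le> b\<^sup>2 * real r" using b by (simp add: pos_divide_le_eq mult.commute)
    then have "4 * A * real r \<le> b\<^sup>2 * real r * real r" by (intro mult_right_mono) auto
    moreover have "A * (real r + 1) \<le> A * (2 * real r)" using assms r by (intro mult_left_mono) auto
    moreover have "A * (2 * real r) = 4 * A * real r / 2" "(b * real r)\<^sup>2 = b\<^sup>2 * real r * real r"
      by (simp_all add: power2_eq_square)
    ultimately have "A * (real r + 1) \<le> (b * real r)\<^sup>2 / 2" by linarith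
    also have "\<dots> \<le> exp (b * real r)"
    proof -
      have "0 \<le> b * real r" using b by simp
      then show ?thesis using exp_lower_Taylor_quadratic[of "b * real r"] by linarith
    qed
    also have "\<dots> = 2 powr (c * real r)" unfolding b_def powr_def by (simp add: mult_ac)
    finally show "A * (real r + 1) \<le> 2 powr (c * real r)" .
  qed
qed

lemma norm_weyl_sum_trivial: "norm (weyl_sum f r l) \<le> 2 ^ r"
proof -
  have "norm (of_int (thue_morse n * thue_morse (n + 1)) * unit_exp y) = 1" for n y
  proof -
    have "\<bar>thue_morse m\<bar> = 1" for m unfolding thue_morse_def by simp
    then have "\<bar>thue_morse n * thue_morse (n + 1)\<bar> = 1" by (simp add: abs_mult)
    then have "\<bar>real_of_int (thue_morse n * thue_morse (n + 1))\<bar> = 1" by (metis of_int_1 of_int_abs)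
    then show ?thesis by (simp only: norm_mult norm_of_int norm_unit_exp mult_1_right)
  qed
  then show ?thesis unfolding weyl_sum_def by (intro order.trans[OF norm_sum]) simp
qed

theorem theorem2p7:
  fixes d :: nat and \<epsilon> :: real
  assumes "d \<ge> 3" and "\<epsilon> > 0"
  shows "\<exists>r0::nat. \<forall>(f::real poly) (a::int) (q::int) (l::nat) (r::nat).
           degree f = d \<longrightarrow> coeff f 0 = 0 \<longrightarrow>
           q \<ge> 1 \<longrightarrow> gcd a q = 1 \<longrightarrow>
           \<bar>coeff f d - of_int a / of_int q\<bar> < 1 / (of_int q)\<^sup>2 \<longrightarrow>
           l \<ge> 1 \<longrightarrow> r \<ge> r0 \<longrightarrow>
           norm (weyl_sum f r l) \<le>
             2 powr ((1 + \<epsilon>) * real r) *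
             (real l powr eta1 d * of_int q powr (- eta1 d)
              + real l powr vartheta d * 2 powr (- zeta1 d * real r)
              + 2 powr (- zeta2 d * real r)
              + 2 powr (- zeta3 d * real r) * of_int q powr eta2 d) powr (1 / 2)"
proof -
  define D where "D = real d * (real d - 1)"
  have d3: "real d \<ge> 3" using assms(1) by simp
  have D0: "D > 0" unfolding D_def using d3 by simp
  have D1: "D \<ge> 1"
  proof -
    have "1 * 1 \<le> real d * (real d - 1)" using d3 by (intro mult_mono) auto
    then show ?thesis unfolding D_def by simp
  qed
  \<comment> \<open>This is the inequality between half of \<open>zeta2 d\<close> and 1 / D, with
    equality at d = 3; for \<open>eta1 d\<close> there is more room. So the saving 1 / D is strong
    enough under the square root.\<close>
  have "(real d - 2) * (real d - 3) \<ge> 0" using d3 by simp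
  then have z2: "D \<le> 2 * ((real d)\<^sup>2 - 3 * real d + 3)" and e1: "D \<le> 2 * ((real d)\<^sup>2 - 2 * real d + 2)"
    unfolding D_def power2_eq_square using d3 by (simp_all add: algebra_simps)
  have eta1: "eta1 d / 2 \<le> 1 / D" "0 < eta1 d"
  proof -
    have "0 < 2 * ((real d)\<^sup>2 - 2 * real d + 2)" using e1 D0 by linarith
    then show "eta1 d / 2 \<le> 1 / D" "0 < eta1 d"
      unfolding eta1_def using e1 D0 by (simp_all add: frac_le)
  qed
  have zeta2: "zeta2 d / 2 \<le> 1 / D"
  proof -
    have "0 < 2 * ((real d)\<^sup>2 - 3 * real d + 3)" using z2 D0 by linarith
    then show ?thesis unfolding zeta2_def using z2 D0 by (simp add: frac_le)
  qed
  obtain A where A: "A \<ge> 1" and est: "\<And>(f::real poly) (a::int) (q::int) (l::nat) (r::nat).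
    degree f = d \<Longrightarrow> q \<ge> 1 \<Longrightarrow> gcd a q = 1 \<Longrightarrow> \<bar>coeff f d - of_int a / of_int q\<bar> < 1 / (of_int q)\<^sup>2 \<Longrightarrow>
    l \<ge> 1 \<Longrightarrow> of_int q \<le> (2 ^ r :: real) ^ (d - 1) \<Longrightarrow>
    norm (weyl_sum f r l) \<le> A * (real r + 1) * (2 ^ r) powr (1 + \<epsilon> / 2) * (real l / of_int q + 1 / 2 ^ r) powr (1 / D)"
    using tm_weyl_estimate[OF assms(1), of "\<epsilon> / 2"] assms(2) unfolding D_def by auto
  \<comment> \<open>One half of \<epsilon> is spent in \<open>est\<close>; the other half pays for
    the linear factor in r and for the 2 lost when a sum of two terms is replaced by twice their
    maximum.\<close>
  obtain r0 where r0: "\<And>r. r \<ge> r0 \<Longrightarrow> 2 * A * (real r + 1) \<le> 2 powr (\<epsilon> / 2 * real r)"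
    using linear_le_exponential[of "2 * A" "\<epsilon> / 2"] A assms(2) by auto
  show ?thesis
  proof (intro exI[of _ r0] allI impI)
    fix f :: "real poly" and a q :: int and l r :: nat
    assume f: "degree f = d" and q: "q \<ge> 1" and cop: "gcd a q = 1"
      and \<alpha>: "\<bar>coeff f d - of_int a / of_int q\<bar> < 1 / (of_int q)\<^sup>2" and l: "l \<ge> 1" and r: "r \<ge> r0"
    define n :: real where "n = 2 ^ r"
    have n1: "n \<ge> 1" unfolding n_def by simp
    have qr: "real_of_int q \<ge> 1" using q by simp
    have npow: "2 powr (- z * real r) = n powr (- z)" for z
      unfolding n_def by (simp add: powr_realpow[symmetric] powr_powr mult.commute)
    have npow': "2 powr ((1 + \<epsilon>) * real r) = n powr (1 + \<epsilon>)"
      unfolding n_def by (simp add: powr_realpow[symmetric] powr_powr mult.commute)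
    define X1 X3 X4 where "X1 = real l powr eta1 d * of_int q powr (- eta1 d)"
      and "X3 = n powr (- zeta2 d)" and "X4 = n powr (- zeta3 d) * of_int q powr eta2 d"
    define X where "X = X1 + real l powr vartheta d * n powr (- zeta1 d) + X3 + X4"
    have X: "X1 \<le> X" "X3 \<le> X" "X4 \<le> X"
      unfolding X_def X1_def X3_def X4_def by (simp_all add: add_increasing add_increasing2)
    have X1eq: "X1 = (real l / of_int q) powr eta1 d"
      unfolding X1_def using qr by (simp add: powr_divide powr_minus_divide)
    have trivial: "norm (weyl_sum f r l) \<le> n powr (1 + \<epsilon>) * X powr (1 / 2)" if "1 \<le> X"
    proof -
      have "norm (weyl_sum f r l) \<le> n powr 1 * 1" using norm_weyl_sum_trivial[of f r l] n1 unfolding n_def by simp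
      also have "\<dots> \<le> n powr (1 + \<epsilon>) * X powr (1 / 2)"
        using n1 assms(2) that by (intro mult_mono powr_mono ge_one_powr_ge_zero) auto
      finally show ?thesis .
    qed
    have main: "norm (weyl_sum f r l) \<le> n powr (1 + \<epsilon>) * X powr (1 / 2)"
    \<comment> \<open>If q \<le> l, the first of the four terms is at least 1; if q > n ^ (d - 1),
      the last one is, because \<open>zeta3 d\<close> is (d - 1) times \<open>eta2 d\<close>. In
      both cases the trivial bound suffices.\<close>
    proof (cases "of_int q \<le> real l")
      case True
      then have "1 \<le> X1" unfolding X1eq using qr eta1 by (intro ge_one_powr_ge_zero) auto
      then show ?thesis using X trivial by linarith
    next
      case lq: False
      show ?thesis
      proof (cases "of_int q \<le> n ^ (d - 1)")
        case False
        have "1 = n powr (- zeta3 d) * (n powr (real d - 1)) powr eta2 d"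
          using n1 d3 unfolding zeta3_def eta2_def powr_powr powr_add[symmetric] by (simp add: power2_eq_square)
        also have "n powr (real d - 1) = n ^ (d - 1)"
          using n1 assms(1) by (simp add: powr_realpow[symmetric] of_nat_diff)
        also have "n powr (- zeta3 d) * (n ^ (d - 1)) powr eta2 d \<le> X4"
          unfolding X4_def using False n1 by (intro mult_left_mono powr_mono2) (auto simp: eta2_def)
        finally show ?thesis using X trivial by linarith
      next
        case True
        define z where "z = max (real l / of_int q) (1 / n)"
        have z0: "z > 0" unfolding z_def using n1 by (simp add: less_max_iff_disj)
        have zX: "z powr (1 / D) \<le> X powr (1 / 2)"
        proof -
          \<comment> \<open>For y \<le> 1, lowering the exponent from 1 / D to e / 2 only increases
            the power. For y = l / q this uses the present case l < q.\<close>
          have half: "y powr (1 / D) \<le> X powr (1 / 2)" if "0 < y" "y \<le> 1" "e / 2 \<le> 1 / D" "y powr e \<le> X" for y e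
          proof -
            have "y powr (1 / D) \<le> y powr (e / 2)" using that by (intro powr_mono') auto
            also have "\<dots> = (y powr e) powr (1 / 2)" by (simp add: powr_powr)
            also have "\<dots> \<le> X powr (1 / 2)" using that by (intro powr_mono2) auto
            finally show ?thesis .
          qed
          have "(real l / of_int q) powr (1 / D) \<le> X powr (1 / 2)"
            using l lq qr eta1(1) X(1) unfolding X1eq by (intro half) auto
          moreover have "(1 / n) powr zeta2 d = X3"
            unfolding X3_def using n1 by (simp add: powr_divide powr_minus_divide)
          then have "(1 / n) powr (1 / D) \<le> X powr (1 / 2)"
            using n1 zeta2 X(2) by (intro half) auto
          ultimately show ?thesis unfolding z_def by (simp add: max_def)
        qed
        have "(real l / of_int q + 1 / n) powr (1 / D) \<le> (2 * z) powr (1 / D)"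
          using n1 qr D0 unfolding z_def by (intro powr_mono2) auto
        also have "\<dots> = 2 powr (1 / D) * z powr (1 / D)" using z0 by (simp add: powr_mult)
        also have "\<dots> \<le> 2 powr 1 * X powr (1 / 2)"
          using D1 by (intro mult_mono powr_mono zX) auto
        finally have Y: "(real l / of_int q + 1 / n) powr (1 / D) \<le> 2 * X powr (1 / 2)" by simp
        have "norm (weyl_sum f r l) \<le> A * (real r + 1) * n powr (1 + \<epsilon> / 2) * (real l / of_int q + 1 / n) powr (1 / D)"
          using est[OF f q cop \<alpha> l] True unfolding n_def by simp
        also have "\<dots> \<le> A * (real r + 1) * n powr (1 + \<epsilon> / 2) * (2 * X powr (1 / 2))"
          using A Y by (intro mult_left_mono) auto
        also have "\<dots> = (2 * A * (real r + 1)) * (n powr (1 + \<epsilon> / 2) * X powr (1 / 2))" by simp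
        also have "\<dots> \<le> 2 powr (\<epsilon> / 2 * real r) * (n powr (1 + \<epsilon> / 2) * X powr (1 / 2))"
          using r0[OF r] by (intro mult_right_mono) auto
        also have "2 powr (\<epsilon> / 2 * real r) = n powr (\<epsilon> / 2)"
          unfolding n_def by (simp add: powr_realpow[symmetric] powr_powr mult.commute)
        also have "n powr (\<epsilon> / 2) * (n powr (1 + \<epsilon> / 2) * X powr (1 / 2)) = n powr (\<epsilon> / 2 + (1 + \<epsilon> / 2)) * X powr (1 / 2)"
          by (simp only: powr_add[of n "\<epsilon> / 2" "1 + \<epsilon> / 2"] mult.assoc)
        also have "\<epsilon> / 2 + (1 + \<epsilon> / 2) = 1 + \<epsilon>" by simp
        finally show ?thesis .
      qed
    qed
    then show "norm (weyl_sum f r l) \<le>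
             2 powr ((1 + \<epsilon>) * real r) *
             (real l powr eta1 d * of_int q powr (- eta1 d)
              + real l powr vartheta d * 2 powr (- zeta1 d * real r)
              + 2 powr (- zeta2 d * real r)
              + 2 powr (- zeta3 d * real r) * of_int q powr eta2 d) powr (1 / 2)"
      unfolding npow npow' X_def X1_def X3_def X4_def .
  qed
qed

end
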